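(* Suppose that $f$ is coercive, i.e. $\liminf_{\|x\|\to\infty} f(x)/\|x\|=\infty$. Let $\{(\bar x^j,\bar w^j)\}_{j\in\mathbb N}$ be the sequence generated by the semismooth Newton algorithm SNA applied to the problems $(P_k)$ and $(D_k)$ described in the context. Suppose further that: (a) for any $\gamma>0$, both $\mathrm{Prox}_{\gamma f^*}(\cdot)$ and $\mathrm{Prox}_{\gamma g^*}(\cdot)$ are semismooth; (b) there exists an accumulation point $\hat x^{k+1}$ of $\{\bar x^j\}_{j\in\mathbb N}$ such that every element of $\widehat\partial^2\Psi_k(\hat x^{k+1})$ is nonsingular. Then $\{\bar x^j\}_{j\in\mathbb N}$ converges to the global minimizer $\hat x^{k+1}$ of $(P_k)$ with Q-superlinear rate, i.e. $$\|\bar x^{j+1}-\hat x^{k+1}\|=o(\|\bar x^j-\hat x^{k+1}\|).$$ Moreover, $\{\bar w^j\}_{j\in\mathbb N}$ converges to the global minimizer $\hat w^{k+1}$ of $(D_k)$ with R-superlinear rate.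
   Context: **Data.** $f:\mathbb R^n\to(-\infty,\infty]$ and $g:\mathbb R^m\to(-\infty,\infty]$ are proper, closed, convex; $A:\mathbb R^n\to\mathbb R^m$ and $B:\mathbb R^n\to\mathbb R^p$ are linear (identified with matrices); $Qx:=[Ax;Bx]\in\mathbb R^{m+p}$; $M:=QQ^\top+I$; $\|w\|_M^2:=\langle w,Mw\rangle$. Vectors of $\mathbb R^{m+p}$ are written $w=[y;z]$ with $y\in\mathbb R^m$, $z\in\mathbb R^p$. $f^*,g^*$ are the Fenchel conjugates. $\mu\in\mathbb R^p$ has positive entries. For $T\subseteq[p]=\{1,\dots,p\}$, $\overline T=[p]\setminus T$, $z_T$ is the subvector of $z$ indexed by $T$, $B_{T:}$ the submatrix of rows indexed by $T$. For $\sigma>0$ and $\psi$ proper closed convex, $\mathcal E_{\sigma\psi}(p)=\min_x\{\frac1{2\sigma}\|x-p\|^2+\psi(x)\}$ and $\mathrm{Prox}_{\sigma\psi}(p)$ is the unique minimizer. **Semismoothness.** A locally Lipschitz map $F$ is semismooth at $x$ if it is directionally differentiable at $x$ and $F(x+d)-F(x)-Hd=o(\|d\|)$ for all $H\in\partial_CF(x+d)$ as $d\to0$, where $\partial_CF$ is the Clarke generalized Jacobian; it is semismooth if this holds at every point. **Subproblems.** Let $x^k\in\mathbb R^n$ and $w^k=[y^k;z^k]\in\mathbb R^{m+p}$ be the current primal and dual iterates of the outer proximal point algorithm for $\min_{w=[y;z]}\Xi(w)+\sum_{i=1}^p\mu_i\mathbb 1_{\{z_i\neq0\}}$, where $\Xi(w)=f^*(-Q^\top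 w)+g^*(y)$; let $\gamma_k>0$ and $$\Xi_k(w)=\Xi(w)+\tfrac1{2\gamma_k}\|w-w^k\|_M^2 .$$ The point $\tilde z^k\in\mathbb R^p$ is obtained by one cycle of coordinate minimization: successively for $i=1,\dots,p$, $\tilde z_i^k\in\operatorname{argmin}_{t\in\mathbb R}\ \Xi_k(y^k,\tilde z^k_1,\dots,\tilde z^k_{i-1},t,z^k_{i+1},\dots,z^k_p)+\mu_i\mathbb 1_{\{t\ne0\}}$. Put $\tilde w^k=[y^k;\tilde z^k]$ and $T_k=\{i\in[p]:\tilde z^k_i\ne0\}$. $(D_k)$ is the problem of minimizing $\Xi_k(w)$ over $w=[y;z]$ subject to $z_{\overline T_k}=0$. $(P_k)$ is the problem of minimizing over $x\in\mathbb R^n$ $$\Psi_k(x)=f_k(x)+g_k(Ax)+h_k(Bx),$$ where $f_k(x)=\mathcal E_{\frac1{\gamma_k}f}(x-Q^\top w^k/\gamma_k)-\frac1{2\gamma_k}\|Q^\top w^k\|^2$, $g_k(u)=\mathcal E_{\frac1{\gamma_k}g}(u+y^k/\gamma_k)-\frac1{2\gamma_k}\|y^k\|^2$, $h_k(v)=\frac{\gamma_k}2\|(v+z^k/\gamma_k)_{T_k}\|^2-\frac1{2\gamma_k}\|z^k\|^2$. These are convex with $\gamma_k$-Lipschitz gradients. **Generalized Hessian.** $\widehat\partial^2\Psi_k(x)=\partial^2f_k(x)+A^\top\partial^2g_k(Ax)A+\gamma_kB_{T_k:}^\top B_{T_k:}$ (a set of matrices), where $\partial^2 f_k,\partial^2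 g_k$ are the Clarke generalized Jacobians of $\nabla f_k,\nabla g_k$. **Algorithm SNA.** Parameters $\tau\in(0,1]$, $\tau_1,\tau_2,\beta\in(0,1)$, $\zeta\in(0,1/2)$; starting point $(\bar x^0,\bar w^0)=(x^k,\tilde w^k)$. For $j=0,1,\dots$: 1. Newton direction: compute $H_j\in\widehat\partial^2\Psi_k(\bar x^j)$ and $\theta_j=\tau_1\|\nabla\Psi_k(\bar x^j)\|$. Apply the conjugate gradient method to find an approximate solution $d^j$ to $(H_j+\theta_jI)d=-\nabla\Psi_k(\bar x^j)$ such that $\|(H_j+\theta_jI)d^j+\nabla\Psi_k(\bar x^j)\|\le\tau_2\|\nabla\Psi_k(\bar x^j)\|^{1+\tau}$. 2. Line search: set $\alpha_j=\beta^{q_j}$ with $q_j$ the smallest nonnegative integer $q$ such that $\Psi_k(\bar x^j+\beta^qd^j)\le\Psi_k(\bar x^j)+\zeta\beta^q\langle\nabla\Psi_k(\bar x^j),d^j\rangle$; set $\bar x^{j+1}=\bar x^j+\alpha_jd^j$. 3. Dual recovery: update $\bar w^j=[\bar y^j;\bar z^j]$ by $\bar y^j=\mathrm{Prox}_{\gamma_kg^*}(\gamma_kA\bar x^j+y^k)$, $\bar z^j_{T_k}=z^k_{T_k}+\gamma_kB_{T_k:}\bar x^j$, $\bar z^j_{\overline T_k}=0$. The theorem concerns the infinite sequence indexed by $j\in\mathbb N$, i.e. the algorithm without its stopping test. **R-superlinear convergence** of $\{\bar w^j\}$ to $\hat w$ means that $\|\bar w^j-\hat w\|$ is bounded above by a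 nonnegative sequence converging Q-superlinearly to $0$.
   Formalization: The conjugate gradient method is taken to start at 0 and to make at least one step; otherwise d^j = 0 can pass the residual test when the gradient is large, and the algorithm stalls at a point that is not the minimizer. *)

theory Defs
  imports "HOL-Analysis.Analysis" "HOL-Library.Landau_Symbols"
begin

definition proper_fun :: "('a \<Rightarrow> ereal) \<Rightarrow> bool" where
  "proper_fun \<psi> \<longleftrightarrow> (\<forall>x. \<psi> x \<noteq> -\<infinity>) \<and> (\<exists>x. \<psi> x \<noteq> \<infinity>)"

definition epi :: "('a \<Rightarrow> ereal) \<Rightarrow> ('a \<times> real) set" where
  "epi \<psi> = {(x, t). \<psi> x \<le> ereal t}"

definition proper_closed_convex :: "('a::euclidean_space \<Rightarrow> ereal) \<Rightarrow> bool" where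
  "proper_closed_convex \<psi> \<longleftrightarrow> proper_fun \<psi> \<and> closed (epi \<psi>) \<and> convex (epi \<psi>)"

definition fenchel_conj :: "('a::euclidean_space \<Rightarrow> ereal) \<Rightarrow> 'a \<Rightarrow> ereal" where
  "fenchel_conj \<psi> u = (SUP x. ereal (u \<bullet> x) - \<psi> x)"

definition prox_objective :: "real \<Rightarrow> ('a::euclidean_space \<Rightarrow> ereal) \<Rightarrow> 'a \<Rightarrow> 'a \<Rightarrow> ereal" where
  "prox_objective \<sigma> \<psi> v x = ereal (1 / (2 * \<sigma>) * (norm (x - v))\<^sup>2) + \<psi> x"

text \<open>For proper closed convex functions the infimum below is finite and attained at exactly one
  point, which is the value of \<open>prox\<close>.\<close>

definition moreau_env :: "real \<Rightarrow> ('a::euclidean_space \<Rightarrow> ereal) \<Rightarrow> 'a \<Rightarrow> ereal" where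
  "moreau_env \<sigma> \<psi> v = (INF x. prox_objective \<sigma> \<psi> v x)"

definition prox :: "real \<Rightarrow> ('a::euclidean_space \<Rightarrow> ereal) \<Rightarrow> 'a \<Rightarrow> 'a" where
  "prox \<sigma> \<psi> v = (THE x. is_arg_min (prox_objective \<sigma> \<psi> v) (\<lambda>_. True) x)"

definition coercive :: "('a::euclidean_space \<Rightarrow> ereal) \<Rightarrow> bool" where
  "coercive \<psi> \<longleftrightarrow> Liminf at_infinity (\<lambda>x. \<psi> x / ereal (norm x)) = \<infinity>"

definition unique_minimizer :: "('a \<Rightarrow> 'b::order) \<Rightarrow> ('a \<Rightarrow> bool) \<Rightarrow> 'a \<Rightarrow> bool" where
  "unique_minimizer \<phi> P x \<longleftrightarrow> is_arg_min \<phi> P x \<and> (\<forall>y. is_arg_min \<phi> P y \<longrightarrow> y = x)"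

definition grad :: "('a::euclidean_space \<Rightarrow> real) \<Rightarrow> 'a \<Rightarrow> 'a" where
  "grad \<phi> x = (THE D. GDERIV \<phi> x :> D)"

definition clarke_jacobian :: "(real^'a \<Rightarrow> real^'b) \<Rightarrow> real^'a \<Rightarrow> (real^'a^'b) set" where
  "clarke_jacobian F x = convex hull
     {J. \<exists>s. (\<forall>i::nat. F differentiable (at (s i))) \<and> s \<longlonglongrightarrow> x \<and>
             (\<lambda>i. jacobian F (at (s i))) \<longlonglongrightarrow> J}"

definition locally_lipschitz :: "('a::metric_space \<Rightarrow> 'b::metric_space) \<Rightarrow> bool" where
  "locally_lipschitz F \<longleftrightarrow> (\<forall>x. \<exists>e>0. \<exists>L. L-lipschitz_on (ball x e) F)"

definition directionally_differentiable_at ::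
    "('a::real_normed_vector \<Rightarrow> 'b::real_normed_vector) \<Rightarrow> 'a \<Rightarrow> bool" where
  "directionally_differentiable_at F x \<longleftrightarrow>
     (\<forall>d. \<exists>D. ((\<lambda>t. (F (x + t *\<^sub>R d) - F x) /\<^sub>R t) \<longlongrightarrow> D) (at_right 0))"

definition semismooth :: "(real^'a \<Rightarrow> real^'b) \<Rightarrow> bool" where
  "semismooth F \<longleftrightarrow> locally_lipschitz F \<and>
     (\<forall>x. directionally_differentiable_at F x \<and>
          (\<forall>\<epsilon>>0. \<exists>\<delta>>0. \<forall>d. norm d < \<delta> \<longrightarrow>
             (\<forall>H\<in>clarke_jacobian F (x + d). norm (F (x + d) - F x - H *v d) \<le> \<epsilon> * norm d)))"

definition R_superlinear :: "(nat \<Rightarrow> 'a::real_normed_vector) \<Rightarrow> 'a \<Rightarrow> bool" where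
  "R_superlinear w l \<longleftrightarrow> (\<exists>e::nat \<Rightarrow> real.
     (\<forall>j. 0 \<le> e j \<and> norm (w j - l) \<le> e j) \<and> e \<longlonglongrightarrow> 0 \<and> (\<lambda>j. e (Suc j)) \<in> o(e))"

text \<open>A vector \<open>[y; z]\<close> is represented by the pair \<open>(y, z)\<close>; the inner product and
  norm of the product type are those of the concatenated vector.  An index type of class
  \<open>{finite, linorder}\<close> plays the role of \<open>{1, \<dots>, p}\<close> with its order.\<close>

definition Q_op :: "real^'n^'m \<Rightarrow> real^'n^'p \<Rightarrow> real^'n \<Rightarrow> (real^'m) \<times> (real^'p)" where
  "Q_op A B x = (A *v x, B *v x)"

definition QT_op :: "real^'n^'m \<Rightarrow> real^'n^'p \<Rightarrow> (real^'m) \<times> (real^'p) \<Rightarrow> real^'n" where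
  "QT_op A B w = transpose A *v fst w + transpose B *v snd w"

definition M_op ::
    "real^'n^'m \<Rightarrow> real^'n^'p \<Rightarrow> (real^'m) \<times> (real^'p) \<Rightarrow> (real^'m) \<times> (real^'p)" where
  "M_op A B w = Q_op A B (QT_op A B w) + w"

text \<open>Subvectors and row submatrices are extended by zero outside \<open>T\<close>.  This changes
  neither the norm of a subvector nor the product of the transposed row submatrix with itself.\<close>

definition restrict_idx :: "'p set \<Rightarrow> 'a::zero ^ 'p \<Rightarrow> 'a ^ 'p" where
  "restrict_idx T v = (\<chi> i. if i \<in> T then v $ i else 0)"

definition Xi :: "(real^'n \<Rightarrow> ereal) \<Rightarrow> (real^'m \<Rightarrow> ereal) \<Rightarrow> real^'n^'m \<Rightarrow> real^'n^'p
    \<Rightarrow> (real^'m) \<times> (real^'p) \<Rightarrow> ereal" where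
  "Xi f g A B w = fenchel_conj f (- QT_op A B w) + fenchel_conj g (fst w)"

definition Xi_k :: "(real^'n \<Rightarrow> ereal) \<Rightarrow> (real^'m \<Rightarrow> ereal) \<Rightarrow> real^'n^'m \<Rightarrow> real^'n^'p
    \<Rightarrow> real \<Rightarrow> (real^'m) \<times> (real^'p) \<Rightarrow> (real^'m) \<times> (real^'p) \<Rightarrow> ereal" where
  "Xi_k f g A B \<gamma> wk w =
     Xi f g A B w + ereal (1 / (2 * \<gamma>) * ((w - wk) \<bullet> M_op A B (w - wk)))"

definition coordinate_cycle :: "(real^'n \<Rightarrow> ereal) \<Rightarrow> (real^'m \<Rightarrow> ereal) \<Rightarrow> real^'n^'m
    \<Rightarrow> real^'n^('p::{finite,linorder}) \<Rightarrow> real^('p::{finite,linorder}) \<Rightarrow> real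
    \<Rightarrow> (real^'m) \<times> (real^('p::{finite,linorder})) \<Rightarrow> real^('p::{finite,linorder}) \<Rightarrow> bool" where
  "coordinate_cycle f g A B \<mu> \<gamma> wk zt \<longleftrightarrow>
     (\<forall>i. is_arg_min
        (\<lambda>t. Xi_k f g A B \<gamma> wk
               (fst wk, \<chi> l. if l < i then zt $ l else if l = i then t else snd wk $ l)
             + ereal (if t \<noteq> 0 then \<mu> $ i else 0))
        (\<lambda>_. True) (zt $ i))"

definition f_k :: "(real^'n \<Rightarrow> ereal) \<Rightarrow> real^'n^'m \<Rightarrow> real^'n^'p \<Rightarrow> real
    \<Rightarrow> (real^'m) \<times> (real^'p) \<Rightarrow> real^'n \<Rightarrow> real" where
  "f_k f A B \<gamma> wk x =
     real_of_ereal (moreau_env (1 / \<gamma>) f (x - QT_op A B wk /\<^sub>R \<gamma>))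
     - 1 / (2 * \<gamma>) * (norm (QT_op A B wk))\<^sup>2"

definition g_k :: "(real^'m \<Rightarrow> ereal) \<Rightarrow> real \<Rightarrow> (real^'m) \<times> (real^'p) \<Rightarrow> real^'m \<Rightarrow> real" where
  "g_k g \<gamma> wk u =
     real_of_ereal (moreau_env (1 / \<gamma>) g (u + fst wk /\<^sub>R \<gamma>)) - 1 / (2 * \<gamma>) * (norm (fst wk))\<^sup>2"

definition h_k :: "real \<Rightarrow> (real^'m) \<times> (real^'p) \<Rightarrow> 'p set \<Rightarrow> real^'p \<Rightarrow> real" where
  "h_k \<gamma> wk T v =
     \<gamma> / 2 * (norm (restrict_idx T (v + snd wk /\<^sub>R \<gamma>)))\<^sup>2 - 1 / (2 * \<gamma>) * (norm (snd wk))\<^sup>2"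

definition Psi_k :: "(real^'n \<Rightarrow> ereal) \<Rightarrow> (real^'m \<Rightarrow> ereal) \<Rightarrow> real^'n^'m \<Rightarrow> real^'n^'p
    \<Rightarrow> real \<Rightarrow> (real^'m) \<times> (real^'p) \<Rightarrow> 'p set \<Rightarrow> real^'n \<Rightarrow> real" where
  "Psi_k f g A B \<gamma> wk T x = f_k f A B \<gamma> wk x + g_k g \<gamma> wk (A *v x) + h_k \<gamma> wk T (B *v x)"

definition gen_hessian :: "(real^'n \<Rightarrow> ereal) \<Rightarrow> (real^'m \<Rightarrow> ereal) \<Rightarrow> real^'n^'m \<Rightarrow> real^'n^'p
    \<Rightarrow> real \<Rightarrow> (real^'m) \<times> (real^'p) \<Rightarrow> 'p set \<Rightarrow> real^'n \<Rightarrow> (real^'n^'n) set" where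
  "gen_hessian f g A B \<gamma> wk T x =
     {V + transpose A ** W ** A
        + \<gamma> *\<^sub>R (transpose (restrict_idx T B) ** restrict_idx T B) | V W.
      V \<in> clarke_jacobian (grad (f_k f A B \<gamma> wk)) x \<and>
      W \<in> clarke_jacobian (grad (g_k g \<gamma> wk)) (A *v x)}"

text \<open>The conjugate gradient method for \<open>H d = b\<close>, started at \<open>0\<close>: the state consists of
  the iterate, the residual \<open>b - H d\<close> and the search direction.  Once the residual vanishes the
  iterate no longer changes, because division by zero yields zero.\<close>

primrec cg_state :: "real^'n^'n \<Rightarrow> real^'n \<Rightarrow> nat \<Rightarrow> (real^'n) \<times> (real^'n) \<times> (real^'n)" where
  "cg_state H b 0 = (0, b, b)"
| "cg_state H b (Suc i) =
     (let (d, r, s) = cg_state H b i;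
          a = (r \<bullet> r) / (s \<bullet> (H *v s));
          r' = r - a *\<^sub>R (H *v s);
          c = (r' \<bullet> r') / (r \<bullet> r)
      in (d + a *\<^sub>R s, r', r' + c *\<^sub>R s))"

definition cg_iterate :: "real^'n^'n \<Rightarrow> real^'n \<Rightarrow> nat \<Rightarrow> real^'n" where
  "cg_iterate H b i = fst (cg_state H b i)"

text \<open>At least one conjugate gradient step is made: the initial vector \<open>0\<close> satisfies the
  residual test whenever the gradient is large, but it is not a descent direction.\<close>

definition newton_direction :: "real \<Rightarrow> real \<Rightarrow> real \<Rightarrow> real^'n^'n \<Rightarrow> real^'n \<Rightarrow> real^'n \<Rightarrow> bool" where
  "newton_direction \<tau> \<tau>1 \<tau>2 H G d \<longleftrightarrow>
     (let K = H + (\<tau>1 * norm G) *\<^sub>R mat 1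
      in (\<exists>i\<ge>1. d = cg_iterate K (- G) i) \<and>
         norm (K *v d + G) \<le> \<tau>2 * norm G powr (1 + \<tau>))"

definition armijo :: "(real^'n \<Rightarrow> real) \<Rightarrow> real \<Rightarrow> real \<Rightarrow> real^'n \<Rightarrow> real^'n \<Rightarrow> nat \<Rightarrow> bool" where
  "armijo \<Psi> \<beta> \<zeta> x d q \<longleftrightarrow>
     \<Psi> (x + \<beta> ^ q *\<^sub>R d) \<le> \<Psi> x + \<zeta> * \<beta> ^ q * (grad \<Psi> x \<bullet> d)"

definition dual_recovery :: "(real^'m \<Rightarrow> ereal) \<Rightarrow> real^'n^'m \<Rightarrow> real^'n^'p \<Rightarrow> real
    \<Rightarrow> (real^'m) \<times> (real^'p) \<Rightarrow> 'p set \<Rightarrow> real^'n \<Rightarrow> (real^'m) \<times> (real^'p)" where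
  "dual_recovery g A B \<gamma> wk T x =
     (prox \<gamma> (fenchel_conj g) (\<gamma> *\<^sub>R (A *v x) + fst wk),
      restrict_idx T (snd wk + \<gamma> *\<^sub>R (B *v x)))"

text \<open>\<open>wbar j\<close> is the value after the dual recovery step of iteration \<open>j\<close>.  The initial
  dual vector is overwritten by that step in iteration \<open>0\<close> without having been used, so it does
  not appear here.\<close>

definition SNA_sequence :: "(real^'n \<Rightarrow> ereal) \<Rightarrow> (real^'m \<Rightarrow> ereal) \<Rightarrow> real^'n^'m \<Rightarrow> real^'n^'p
    \<Rightarrow> real \<Rightarrow> (real^'m) \<times> (real^'p) \<Rightarrow> 'p set
    \<Rightarrow> real \<Rightarrow> real \<Rightarrow> real \<Rightarrow> real \<Rightarrow> real \<Rightarrow> real^'n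
    \<Rightarrow> (nat \<Rightarrow> real^'n) \<Rightarrow> (nat \<Rightarrow> (real^'m) \<times> (real^'p)) \<Rightarrow> bool" where
  "SNA_sequence f g A B \<gamma> wk T \<tau> \<tau>1 \<tau>2 \<beta> \<zeta> x0 xbar wbar \<longleftrightarrow>
     (let \<Psi> = Psi_k f g A B \<gamma> wk T in
      xbar 0 = x0 \<and>
      (\<forall>j. \<exists>H d q.
         H \<in> gen_hessian f g A B \<gamma> wk T (xbar j) \<and>
         newton_direction \<tau> \<tau>1 \<tau>2 H (grad \<Psi> (xbar j)) d \<and>
         armijo \<Psi> \<beta> \<zeta> (xbar j) d q \<and> (\<forall>q'<q. \<not> armijo \<Psi> \<beta> \<zeta> (xbar j) d q') \<and>
         xbar (Suc j) = xbar j + \<beta> ^ q *\<^sub>R d \<and>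
         wbar j = dual_recovery g A B \<gamma> wk T (xbar j)))"

end

theory Submission
  imports Defs
begin

text \<open>By Moreau's decomposition, \<open>\<Psi>\<close> is convex with Lipschitz gradient
  \<open>\<nabla>\<Psi>(x) = p + A\<^sup>T y + B\<^sup>T z\<close>, where \<open>p\<close> and \<open>y\<close> are proximal points of \<open>f\<^sup>*\<close> and \<open>g\<^sup>*\<close> at affine
  functions of \<open>x\<close>.  Semismoothness of the two proximal maps therefore gives
  \<open>\<nabla>\<Psi>(x) - \<nabla>\<Psi>(xhat) - H (x - xhat) = o(\<parallel>x - xhat\<parallel>)\<close> for all \<open>H\<close> in the generalized Hessian at \<open>x\<close>, without
  any chain rule for Clarke Jacobians.  These matrices are symmetric and positive semidefinite, and
  upper semicontinuity makes them uniformly positive definite near \<open>xhat\<close>.  Every conjugate gradient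
  iterate decreases the quadratic model at least as much as the first one, so near \<open>xhat\<close> the line search
  yields a fixed decrease whenever \<open>\<nabla>\<Psi>\<close> is bounded away from \<open>0\<close>; hence \<open>\<nabla>\<Psi>(xhat) = 0\<close>.
  Near \<open>xhat\<close> the full Newton step contracts superlinearly, and it is accepted because
  \<open>\<Psi>(x) - \<Psi>(xhat) = 1/2 \<langle>\<nabla>\<Psi>(x), x - xhat\<rangle> + o(\<parallel>x - xhat\<parallel>\<^sup>2)\<close> and \<open>\<zeta> < 1/2\<close>.  On the dual side,
  completing the squares splits \<open>\<Xi>\<^sub>k\<close> into a constant and three proximal objectives, which the recovered point
  minimizes simultaneously exactly because \<open>\<nabla>\<Psi>(xhat) = 0\<close>.\<close>

section \<open>Smooth convex functions and proximal maps\<close>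

text \<open>The residual test says little far from a solution, since its bound
  \<open>\<tau>2 * norm G powr (1 + \<tau>)\<close> can exceed \<open>norm G\<close>. The global
  part therefore uses how conjugate gradients produce the direction, not how accurate it is; the
  test enters only near \<open>xhat\<close>. There \<Psi> need not have second derivatives, so the
  factor 1/2 that must beat \<zeta> cannot be read off a Taylor expansion. Instead, directional
  differentiability of \<open>G\<close> at \<open>xhat\<close>, made uniform over directions by
  compactness of the sphere, shows that \<open>G\<close> is nearly linear along rays from
  \<open>xhat\<close>, and integration along a ray gives 1/2. A second obstacle is that
  \<open>clarke_jacobian\<close> is built from points of differentiability and might be empty, which
  would make lower bounds quantified over Hessians vacuous at points that are not iterates.
  Uniqueness of the minimizer and the compactness argument for uniform positivity both depend on
  excluding this; a Baire category argument extracts a dense set of differentiability points from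
  directional differentiability.\<close>

lemma nonpos_if_le_small_multiples:
  fixes k C :: real
  assumes "\<And>s. 0 < s \<Longrightarrow> s \<le> 1 \<Longrightarrow> k \<le> s * C"
  shows "k \<le> 0"
proof (rule ccontr)
  assume k: "\<not> k \<le> 0"
  have kC: "k \<le> C" using assms[of 1] by simp
  \<comment> \<open>The multiple \<open>s = k / (2 * C)\<close> is admissible because
    \<open>k \<le> C\<close>, and it forces \<open>k \<le> k / 2\<close>.\<close>
  have "k \<le> k / (2 * C) * C" using k kC by (intro assms) (auto simp: field_simps)
  then show False using k kC by (simp add: field_simps)
qed

text \<open>Stating the bounds for an explicit \<open>G\<close> and all pairs of points lets sums,
  translations and matrix substitutions preserve them by direct calculation;
  \<open>smooth_convex_grad\<close> identifies \<open>G\<close> with \<open>grad\<close> afterwards.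
  The upper bound is the descent lemma that the line search relies on.\<close>

definition smooth_convex :: "real \<Rightarrow> ('a::euclidean_space \<Rightarrow> real) \<Rightarrow> ('a \<Rightarrow> 'a) \<Rightarrow> bool" where
  "smooth_convex L \<phi> G \<longleftrightarrow> L \<ge> 0 \<and> (\<forall>x y. \<phi> x + G x \<bullet> (y - x) \<le> \<phi> y \<and>
     \<phi> y \<le> \<phi> x + G x \<bullet> (y - x) + L / 2 * (norm (y - x))\<^sup>2 \<and> norm (G y - G x) \<le> L * norm (y - x))"

lemma smooth_convexD:
  assumes "smooth_convex L \<phi> G"
  shows "L \<ge> 0" "\<phi> x + G x \<bullet> (y - x) \<le> \<phi> y"
    "\<phi> y \<le> \<phi> x + G x \<bullet> (y - x) + L / 2 * (norm (y - x))\<^sup>2"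
    "norm (G y - G x) \<le> L * norm (y - x)"
  using assms unfolding smooth_convex_def by blast+

lemma smooth_convex_monotone:
  assumes "smooth_convex L \<phi> G"
  shows "(G y - G x) \<bullet> (y - x) \<ge> 0"
  using smooth_convexD(2)[OF assms, of x y] smooth_convexD(2)[OF assms, of y x]
  by (simp add: inner_diff_left inner_diff_right)

lemma smooth_convex_gderiv:
  assumes "smooth_convex L \<phi> G"
  shows "GDERIV \<phi> x :> G x"
  unfolding gderiv_def has_derivative_at_alt
proof (intro conjI allI impI)
  show "bounded_linear (\<lambda>h. h \<bullet> G x)" by (rule bounded_linear_inner_left)
  fix e :: real assume e: "e > 0"
  have L: "L \<ge> 0" by (rule smooth_convexD(1)[OF assms])
  \<comment> \<open>Dividing by \<open>L + 1\<close> instead of \<open>L\<close> keeps the radius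
    meaningful when \<open>L = 0\<close>; later radii and step bounds use the same device.\<close>
  show "\<exists>d>0. \<forall>y. norm (y - x) < d \<longrightarrow> norm (\<phi> y - \<phi> x - (y - x) \<bullet> G x) \<le> e * norm (y - x)"
  proof (intro exI[of _ "e / (L + 1)"] conjI allI impI)
    show "0 < e / (L + 1)" using e L by simp
    fix y assume y: "norm (y - x) < e / (L + 1)"
    have "L / 2 * (norm (y - x))\<^sup>2 \<le> (L + 1) * (norm (y - x))\<^sup>2"
      using L by (intro mult_right_mono) auto
    moreover have "norm (\<phi> y - \<phi> x - (y - x) \<bullet> G x) \<le> L / 2 * (norm (y - x))\<^sup>2"
      using smooth_convexD(2)[OF assms, of x y] smooth_convexD(3)[OF assms, of y x] by (simp add: inner_commute)
    ultimately have "norm (\<phi> y - \<phi> x - (y - x) \<bullet> G x) \<le> (L + 1) * norm (y - x) * norm (y - x)"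
      by (simp add: power2_eq_square mult.assoc)
    also have "\<dots> \<le> e * norm (y - x)"
      using y L by (intro mult_right_mono) (auto simp: field_simps)
    finally show "norm (\<phi> y - \<phi> x - (y - x) \<bullet> G x) \<le> e * norm (y - x)" .
  qed
qed

lemma gderiv_unique:
  fixes D E :: "'a::real_inner"
  assumes "GDERIV \<phi> x :> D" "GDERIV \<phi> x :> E"
  shows "D = E"
proof -
  have "(\<lambda>h. h \<bullet> D) = (\<lambda>h. h \<bullet> E)"
    using assms by (auto simp: gderiv_def intro: has_derivative_unique)
  then have "(D - E) \<bullet> D = (D - E) \<bullet> E" by meson
  then have "(D - E) \<bullet> (D - E) = 0" by (simp add: inner_diff_right)
  then show ?thesis by simp
qed

lemma smooth_convex_grad:
  assumes "smooth_convex L \<phi> G"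
  shows "grad \<phi> = G"
proof
  fix x show "grad \<phi> x = G x" unfolding grad_def
    using smooth_convex_gderiv[OF assms] gderiv_unique by blast
qed

lemma smooth_convex_add:
  assumes "smooth_convex L \<phi> F" "smooth_convex M \<psi> G"
  shows "smooth_convex (L + M) (\<lambda>x. \<phi> x + \<psi> x) (\<lambda>x. F x + G x)"
proof -
  note a = smooth_convexD[OF assms(1)] and b = smooth_convexD[OF assms(2)]
  show ?thesis unfolding smooth_convex_def
  proof (intro conjI allI)
    show "L + M \<ge> 0" using a(1) b(1) by simp
    fix x y
    show "\<phi> x + \<psi> x + (F x + G x) \<bullet> (y - x) \<le> \<phi> y + \<psi> y"
      using a(2)[of x y] b(2)[of x y] by (simp add: inner_add_left)
    show "\<phi> y + \<psi> y \<le> \<phi> x + \<psi> x + (F x + G x) \<bullet> (y - x) + (L + M) / 2 * (norm (y - x))\<^sup>2"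
      using a(3)[of y x] b(3)[of y x] by (simp add: inner_add_left add_divide_distrib distrib_right)
    have "norm (F y + G y - (F x + G x)) \<le> norm (F y - F x) + norm (G y - G x)"
      by (metis add_diff_add norm_triangle_ineq)
    then show "norm (F y + G y - (F x + G x)) \<le> (L + M) * norm (y - x)"
      using a(4)[of y x] b(4)[of y x] by (simp add: distrib_right)
  qed
qed

lemma smooth_convex_translate:
  assumes "smooth_convex L \<phi> G"
  shows "smooth_convex L (\<lambda>x. \<phi> (x + a) + c) (\<lambda>x. G (x + a))"
proof -
  have "L \<ge> 0" by (rule smooth_convexD(1)[OF assms])
  moreover have "\<phi> (x + a) + c + G (x + a) \<bullet> (y - x) \<le> \<phi> (y + a) + c \<and>
      \<phi> (y + a) + c \<le> \<phi> (x + a) + c + G (x + a) \<bullet> (y - x) + L / 2 * (norm (y - x))\<^sup>2 \<and>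
      norm (G (y + a) - G (x + a)) \<le> L * norm (y - x)" for x y
    using smooth_convexD(2)[OF assms, of "x + a" "y + a"]
      smooth_convexD(3,4)[OF assms, of "y + a" "x + a"] by simp
  ultimately show ?thesis unfolding smooth_convex_def by blast
qed

lemma norm_matrix_vector_mult_le:
  fixes A :: "real^'n^'m"
  shows "norm (A *v x) \<le> norm A * norm x"
proof -
  have "norm (A *v x) \<le> L2_set (\<lambda>i. norm (A $ i) * norm x) UNIV"
    unfolding norm_vec_def[of "A *v x"]
    by (rule L2_set_mono) (auto simp: matrix_vector_mul_component Cauchy_Schwarz_ineq2)
  also have "\<dots> = norm A * norm x"
    by (simp add: norm_vec_def[of A] L2_set_left_distrib)
  finally show ?thesis .
qed

lemma norm_transpose: "norm (transpose A) = norm (A :: real^'n^'m)"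
proof -
  have "norm (transpose A)^2 = norm A ^2"
    unfolding power2_norm_eq_inner inner_vec_def transpose_def
    by simp (rule sum.swap)
  then show ?thesis by simp
qed

lemma inner_transpose: "(transpose A *v u) \<bullet> x = u \<bullet> ((A :: real^'n^'m) *v x)"
  by (metis dot_lmul_matrix inner_commute vector_transpose_matrix transpose_transpose)

lemma smooth_convex_compose_matrix:
  fixes A :: "real^'n^'m"
  assumes "smooth_convex L \<phi> G"
  shows "smooth_convex (L * (norm A)\<^sup>2) (\<lambda>x. \<phi> (A *v x)) (\<lambda>x. transpose A *v G (A *v x))"
proof -
  note a = smooth_convexD[OF assms]
  have sub: "A *v y - A *v x = A *v (y - x)" for x y by (simp add: matrix_vector_mult_diff_distrib)
  show ?thesis unfolding smooth_convex_def
  proof (intro conjI allI)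
    show "0 \<le> L * (norm A)\<^sup>2" using a(1) by simp
    fix x y
    show "\<phi> (A *v x) + (transpose A *v G (A *v x)) \<bullet> (y - x) \<le> \<phi> (A *v y)"
      using a(2)[of "A *v x" "A *v y"] by (simp add: sub inner_transpose del: transpose_matrix_vector)
    have "L / 2 * (norm (A *v (y - x)))\<^sup>2 \<le> L / 2 * (norm A * norm (y - x))\<^sup>2"
      using a(1) by (intro mult_left_mono power_mono norm_matrix_vector_mult_le) auto
    then show "\<phi> (A *v y) \<le> \<phi> (A *v x) + (transpose A *v G (A *v x)) \<bullet> (y - x)
        + L * (norm A)\<^sup>2 / 2 * (norm (y - x))\<^sup>2"
      using a(3)[of "A *v y" "A *v x"] by (simp add: sub inner_transpose power_mult_distrib del: transpose_matrix_vector)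
    have "norm (transpose A *v G (A *v y) - transpose A *v G (A *v x))
        \<le> norm A * norm (G (A *v y) - G (A *v x))"
      by (metis norm_matrix_vector_mult_le norm_transpose matrix_vector_mult_diff_distrib)
    also have "\<dots> \<le> norm A * (L * (norm A * norm (y - x)))"
      using a(4)[of "A *v y" "A *v x"] a(1) norm_matrix_vector_mult_le[of A "y - x"]
      by (intro mult_left_mono) (auto simp: sub intro: order_trans mult_left_mono)
    finally show "norm (transpose A *v G (A *v y) - transpose A *v G (A *v x))
        \<le> L * (norm A)\<^sup>2 * norm (y - x)"
      by (simp add: power2_eq_square ac_simps)
  qed
qed

section \<open>Existence and variational characterization of proximal points\<close>

lemma epi_iff: "(x, t) \<in> epi \<psi> \<longleftrightarrow> \<psi> x \<le> ereal t"
  by (simp add: epi_def)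

text \<open>The closed epigraph stands in for lower semicontinuity: points with values below
  \<open>-n\<close> would accumulate at a point lying below every height, hence of value
  \<open>-\<infinity>\<close>.\<close>

lemma closed_epi_bounded_below_on_compact:
  fixes \<psi> :: "'a::euclidean_space \<Rightarrow> ereal"
  assumes cl: "closed (epi \<psi>)" and ninf: "\<And>x. \<psi> x \<noteq> -\<infinity>" and S: "compact S"
  obtains m where "\<And>x. x \<in> S \<Longrightarrow> ereal m \<le> \<psi> x"
proof -
  have "\<exists>n::nat. \<forall>x\<in>S. ereal (- real n) \<le> \<psi> x"
  proof (rule ccontr)
    assume "\<not> ?thesis"
    then have "\<forall>n::nat. \<exists>x\<in>S. \<psi> x < ereal (- real n)" by (auto simp: not_le)
    then obtain X where X: "\<And>n::nat. X n \<in> S" "\<And>n. \<psi> (X n) < ereal (- real n)" by metis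
    obtain l r where lr: "l \<in> S" "strict_mono r" "(X \<circ> r) \<longlonglongrightarrow> l"
      using S X(1) unfolding compact_def by metis
    \<comment> \<open>Dropping the first \<open>N\<close> terms puts the whole tail below the fixed
      height \<open>-N\<close>, so closedness applies with a constant second component.\<close>
    have "(l, - real N) \<in> epi \<psi>" for N
    proof (rule closed_sequentially[OF cl])
      show "(\<lambda>n. ((X \<circ> r) (n + N), - real N)) \<longlonglongrightarrow> (l, - real N)"
        by (intro tendsto_Pair tendsto_const LIMSEQ_ignore_initial_segment lr)
      fix n
      have "\<psi> (X (r (n + N))) \<le> ereal (- real (r (n + N)))" using X(2) less_imp_le by blast
      also have "\<dots> \<le> ereal (- real N)" using seq_suble[OF lr(2), of "n + N"] by simp
      finally show "((X \<circ> r) (n + N), - real N) \<in> epi \<psi>" by (simp add: epi_iff)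
    qed
    then have *: "\<psi> l \<le> ereal (- real N)" for N by (simp add: epi_iff)
    show False
    proof (cases "\<psi> l")
      case (real b)
      obtain N where "- b < real N" using reals_Archimedean2 by blast
      then show False using *[of N] real by simp
    qed (use * ninf in auto)
  qed
  then show ?thesis using that by blast
qed

text \<open>The function is bounded below on a unit ball around a point \<open>x0\<close> of its
  domain, and convexity on segments from \<open>x0\<close> propagates this bound linearly to all of
  space. This is weaker than an affine minorant but still dominated by a quadratic.\<close>

lemma proper_closed_convex_minorant:
  fixes \<psi> :: "'a::euclidean_space \<Rightarrow> ereal"
  assumes "proper_closed_convex \<psi>"
  obtains C where "C \<ge> 0" "\<And>x. ereal (- C * (1 + norm (x - v))) \<le> \<psi> x"
proof -
  have ninf: "\<And>x. \<psi> x \<noteq> -\<infinity>" and cl: "closed (epi \<psi>)" and co: "convex (epi \<psi>)"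
    using assms by (auto simp: proper_closed_convex_def proper_fun_def)
  obtain x0 where "\<psi> x0 \<noteq> \<infinity>" using assms by (auto simp: proper_closed_convex_def proper_fun_def)
  then obtain a0 where a0: "\<psi> x0 = ereal a0" using ninf[of x0] by (cases "\<psi> x0") auto
  obtain m where m: "\<And>x. x \<in> cball x0 1 \<Longrightarrow> ereal m \<le> \<psi> x"
    using closed_epi_bounded_below_on_compact[OF cl ninf compact_cball] by blast
  define C where "C = \<bar>m\<bar> + \<bar>a0\<bar>"
  have C: "C \<ge> 0" by (simp add: C_def)
  have b: "ereal (- C * (1 + norm (x - x0))) \<le> \<psi> x" for x
  proof (cases "norm (x - x0) \<le> 1")
    case True
    have "C * (1 + norm (x - x0)) \<ge> C" using C by (simp add: distrib_left)
    moreover have "- C \<le> m" unfolding C_def by auto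
    ultimately have "- C * (1 + norm (x - x0)) \<le> m" by simp
    moreover have "ereal m \<le> \<psi> x" using True by (intro m) (simp add: dist_norm norm_minus_commute)
    ultimately show ?thesis by (meson ereal_less_eq(3) order_trans)
  next
    case False
    define r where "r = norm (x - x0)"
    have r: "r > 1" using False by (simp add: r_def)
    show ?thesis
    proof (cases "\<psi> x")
      case (real b)
      \<comment> \<open>\<open>z\<close> is where the segment from \<open>x0\<close> to
        \<open>x\<close> meets the unit sphere around \<open>x0\<close>; the lower bound at
        \<open>z\<close> forces one on the value \<open>b\<close> at the far end.\<close>
      define z where "z = (1 - 1/r) *\<^sub>R x0 + (1/r) *\<^sub>R x"
      have "(1 - 1/r) *\<^sub>R (x0, a0) + (1/r) *\<^sub>R (x, b) \<in> epi \<psi>"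
        using r a0 real by (intro convexD[OF co]) (auto simp: epi_iff)
      then have z1: "\<psi> z \<le> ereal ((1 - 1/r) * a0 + b / r)" by (simp add: z_def epi_iff)
      have "z - x0 = (1/r) *\<^sub>R (x - x0)" by (simp add: z_def algebra_simps)
      then have "norm (z - x0) = 1 / r * r" using r by (simp only: norm_scaleR r_def) simp
      then have "norm (z - x0) = 1" using r by simp
      then have "ereal m \<le> \<psi> z" by (intro m) (simp add: dist_norm norm_minus_commute)
      then have "m \<le> (1 - 1/r) * a0 + b / r" using z1 by (meson ereal_less_eq(3) order_trans)
      then have "m * r - (r - 1) * a0 \<le> b" using r by (simp add: field_simps)
      moreover have "m * r \<ge> - (\<bar>m\<bar> * r)" using r
        by (metis abs_ge_minus_self abs_mult abs_of_pos less_trans minus_le_iff zero_less_one)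
      moreover have "(r - 1) * a0 \<le> \<bar>a0\<bar> * r" using r
        by (smt (verit) mult_less_0_iff mult_mono' mult.commute)
      ultimately have "- C * r \<le> b" unfolding C_def minus_add_distrib distrib_right by linarith
      then have "- C * (1 + r) \<le> b" using C by (simp add: algebra_simps)
      then show ?thesis by (simp add: real r_def)
    qed (use ninf in auto)
  qed
  show ?thesis
  proof (rule that[of "C * (1 + norm (v - x0))"])
    show "0 \<le> C * (1 + norm (v - x0))" using C by simp
    fix x
    have "norm (x - x0) \<le> norm (x - v) + norm (v - x0)"
      by (metis diff_add_cancel add_diff_eq norm_triangle_ineq)
    moreover have "0 \<le> norm (v - x0) * norm (x - v)" by simp
    ultimately have "1 + norm (x - x0) \<le> (1 + norm (v - x0)) * (1 + norm (x - v))"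
      by (simp only: distrib_left distrib_right)
    then have "C * (1 + norm (x - x0)) \<le> C * (1 + norm (v - x0)) * (1 + norm (x - v))"
      using C by (simp add: mult_left_mono mult.assoc)
    then show "ereal (- (C * (1 + norm (v - x0))) * (1 + norm (x - v))) \<le> \<psi> x"
      using b[of x] by (smt (verit, best) ereal_less_eq(3) mult_minus_left order_trans)
  qed
qed

text \<open>Minimizing the continuous function \<open>q\<close> over part of the epigraph turns the
  extended-valued problem into the extreme value theorem; the sublevel set is bounded because the
  quadratic term dominates the linear minorant.\<close>

lemma prox_exists:
  fixes \<psi> :: "'a::euclidean_space \<Rightarrow> ereal"
  assumes pcc: "proper_closed_convex \<psi>" and \<gamma>: "\<gamma> > 0"
  obtains p a where "is_arg_min (prox_objective (1/\<gamma>) \<psi> v) (\<lambda>_. True) p" "\<psi> p = ereal a"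
proof -
  have ninf: "\<And>x. \<psi> x \<noteq> -\<infinity>" and cl: "closed (epi \<psi>)"
    using assms by (auto simp: proper_closed_convex_def proper_fun_def)
  obtain x0 where "\<psi> x0 \<noteq> \<infinity>" using assms by (auto simp: proper_closed_convex_def proper_fun_def)
  then obtain a0 where a0: "\<psi> x0 = ereal a0" using ninf[of x0] by (cases "\<psi> x0") auto
  obtain C where C: "C \<ge> 0" "\<And>x. ereal (- C * (1 + norm (x - v))) \<le> \<psi> x"
    using proper_closed_convex_minorant[OF pcc] by blast
  define q where "q z = snd z + \<gamma>/2 * (norm (fst z - v))\<^sup>2" for z :: "'a \<times> real"
  define c0 where "c0 = q (x0, a0)"
  define S where "S = epi \<psi> \<inter> {z. q z \<le> c0}"
  have qc: "continuous_on UNIV q" unfolding q_def by (intro continuous_intros)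
  have "closed S" unfolding S_def
    using cl qc by (intro closed_Int closed_Collect_le) (auto intro: continuous_intros)
  moreover have "bounded S"
  proof -
    \<comment> \<open>For \<open>\<rho> > 1\<close>, \<open>\<bar>c0\<bar>\<close> is at most
      \<open>\<bar>c0\<bar> * \<rho>\<close> and \<open>1 + \<rho>\<close> at most
      \<open>2 * \<rho>\<close>, which produces the slope \<open>K\<close>; comparison with
      \<open>\<gamma>/2 * \<rho>\<^sup>2\<close> produces the radius \<open>R\<close>.\<close>
    define K where "K = \<bar>c0\<bar> + 2 * C"
    define R where "R = max 1 (2 * K / \<gamma>)"
    have "S \<subseteq> cball v R \<times> {- C * (1 + R)..c0}"
    proof clarify
      fix x t assume "(x, t) \<in> S"
      then have t1: "\<psi> x \<le> ereal t" and t2: "t + \<gamma>/2 * (norm (x - v))\<^sup>2 \<le> c0"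
        by (auto simp: S_def epi_iff q_def)
      define \<rho> where "\<rho> = norm (x - v)"
      have \<rho>: "\<rho> \<ge> 0" by (simp add: \<rho>_def)
      have t3: "- C * (1 + \<rho>) \<le> t" using C(2)[of x] t1 unfolding \<rho>_def by (meson ereal_less_eq(3) order_trans)
      have "\<rho> \<le> R"
      proof (cases "\<rho> \<le> 1")
        case False
        have "\<gamma>/2 * \<rho>\<^sup>2 \<le> c0 + C * (1 + \<rho>)" using t2 t3 by (simp add: \<rho>_def)
        also have "\<dots> \<le> \<bar>c0\<bar> * \<rho> + C * (2 * \<rho>)"
          using False C(1) by (intro add_mono mult_left_mono) (auto simp: mult_le_cancel_left1 intro: order_trans[OF abs_ge_self])
        also have "\<dots> = K * \<rho>" by (simp add: K_def algebra_simps)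
        finally have "(\<gamma>/2 * \<rho>) * \<rho> \<le> K * \<rho>" by (simp add: power2_eq_square)
        then have "\<gamma>/2 * \<rho> \<le> K" using False by (simp add: mult_le_cancel_right)
        then show ?thesis using \<gamma> unfolding R_def by (simp add: field_simps le_max_iff_disj)
      qed (simp add: R_def)
      moreover have "- C * (1 + R) \<le> t" using t3 C(1) \<open>\<rho> \<le> R\<close>
        by (smt (verit) mult_left_mono mult_minus_left)
      moreover have "t \<le> c0" using t2 \<gamma> by (smt (verit) mult_nonneg_nonneg zero_le_power2 half_gt_zero)
      ultimately show "x \<in> cball v R \<and> t \<in> {- C * (1 + R)..c0}"
        by (simp add: \<rho>_def dist_norm norm_minus_commute)
    qed
    then show ?thesis by (rule bounded_subset[OF bounded_Times[OF bounded_cball bounded_closed_interval]])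
  qed
  ultimately have "compact S" by (simp add: compact_eq_bounded_closed)
  moreover have x0S: "(x0, a0) \<in> S" using a0 by (auto simp: S_def c0_def epi_iff)
  ultimately obtain z where z: "z \<in> S" "\<And>y. y \<in> S \<Longrightarrow> q z \<le> q y"
    using continuous_attains_inf[of S q] continuous_on_subset[OF qc] by blast
  obtain p t where pt: "z = (p, t)" by (cases z)
  have "\<psi> p \<le> ereal t" using z(1) pt by (simp add: S_def epi_iff)
  \<comment> \<open>Lowering the height \<open>t\<close> to the function value stays in
    \<open>S\<close> and does not increase \<open>q\<close>, so the minimizer may be taken on the
    graph.\<close>
  then obtain a where a: "\<psi> p = ereal a" "a \<le> t" using ninf[of p] by (cases "\<psi> p") auto
  have paS: "(p, a) \<in> S" using z(1) a pt by (auto simp: S_def epi_iff q_def)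
  have obj: "prox_objective (1/\<gamma>) \<psi> v x = ereal (q (x, b))" if "\<psi> x = ereal b" for x b
    using that by (simp add: prox_objective_def q_def add.commute)
  have min: "q (p, a) \<le> q y" if "y \<in> S" for y using z(2)[OF that] a(2) by (simp add: pt q_def)
  have "\<not> prox_objective (1/\<gamma>) \<psi> v y < prox_objective (1/\<gamma>) \<psi> v p" for y
  proof
    assume less: "prox_objective (1/\<gamma>) \<psi> v y < prox_objective (1/\<gamma>) \<psi> v p"
    then have "\<psi> y \<noteq> \<infinity>" by (auto simp: prox_objective_def)
    then obtain b where b: "\<psi> y = ereal b" using ninf[of y] by (cases "\<psi> y") auto
    have "q (y, b) < q (p, a)" using less by (simp add: obj[OF b] obj[OF a(1)])
    moreover have "q (p, a) \<le> c0" using paS by (simp add: S_def)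
    ultimately have "(y, b) \<in> S" using b by (auto simp: S_def epi_iff)
    then show False using min \<open>q (y, b) < q (p, a)\<close> by fastforce
  qed
  then show ?thesis using that[of p a] a(1) by (simp add: is_arg_min_def)
qed

lemma norm_add_sq: "(norm (a + b))\<^sup>2 = (norm a)\<^sup>2 + 2 * (a \<bullet> b) + (norm (b::'a::real_inner))\<^sup>2"
  by (simp add: power2_norm_eq_inner inner_add_left inner_add_right inner_commute)

text \<open>Moving from \<open>p\<close> towards \<open>x\<close> by a fraction \<open>s\<close>
  changes the quadratic term by an inner product of order \<open>s\<close> and a norm of order
  \<open>s\<^sup>2\<close>. Minimality divided by \<open>s\<close> leaves only the inner product as
  \<open>s\<close> tends to 0.\<close>

lemma prox_subgradient:
  fixes \<psi> :: "'a::euclidean_space \<Rightarrow> ereal"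
  assumes pcc: "proper_closed_convex \<psi>" and \<gamma>: "\<gamma> > 0"
    and p: "is_arg_min (prox_objective (1/\<gamma>) \<psi> v) (\<lambda>_. True) p" and a: "\<psi> p = ereal a"
  shows "ereal (a + \<gamma> * ((v - p) \<bullet> (x - p))) \<le> \<psi> x"
proof (cases "\<psi> x")
  case (real b)
  have co: "convex (epi \<psi>)" using pcc by (simp add: proper_closed_convex_def)
  have "a - b + \<gamma> * ((v - p) \<bullet> (x - p)) \<le> 0"
  proof (rule nonpos_if_le_small_multiples[where C = "\<gamma> / 2 * (norm (x - p))\<^sup>2"])
    fix s :: real assume s: "0 < s" "s \<le> 1"
    define y where "y = p + s *\<^sub>R (x - p)"
    have "(1 - s) *\<^sub>R (p, a) + s *\<^sub>R (x, b) \<in> epi \<psi>"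
      using s a real by (intro convexD[OF co]) (auto simp: epi_iff)
    moreover have "(1 - s) *\<^sub>R p + s *\<^sub>R x = y" by (simp add: y_def algebra_simps)
    ultimately have y: "\<psi> y \<le> ereal ((1 - s) * a + s * b)" by (simp add: epi_iff)
    have "prox_objective (1/\<gamma>) \<psi> v p \<le> prox_objective (1/\<gamma>) \<psi> v y"
      using p by (auto simp: is_arg_min_def not_less)
    also have "\<dots> \<le> ereal (\<gamma> / 2 * (norm (y - v))\<^sup>2 + ((1 - s) * a + s * b))"
      using y by (simp add: prox_objective_def add_left_mono flip: plus_ereal.simps)
    finally have "\<gamma> / 2 * (norm (p - v))\<^sup>2 + a \<le> \<gamma> / 2 * (norm (y - v))\<^sup>2 + ((1 - s) * a + s * b)"
      by (simp add: prox_objective_def a)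
    moreover have "y - v = (p - v) + s *\<^sub>R (x - p)" by (simp add: y_def)
    then have "(norm (y - v))\<^sup>2 = (norm (p - v))\<^sup>2 - 2 * s * ((v - p) \<bullet> (x - p)) + s\<^sup>2 * (norm (x - p))\<^sup>2"
      by (simp only: norm_add_sq) (simp add: power_mult_distrib inner_diff_left right_diff_distrib)
    moreover have "\<gamma> / 2 * k + a \<le> \<gamma> / 2 * l + ((1 - s) * a + s * b) \<Longrightarrow> l = k - 2 * s * i + s\<^sup>2 * n \<Longrightarrow>
        s * (a - b + \<gamma> * i) \<le> s * (s * (\<gamma> / 2 * n))" for i k l n
      by (simp add: algebra_simps power2_eq_square)
    ultimately have "s * (a - b + \<gamma> * ((v - p) \<bullet> (x - p))) \<le> s * (s * (\<gamma> / 2 * (norm (x - p))\<^sup>2))"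
      by blast
    then show "a - b + \<gamma> * ((v - p) \<bullet> (x - p)) \<le> s * (\<gamma> / 2 * (norm (x - p))\<^sup>2)"
      using s by (simp add: mult_le_cancel_left)
  qed
  then show ?thesis by (simp add: real)
next
  case MInf
  then show ?thesis using pcc by (auto simp: proper_closed_convex_def proper_fun_def)
qed simp

text \<open>If \<open>P\<close> is the proximal point of \<open>v\<close>, then \<open>u = \<gamma> (v - P)\<close> is a subgradient at \<open>P\<close>, and
  \<open>P\<close> is a subgradient of the conjugate at \<open>u\<close>; this identifies \<open>u\<close> as a proximal point of the
  conjugate without using the biconjugate.\<close>

lemma moreau_decomposition:
  fixes \<psi> :: "'a::euclidean_space \<Rightarrow> ereal"
  assumes pcc: "proper_closed_convex \<psi>" and \<gamma>: "\<gamma> > 0"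
  obtains P a c where "\<psi> P = ereal a" "prox \<gamma> (fenchel_conj \<psi>) (\<gamma> *\<^sub>R v) = \<gamma> *\<^sub>R (v - P)"
    "moreau_env (1/\<gamma>) \<psi> v = ereal (a + \<gamma> / 2 * (norm (P - v))\<^sup>2)"
    "\<And>x. ereal (a + \<gamma> * ((v - P) \<bullet> (x - P))) \<le> \<psi> x"
    "fenchel_conj \<psi> (\<gamma> *\<^sub>R (v - P)) = ereal c"
    "\<And>q. prox_objective \<gamma> (fenchel_conj \<psi>) (\<gamma> *\<^sub>R v) (\<gamma> *\<^sub>R (v - P))
       + ereal (1 / (2 * \<gamma>) * (norm (q - \<gamma> *\<^sub>R (v - P)))\<^sup>2) \<le> prox_objective \<gamma> (fenchel_conj \<psi>) (\<gamma> *\<^sub>R v) q"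
proof -
  obtain P a where P: "is_arg_min (prox_objective (1/\<gamma>) \<psi> v) (\<lambda>_. True) P" and a: "\<psi> P = ereal a"
    using prox_exists[OF pcc \<gamma>] by blast
  note sub = prox_subgradient[OF pcc \<gamma> P a]
  define u where "u = \<gamma> *\<^sub>R (v - P)"
  \<comment> \<open>This is the value that equality in Fenchel's inequality prescribes for the
    conjugate at \<open>u\<close>.\<close>
  define c where "c = u \<bullet> P - a"
  have env: "moreau_env (1/\<gamma>) \<psi> v = ereal (a + \<gamma> / 2 * (norm (P - v))\<^sup>2)"
  proof -
    have "moreau_env (1/\<gamma>) \<psi> v = prox_objective (1/\<gamma>) \<psi> v P" unfolding moreau_env_def
      using P by (intro antisym INF_lower INF_greatest) (auto simp: is_arg_min_def not_less)
    then show ?thesis by (simp add: prox_objective_def a add.commute)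
  qed
  have lower: "ereal (c + (q - u) \<bullet> P) \<le> fenchel_conj \<psi> q" for q
    unfolding fenchel_conj_def
    by (rule SUP_upper2[of P]) (auto simp: a c_def inner_diff_left)
  have "fenchel_conj \<psi> u \<le> ereal c" unfolding fenchel_conj_def
  proof (rule SUP_least)
    fix x
    show "ereal (u \<bullet> x) - \<psi> x \<le> ereal c"
      using sub[of x] by (cases "\<psi> x") (auto simp: u_def c_def algebra_simps)
  qed
  with lower[of u] have cu: "fenchel_conj \<psi> u = ereal c" by (simp add: antisym)
  \<comment> \<open>The conjugate is bounded by its affine minorant with slope \<open>P\<close>.
    Since \<open>u - \<gamma> *\<^sub>R v = - (\<gamma> *\<^sub>R P)\<close>, that slope cancels the
    cross term of the square and leaves the quadratic surplus, which gives uniqueness here and again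
    for the dual minimizer.\<close>
  have strong: "prox_objective \<gamma> (fenchel_conj \<psi>) (\<gamma> *\<^sub>R v) u + ereal (1 / (2 * \<gamma>) * (norm (q - u))\<^sup>2)
      \<le> prox_objective \<gamma> (fenchel_conj \<psi>) (\<gamma> *\<^sub>R v) q" for q
  proof -
    have "q - \<gamma> *\<^sub>R v = - (\<gamma> *\<^sub>R P) + (q - u)" by (simp add: u_def algebra_simps)
    then have "(norm (q - \<gamma> *\<^sub>R v))\<^sup>2 = \<gamma>\<^sup>2 * (norm P)\<^sup>2 - 2 * \<gamma> * ((q - u) \<bullet> P) + (norm (q - u))\<^sup>2"
      by (simp only: norm_add_sq) (simp add: power_mult_distrib inner_commute)
    moreover have "u - \<gamma> *\<^sub>R v = - (\<gamma> *\<^sub>R P)" by (simp add: u_def algebra_simps)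
    then have "(norm (u - \<gamma> *\<^sub>R v))\<^sup>2 = \<gamma>\<^sup>2 * (norm P)\<^sup>2" by (simp add: power_mult_distrib)
    ultimately have "1 / (2 * \<gamma>) * (norm (u - \<gamma> *\<^sub>R v))\<^sup>2 + c + 1 / (2 * \<gamma>) * (norm (q - u))\<^sup>2
       = 1 / (2 * \<gamma>) * (norm (q - \<gamma> *\<^sub>R v))\<^sup>2 + (c + (q - u) \<bullet> P)"
      using \<gamma> by (simp add: field_simps)
    then show ?thesis using lower[of q] unfolding prox_objective_def cu
      by (metis add_left_mono plus_ereal.simps(1))
  qed
  have fin: "prox_objective \<gamma> (fenchel_conj \<psi>) (\<gamma> *\<^sub>R v) u = ereal (1 / (2 * \<gamma>) * (norm (u - \<gamma> *\<^sub>R v))\<^sup>2 + c)"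
    by (simp add: prox_objective_def cu)
  have "prox \<gamma> (fenchel_conj \<psi>) (\<gamma> *\<^sub>R v) = u" unfolding prox_def
  proof (rule the_equality)
    have "prox_objective \<gamma> (fenchel_conj \<psi>) (\<gamma> *\<^sub>R v) u \<le> prox_objective \<gamma> (fenchel_conj \<psi>) (\<gamma> *\<^sub>R v) q" for q
      using \<gamma> by (intro order_trans[OF _ strong[of q]]) (simp add: fin)
    then show "is_arg_min (prox_objective \<gamma> (fenchel_conj \<psi>) (\<gamma> *\<^sub>R v)) (\<lambda>_. True) u"
      by (auto simp: is_arg_min_def not_less)
    fix q assume "is_arg_min (prox_objective \<gamma> (fenchel_conj \<psi>) (\<gamma> *\<^sub>R v)) (\<lambda>_. True) q"
    then have "prox_objective \<gamma> (fenchel_conj \<psi>) (\<gamma> *\<^sub>R v) q \<le> prox_objective \<gamma> (fenchel_conj \<psi>) (\<gamma> *\<^sub>R v) u"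
      by (auto simp: is_arg_min_def not_less)
    with strong[of q] have "prox_objective \<gamma> (fenchel_conj \<psi>) (\<gamma> *\<^sub>R v) u + ereal (1 / (2 * \<gamma>) * (norm (q - u))\<^sup>2)
       \<le> prox_objective \<gamma> (fenchel_conj \<psi>) (\<gamma> *\<^sub>R v) u" by (rule order_trans)
    then have "1 / (2 * \<gamma>) * (norm (q - u))\<^sup>2 \<le> 0" by (simp add: fin)
    then show "q = u" using \<gamma> by (simp add: mult_le_0_iff divide_le_0_iff)
  qed
  then show ?thesis using that[of P a c] a env sub cu strong by (simp add: u_def)
qed

text \<open>For the upper bound the envelope at \<open>w\<close> is tested with the proximal point
  of \<open>v\<close>; for the lower bound the subgradient inequality at the proximal point of
  \<open>v\<close> is evaluated at that of \<open>w\<close>.\<close>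

lemma smooth_convex_moreau_env:
  fixes \<psi> :: "'a::euclidean_space \<Rightarrow> ereal"
  assumes pcc: "proper_closed_convex \<psi>" and \<gamma>: "\<gamma> > 0"
  shows "smooth_convex \<gamma> (\<lambda>v. real_of_ereal (moreau_env (1/\<gamma>) \<psi> v))
    (\<lambda>v. prox \<gamma> (fenchel_conj \<psi>) (\<gamma> *\<^sub>R v))"
proof -
  define e where "e v = real_of_ereal (moreau_env (1/\<gamma>) \<psi> v)" for v
  define U where "U v = prox \<gamma> (fenchel_conj \<psi>) (\<gamma> *\<^sub>R v)" for v
  \<comment> \<open>The squared difference of \<open>U\<close> expresses cocoercivity: adding this
    inequality to its copy with \<open>v\<close> and \<open>w\<close> exchanged gives the Lipschitz
    constant \<gamma>.\<close>
  have key: "e v + U v \<bullet> (w - v) + 1 / (2 * \<gamma>) * (norm (U w - U v))\<^sup>2 \<le> e w \<and>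
    e w \<le> e v + U v \<bullet> (w - v) + \<gamma> / 2 * (norm (w - v))\<^sup>2" for v w
  proof -
    obtain P a c where P: "\<psi> P = ereal a" "U v = \<gamma> *\<^sub>R (v - P)"
      "moreau_env (1/\<gamma>) \<psi> v = ereal (a + \<gamma> / 2 * (norm (P - v))\<^sup>2)"
      "\<And>x. ereal (a + \<gamma> * ((v - P) \<bullet> (x - P))) \<le> \<psi> x"
      unfolding U_def by (rule moreau_decomposition[OF pcc \<gamma>, of v]) blast
    obtain R b c where R: "\<psi> R = ereal b" "U w = \<gamma> *\<^sub>R (w - R)"
      "moreau_env (1/\<gamma>) \<psi> w = ereal (b + \<gamma> / 2 * (norm (R - w))\<^sup>2)"
      unfolding U_def by (rule moreau_decomposition[OF pcc \<gamma>, of w]) blast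
    have ev: "e v = a + \<gamma> / 2 * (norm (P - v))\<^sup>2" and ew: "e w = b + \<gamma> / 2 * (norm (R - w))\<^sup>2"
      by (simp_all add: e_def P R)
    have "moreau_env (1/\<gamma>) \<psi> w \<le> prox_objective (1/\<gamma>) \<psi> w P"
      unfolding moreau_env_def by (rule INF_lower) simp
    then have up: "e w \<le> a + \<gamma> / 2 * (norm (P - w))\<^sup>2"
      by (simp add: R ew prox_objective_def P add.commute)
    have eq1: "(norm (P - w))\<^sup>2 = (norm (P - v))\<^sup>2 + 2 * ((v - P) \<bullet> (w - v)) + (norm (w - v))\<^sup>2"
      using norm_add_sq[of "v - P" "w - v"] by (simp add: norm_minus_commute)
    have lo: "a + \<gamma> * ((v - P) \<bullet> (R - P)) \<le> b" using P(4)[of R] by (simp add: R)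
    have "R - P = (w - v) - ((w - R) - (v - P))" by simp
    then have i: "(v - P) \<bullet> (R - P) = (v - P) \<bullet> (w - v) - (v - P) \<bullet> ((w - R) - (v - P))"
      by (metis inner_diff_right)
    have eq2: "(norm (R - w))\<^sup>2 = (norm (P - v))\<^sup>2 + 2 * ((v - P) \<bullet> ((w - R) - (v - P))) + (norm ((w - R) - (v - P)))\<^sup>2"
      using norm_add_sq[of "v - P" "(w - R) - (v - P)"] by (simp add: norm_minus_commute)
    have "U w - U v = \<gamma> *\<^sub>R ((w - R) - (v - P))" by (simp add: P R scaleR_diff_right)
    then have "1 / (2 * \<gamma>) * (norm (U w - U v))\<^sup>2 = \<gamma> / 2 * (norm ((w - R) - (v - P)))\<^sup>2"
      using \<gamma> by (simp add: power_mult_distrib power2_eq_square)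
    moreover have "U v \<bullet> (w - v) = \<gamma> * ((v - P) \<bullet> (w - v))" by (simp add: P)
    ultimately show ?thesis
      using up lo by (simp add: ev ew eq1 eq2 i algebra_simps)
  qed
  have lip: "norm (U w - U v) \<le> \<gamma> * norm (w - v)" for v w
  proof -
    have "1 / \<gamma> * (norm (U w - U v))\<^sup>2 \<le> (U w - U v) \<bullet> (w - v)"
      using key[of v w] key[of w v]
      by (simp add: norm_minus_commute inner_diff_left inner_diff_right)
    also have "\<dots> \<le> norm (U w - U v) * norm (w - v)" by (rule norm_cauchy_schwarz)
    finally have "norm (U w - U v) * norm (U w - U v) \<le> norm (U w - U v) * (\<gamma> * norm (w - v))"
      using \<gamma> by (simp add: field_simps power2_eq_square)
    then show ?thesis using \<gamma> by (cases "norm (U w - U v) = 0") (auto simp: mult_le_cancel_left)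
  qed
  have "smooth_convex \<gamma> e U" unfolding smooth_convex_def
    using \<gamma> key lip by (auto intro: order_trans[rotated])
      (smt (verit, best) key divide_nonneg_pos mult_nonneg_nonneg zero_le_power2)
  then show ?thesis unfolding e_def[abs_def] U_def[abs_def] .
qed

section \<open>Clarke Jacobians of Lipschitz maps\<close>

lemma bounded_linear_matrix_vector_mult_left: "bounded_linear (\<lambda>J :: real^'n^'m. J *v d)"
  by (simp add: linear_conv_bounded_linear[symmetric] linear_iff matrix_vector_mult_add_rdistrib
      scaleR_matrix_vector_assoc)

lemma has_derivative_matrix_imp_jacobian:
  fixes F :: "real^'n \<Rightarrow> real^'m"
  assumes "(F has_derivative (\<lambda>h. J *v h)) (at x)"
  shows "F differentiable (at x)" "jacobian F (at x) = J"
proof -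
  show "F differentiable (at x)" using assms by (auto simp: differentiable_def)
  show "jacobian F (at x) = J"
    unfolding jacobian_def frechet_derivative_at[OF assms, symmetric] by (rule matrix_of_matrix_vector_mul)
qed

lemma jacobian_estimate:
  fixes F :: "real^'n \<Rightarrow> real^'m"
  assumes "F differentiable (at x)" "e > 0"
  obtains \<delta> where "\<delta> > 0"
    "\<And>h. norm h < \<delta> \<Longrightarrow> norm (F (x + h) - F x - jacobian F (at x) *v h) \<le> e * norm h"
proof -
  have "(F has_derivative (\<lambda>h. jacobian F (at x) *v h)) (at x)"
    using assms(1) by (simp add: jacobian_works)
  then obtain \<delta> where "\<delta> > 0"
    "\<And>y. norm (y - x) < \<delta> \<Longrightarrow> norm (F y - F x - jacobian F (at x) *v (y - x)) \<le> e * norm (y - x)"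
    using assms(2) unfolding has_derivative_at_alt by blast
  then show ?thesis using that[of \<delta>] by (metis add_diff_cancel_left')
qed

text \<open>The limit is one-sided, matching \<open>directionally_differentiable_at\<close>; through
  it the Lipschitz bound and monotonicity pass from difference quotients to Jacobians.\<close>

lemma jacobian_directional_limit:
  fixes F :: "real^'n \<Rightarrow> real^'m"
  assumes "F differentiable (at x)"
  shows "((\<lambda>t. (F (x + t *\<^sub>R d) - F x) /\<^sub>R t) \<longlongrightarrow> jacobian F (at x) *v d) (at_right 0)"
proof (rule tendstoI)
  fix e :: real assume e: "e > 0"
  define e' where "e' = e / (norm d + 1)"
  have np: "norm d + 1 > 0" by (simp add: add_nonneg_pos)
  have e': "e' > 0" using e np by (simp add: e'_def)
  obtain \<delta> where \<delta>: "\<delta> > 0"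
    "\<And>h. norm h < \<delta> \<Longrightarrow> norm (F (x + h) - F x - jacobian F (at x) *v h) \<le> e' * norm h"
    using jacobian_estimate[OF assms e'] by blast
  have "\<forall>\<^sub>F t in at_right 0. t \<in> {0<..<\<delta> / (norm d + 1)}"
    using \<delta>(1) np by (intro eventually_at_right_real) simp
  then show "\<forall>\<^sub>F t in at_right 0. dist ((F (x + t *\<^sub>R d) - F x) /\<^sub>R t) (jacobian F (at x) *v d) < e"
  proof eventually_elim
    case (elim t)
    then have t: "t > 0" "t * (norm d + 1) < \<delta>" using np by (auto simp: pos_less_divide_eq)
    have "norm (t *\<^sub>R d) < \<delta>" using t by (simp add: distrib_left)
    then have est: "norm (F (x + t *\<^sub>R d) - F x - jacobian F (at x) *v (t *\<^sub>R d)) \<le> e' * norm (t *\<^sub>R d)"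
      by (rule \<delta>(2))
    have "(F (x + t *\<^sub>R d) - F x) /\<^sub>R t - jacobian F (at x) *v d
        = (F (x + t *\<^sub>R d) - F x - jacobian F (at x) *v (t *\<^sub>R d)) /\<^sub>R t"
      using t(1) by (simp add: scaleR_diff_right matrix_vector_mult_scaleR)
    then have "norm ((F (x + t *\<^sub>R d) - F x) /\<^sub>R t - jacobian F (at x) *v d)
        = norm (F (x + t *\<^sub>R d) - F x - jacobian F (at x) *v (t *\<^sub>R d)) / t"
      using t(1) by (simp add: divide_inverse_commute)
    also have "\<dots> \<le> e' * norm (t *\<^sub>R d) / t" using est t(1) by (intro divide_right_mono) auto
    also have "\<dots> = e' * norm d" using t(1) by simp
    also have "\<dots> < e" using e np unfolding e'_def by (simp add: divide_less_eq)
    finally show ?case by (simp add: dist_norm)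
  qed
qed

lemma norm_jacobian_mult_le:
  fixes F :: "real^'n \<Rightarrow> real^'m"
  assumes "\<And>x y. norm (F y - F x) \<le> L * norm (y - x)" and "F differentiable (at x)"
  shows "norm (jacobian F (at x) *v d) \<le> L * norm d"
proof (rule Lim_norm_ubound[OF _ jacobian_directional_limit[OF assms(2)]])
  show "\<forall>\<^sub>F t in at_right 0. norm ((F (x + t *\<^sub>R d) - F x) /\<^sub>R t) \<le> L * norm d"
    using eventually_at_right_less[of "0::real"]
  proof eventually_elim
    case (elim t)
    have "norm (F (x + t *\<^sub>R d) - F x) \<le> L * norm (t *\<^sub>R d)" using assms(1)[of "x + t *\<^sub>R d" x] by simp
    moreover have "norm ((F (x + t *\<^sub>R d) - F x) /\<^sub>R t) = norm (F (x + t *\<^sub>R d) - F x) / t"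
      using elim by (simp add: divide_inverse_commute)
    ultimately show ?case using elim by (simp add: pos_divide_le_eq mult_ac)
  qed
qed simp

lemma jacobian_monotone:
  fixes G :: "real^'n \<Rightarrow> real^'n"
  assumes "\<And>x y. (G y - G x) \<bullet> (y - x) \<ge> 0" and "G differentiable (at x)"
  shows "0 \<le> (jacobian G (at x) *v d) \<bullet> d"
proof (rule tendsto_lowerbound)
  show "((\<lambda>t. ((G (x + t *\<^sub>R d) - G x) /\<^sub>R t) \<bullet> d) \<longlongrightarrow> (jacobian G (at x) *v d) \<bullet> d) (at_right 0)"
    by (intro tendsto_inner tendsto_const jacobian_directional_limit assms)
  show "\<forall>\<^sub>F t in at_right 0. 0 \<le> ((G (x + t *\<^sub>R d) - G x) /\<^sub>R t) \<bullet> d"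
    using eventually_at_right_less[of "0::real"]
  proof eventually_elim
    case (elim t)
    then show ?case using assms(1)[of "x + t *\<^sub>R d" x] by (simp add: zero_le_mult_iff)
  qed
qed simp

lemma smooth_convex_DERIV_line:
  assumes "smooth_convex L \<phi> G"
  shows "((\<lambda>s. \<phi> (y + s *\<^sub>R a)) has_real_derivative (G (y + s *\<^sub>R a) \<bullet> a)) (at s)"
proof -
  have "(\<phi> has_derivative (\<lambda>h. h \<bullet> G (y + s *\<^sub>R a))) (at (y + s *\<^sub>R a))"
    using smooth_convex_gderiv[OF assms] by (simp add: gderiv_def)
  moreover have "((\<lambda>s. y + s *\<^sub>R a) has_derivative (\<lambda>t. t *\<^sub>R a)) (at s)"
    by (auto intro!: derivative_eq_intros)
  ultimately have "((\<lambda>s. \<phi> (y + s *\<^sub>R a)) has_derivative (\<lambda>t. (t *\<^sub>R a) \<bullet> G (y + s *\<^sub>R a))) (at s)"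
    by (rule has_derivative_compose[rotated])
  then show ?thesis unfolding has_field_derivative_def
    by (rule has_derivative_eq_rhs) (auto simp: inner_commute mult.commute)
qed

lemma transpose_eq_if_self_adjoint:
  fixes J :: "real^'n^'n"
  assumes "\<And>a b. (J *v a) \<bullet> b = (J *v b) \<bullet> a"
  shows "transpose J = J"
proof -
  have "J $ i $ j = J $ j $ i" for i j
    using assms[of "axis j 1" "axis i 1"] by (simp add: inner_axis matrix_vector_mult_basis column_def)
  then show ?thesis by (simp add: transpose_def vec_eq_iff)
qed

text \<open>Schwarz's theorem at a point where the gradient is merely differentiable: both mixed
  derivatives are limits of the same second difference quotient.\<close>

lemma smooth_convex_jacobian_symmetric:
  fixes \<phi> :: "real^'n \<Rightarrow> real"
  assumes sc: "smooth_convex L \<phi> G" and diff: "G differentiable (at x)"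
  shows "transpose (jacobian G (at x)) = jacobian G (at x)"
proof -
  define J where "J = jacobian G (at x)"
  define D where "D a b t = \<phi> (x + t *\<^sub>R a + t *\<^sub>R b) - \<phi> (x + t *\<^sub>R a) - \<phi> (x + t *\<^sub>R b) + \<phi> x" for a b t
  have lim: "((\<lambda>t. D a b t / t\<^sup>2) \<longlongrightarrow> (J *v b) \<bullet> a) (at_right 0)" for a b
  proof (rule tendstoI)
    fix e :: real assume e: "e > 0"
    \<comment> \<open>The increments \<open>h1\<close> and \<open>h2\<close> below have norms at
      most \<open>t * (norm a + norm b)\<close> and \<open>t * norm a\<close>, so their errors add
      up to a multiple of \<open>C - 1\<close>; the extra 1 makes the divisor positive and the final
      inequality strict.\<close>
    define C where "C = (2 * norm a + norm b) * norm a + 1"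
    have C: "C > 0" by (simp add: C_def add_nonneg_pos)
    obtain \<delta> where \<delta>: "\<delta> > 0" "\<And>h. norm h < \<delta> \<Longrightarrow> norm (G (x + h) - G x - J *v h) \<le> e / C * norm h"
      using jacobian_estimate[OF diff, of "e / C"] e C unfolding J_def by auto
    define r where "r = norm a + norm b + 1"
    have r: "r > 0" by (simp add: r_def add_nonneg_pos)
    have "\<forall>\<^sub>F t in at_right 0. t \<in> {0<..<\<delta> / r}"
      using \<delta>(1) r by (intro eventually_at_right_real) simp
    then show "\<forall>\<^sub>F t in at_right 0. dist (D a b t / t\<^sup>2) ((J *v b) \<bullet> a) < e"
    proof eventually_elim
      case (elim t)
      then have t: "t > 0" "t * r < \<delta>" using r by (auto simp: pos_less_divide_eq)
      \<comment> \<open>This is the increment in direction \<open>b\<close> as a function of the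
        step in direction \<open>a\<close>. The mean value theorem reduces the second difference of
        \<phi> to a first difference of \<open>G\<close>, where differentiability at
        \<open>x\<close> applies.\<close>
      define \<psi> where "\<psi> s = \<phi> ((x + t *\<^sub>R b) + s *\<^sub>R a) - \<phi> (x + s *\<^sub>R a)" for s
      define \<psi>' where "\<psi>' s = G ((x + t *\<^sub>R b) + s *\<^sub>R a) \<bullet> a - G (x + s *\<^sub>R a) \<bullet> a" for s
      have "(\<psi> has_real_derivative \<psi>' s) (at s)" for s
        unfolding \<psi>_def[abs_def] \<psi>'_def by (intro DERIV_diff smooth_convex_DERIV_line[OF sc])
      then obtain z where z: "0 < z" "z < t" "\<psi> t - \<psi> 0 = (t - 0) * \<psi>' z"
        using MVT2[of 0 t \<psi> \<psi>'] t(1) by blast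
      have D: "D a b t = t * \<psi>' z" using z(3) by (simp add: D_def \<psi>_def add.commute add.left_commute)
      define h1 h2 where "h1 = t *\<^sub>R b + z *\<^sub>R a" and "h2 = z *\<^sub>R a"
      have za: "z * norm a \<le> t * norm a" using z by (simp add: mult_right_mono)
      have n2: "norm h2 \<le> t * norm a" using z za by (simp add: h2_def)
      have n1: "norm h1 \<le> t * (norm a + norm b)"
        using norm_triangle_ineq[of "t *\<^sub>R b" "z *\<^sub>R a"] z za t by (simp add: h1_def distrib_left)
      have "0 \<le> t * norm b" using t(1) by simp
      then have "t * (norm a + norm b) < \<delta>" "t * norm a < \<delta>"
        using t unfolding r_def distrib_left by linarith+
      then have e1: "norm (G (x + h1) - G x - J *v h1) \<le> e / C * norm h1"
        and e2: "norm (G (x + h2) - G x - J *v h2) \<le> e / C * norm h2"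
        using n1 n2 by (intro \<delta>(2), linarith)+
      have tb: "J *v h1 - J *v h2 = t *\<^sub>R (J *v b)"
        by (simp add: h1_def h2_def matrix_vector_right_distrib matrix_vector_mult_scaleR)
      have "\<psi>' z - t * ((J *v b) \<bullet> a) =
          ((G (x + h1) - G x - J *v h1) - (G (x + h2) - G x - J *v h2)) \<bullet> a"
        using arg_cong[OF tb, of "\<lambda>w. w \<bullet> a"]
        by (simp only: \<psi>'_def h1_def h2_def inner_diff_left add.assoc inner_scaleR_left)
      also have "\<bar>\<dots>\<bar> \<le> norm ((G (x + h1) - G x - J *v h1) - (G (x + h2) - G x - J *v h2)) * norm a"
        by (rule Cauchy_Schwarz_ineq2)
      also have "\<dots> \<le> (e / C * norm h1 + e / C * norm h2) * norm a"
        using e1 e2 by (intro mult_right_mono order_trans[OF norm_triangle_ineq4]) auto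
      also have "\<dots> \<le> (e / C * (t * (norm a + norm b)) + e / C * (t * norm a)) * norm a"
        using n1 n2 e C by (intro mult_right_mono add_mono mult_left_mono) auto
      also have "\<dots> = e * t * ((C - 1) / C)" by (simp add: C_def algebra_simps add_divide_distrib)
      also have "\<dots> < e * t * 1" using e t C by (intro mult_strict_left_mono) auto
      finally have "\<bar>\<psi>' z - t * ((J *v b) \<bullet> a)\<bar> / t < e" using t by (simp add: divide_less_eq)
      moreover have "D a b t / t\<^sup>2 - (J *v b) \<bullet> a = (\<psi>' z - t * ((J *v b) \<bullet> a)) / t"
        using t by (simp add: D power2_eq_square diff_divide_distrib)
      ultimately show ?case using t by (simp add: dist_real_def)
    qed
  qed
  have "(J *v b) \<bullet> a = (J *v a) \<bullet> b" for a b
  proof (rule tendsto_unique[OF _ lim])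
    have "D a b = D b a" by (auto simp: D_def add_ac)
    then show "((\<lambda>t. D a b t / t\<^sup>2) \<longlongrightarrow> (J *v a) \<bullet> b) (at_right 0)" using lim[of b a] by simp
  qed simp
  then show ?thesis unfolding J_def[symmetric] by (rule transpose_eq_if_self_adjoint)
qed

text \<open>The section over \<open>x\<close> is the limiting (Bouligand) Jacobian. Collecting all
  sections in one closed set makes compactness and upper semicontinuity closed-graph
  arguments.\<close>

definition jacobian_graph :: "(real^'n \<Rightarrow> real^'m) \<Rightarrow> ((real^'n) \<times> (real^'n^'m)) set" where
  "jacobian_graph F = closure {(y, jacobian F (at y)) | y. F differentiable (at y)}"

lemma clarke_jacobian_eq:
  "clarke_jacobian F x = convex hull {J. (x, J) \<in> jacobian_graph F}"
proof -
  have "(\<exists>s. (\<forall>i::nat. F differentiable (at (s i))) \<and> s \<longlonglongrightarrow> x \<and> (\<lambda>i. jacobian F (at (s i))) \<longlonglongrightarrow> J)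
     \<longleftrightarrow> (x, J) \<in> jacobian_graph F" (is "?l \<longleftrightarrow> ?r") for J
  proof
    assume ?l
    then obtain s where s: "\<And>i::nat. F differentiable (at (s i))" "s \<longlonglongrightarrow> x"
      "(\<lambda>i. jacobian F (at (s i))) \<longlonglongrightarrow> J" by blast
    then show ?r unfolding jacobian_graph_def closure_sequential
      by (intro exI[of _ "\<lambda>i. (s i, jacobian F (at (s i)))"] conjI tendsto_Pair) auto
  next
    assume ?r
    then obtain t where t: "\<And>n. t n \<in> {(y, jacobian F (at y)) | y. F differentiable (at y)}" "t \<longlonglongrightarrow> (x, J)"
      unfolding jacobian_graph_def closure_sequential by blast
    have "F differentiable (at (fst (t n)))" "jacobian F (at (fst (t n))) = snd (t n)" for n
      using t(1)[of n] by auto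
    then show ?l using tendsto_fst[OF t(2)] tendsto_snd[OF t(2)]
      by (intro exI[of _ "\<lambda>n. fst (t n)"]) simp
  qed
  then show ?thesis by (simp add: clarke_jacobian_def)
qed

text \<open>Closed conditions survive the limits and convex ones the hull, so a closed convex
  property of Clarke Jacobians has to be checked only at points of differentiability. The norm
  bound, symmetry and semidefiniteness are all obtained this way.\<close>

lemma clarke_jacobian_subset:
  assumes S: "closed S" "convex S" and J: "\<And>y. F differentiable (at y) \<Longrightarrow> jacobian F (at y) \<in> S"
  shows "clarke_jacobian F x \<subseteq> S"
proof -
  have "jacobian_graph F \<subseteq> UNIV \<times> S" unfolding jacobian_graph_def
    using J S(1) by (intro closure_minimal closed_Times) auto
  then show ?thesis unfolding clarke_jacobian_eq using S(2) by (intro hull_minimal) auto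
qed

lemma convex_norm_mult_le: "convex {J :: real^'n^'m. \<forall>d. norm (J *v d) \<le> L * norm d}"
proof (rule convexI, clarify)
  fix J K :: "real^'n^'m" and u v :: real and d
  assume JK: "\<forall>d. norm (J *v d) \<le> L * norm d" "\<forall>d. norm (K *v d) \<le> L * norm d"
    and uv: "0 \<le> u" "0 \<le> v" "u + v = 1"
  have "norm ((u *\<^sub>R J + v *\<^sub>R K) *v d) \<le> u * norm (J *v d) + v * norm (K *v d)"
    using uv norm_triangle_ineq[of "u *\<^sub>R (J *v d)" "v *\<^sub>R (K *v d)"]
    by (simp add: matrix_vector_mult_add_rdistrib scaleR_matrix_vector_assoc[symmetric])
  also have "\<dots> \<le> u * (L * norm d) + v * (L * norm d)"
    using JK uv by (intro add_mono mult_left_mono) auto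
  also have "\<dots> = L * norm d" using uv by (metis distrib_right mult_1)
  finally show "norm ((u *\<^sub>R J + v *\<^sub>R K) *v d) \<le> L * norm d" .
qed

lemma closed_norm_mult_le: "closed {J :: real^'n^'m. \<forall>d. norm (J *v d) \<le> L * norm d}"
  by (intro closed_Collect_all closed_Collect_le continuous_intros
      bounded_linear.continuous_on[OF bounded_linear_matrix_vector_mult_left])

text \<open>The dimension-dependent factor is crude, but only boundedness matters, as the source of
  compactness.\<close>

lemma norm_matrix_le_if_norm_mult_le:
  fixes J :: "real^'n^'m"
  assumes "\<And>d. norm (J *v d) \<le> L * norm d"
  shows "norm J \<le> real CARD('m) * (real CARD('n) * L)"
proof -
  have "\<bar>J $ i $ j\<bar> \<le> L" for i j
  proof -
    have "\<bar>J $ i $ j\<bar> = \<bar>(J *v axis j 1) $ i\<bar>"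
      by (simp add: matrix_vector_mult_basis column_def)
    also have "\<dots> \<le> norm (J *v axis j 1)" by (rule component_le_norm_cart)
    also have "\<dots> \<le> L" using assms[of "axis j 1"] by simp
    finally show ?thesis .
  qed
  then have "norm (J $ i) \<le> real CARD('n) * L" for i
    by (intro order_trans[OF norm_le_l1_cart] order_trans[OF sum_bounded_above]) auto
  then have "(\<Sum>i\<in>UNIV. norm (J $ i)) \<le> real CARD('m) * (real CARD('n) * L)"
    by (intro order_trans[OF sum_bounded_above]) auto
  moreover have "norm J \<le> (\<Sum>i\<in>UNIV. norm (J $ i))"
    unfolding norm_vec_def[of J] by (rule L2_set_le_sum) simp
  ultimately show ?thesis by simp
qed

section \<open>Compactness, upper semicontinuity and nonemptiness of Clarke Jacobians\<close>

lemma LIMSEQ_if_dist_less_inverse: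
  assumes "\<And>n. dist (y n) x < inverse (real (Suc n))"
  shows "y \<longlonglongrightarrow> x"
  unfolding tendsto_dist_iff[of y]
  by (rule real_tendsto_sandwich[OF _ _ tendsto_const LIMSEQ_inverse_real_of_nat])
    (use assms less_imp_le in \<open>auto intro!: always_eventually simp del: of_nat_Suc\<close>)

locale lipschitz_map =
  fixes F :: "real^'n \<Rightarrow> real^'m" and L :: real
  assumes lipschitz: "norm (F y - F x) \<le> L * norm (y - x)"
begin

lemma clarke_norm_mult_le: "J \<in> clarke_jacobian F x \<Longrightarrow> norm (J *v d) \<le> L * norm d"
  using clarke_jacobian_subset[OF closed_norm_mult_le convex_norm_mult_le, of F L x]
    norm_jacobian_mult_le[of F L] lipschitz by blast

lemma graph_subset_clarke: "(x, J) \<in> jacobian_graph F \<Longrightarrow> J \<in> clarke_jacobian F x"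
  unfolding clarke_jacobian_eq by (rule hull_inc) simp

lemma graph_bounded: "(x, J) \<in> jacobian_graph F \<Longrightarrow> norm J \<le> real CARD('m) * (real CARD('n) * L)"
  using clarke_norm_mult_le[OF graph_subset_clarke] by (rule norm_matrix_le_if_norm_mult_le)

lemma closed_graph_section: "closed {J. (x, J) \<in> jacobian_graph F}"
proof -
  have "closed (Pair x -` jacobian_graph F)"
    by (intro continuous_closed_vimage) (auto simp: jacobian_graph_def intro!: continuous_intros)
  then show ?thesis by (simp add: vimage_def)
qed

lemma compact_clarke: "compact (clarke_jacobian F x)"
  unfolding clarke_jacobian_eq
  by (intro compact_convex_hull) (auto simp: compact_eq_bounded_closed closed_graph_section bounded_iff
      intro: graph_bounded)

lemma graph_sequential_limit:
  assumes x: "x \<longlonglongrightarrow> l" and J: "\<And>n. (x n, J n) \<in> jacobian_graph F"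
  obtains r K where "strict_mono r" "(J \<circ> r) \<longlonglongrightarrow> K" "(l, K) \<in> jacobian_graph F"
proof -
  have "bounded (range J)" using graph_bounded[OF J] by (auto simp: bounded_iff)
  then obtain K r where r: "strict_mono r" "(J \<circ> r) \<longlonglongrightarrow> K"
    using bounded_imp_convergent_subsequence by blast
  have "closed (jacobian_graph F)" by (simp add: jacobian_graph_def)
  then have "(l, K) \<in> jacobian_graph F"
  proof (rule closed_sequentially)
    show "(\<lambda>n. ((x \<circ> r) n, (J \<circ> r) n)) \<longlonglongrightarrow> (l, K)"
      by (intro tendsto_Pair r LIMSEQ_subseq_LIMSEQ x)
  qed (simp add: J)
  then show ?thesis using that r by blast
qed

text \<open>For limiting Jacobians a violating sequence would have a subsequence converging to a
  member of the section over \<open>x\<close>, a contradiction. The convex hull is taken only after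
  this.\<close>

lemma clarke_upper_semicontinuous:
  assumes e: "e > 0"
  obtains \<delta> where "\<delta> > 0"
    "\<And>y J. norm (y - x) < \<delta> \<Longrightarrow> J \<in> clarke_jacobian F y \<Longrightarrow> \<exists>K\<in>clarke_jacobian F x. norm (J - K) < e"
proof -
  have "\<exists>n::nat. \<forall>y J. norm (y - x) < inverse (Suc n) \<longrightarrow> (y, J) \<in> jacobian_graph F \<longrightarrow>
      (\<exists>K. (x, K) \<in> jacobian_graph F \<and> norm (J - K) < e)"
  proof (rule ccontr)
    assume "\<not> ?thesis"
    then have "\<forall>n::nat. \<exists>y J. norm (y - x) < inverse (Suc n) \<and> (y, J) \<in> jacobian_graph F \<and>
      (\<forall>K. (x, K) \<in> jacobian_graph F \<longrightarrow> \<not> norm (J - K) < e)" by blast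
    then obtain y J where yJ: "\<And>n::nat. norm (y n - x) < inverse (Suc n)" "\<And>n. (y n, J n) \<in> jacobian_graph F"
      "\<And>n K. (x, K) \<in> jacobian_graph F \<Longrightarrow> \<not> norm (J n - K) < e" by metis
    have "y \<longlonglongrightarrow> x" using yJ(1) by (intro LIMSEQ_if_dist_less_inverse) (simp add: dist_norm)
    then obtain r K where rK: "(J \<circ> r) \<longlonglongrightarrow> K" "(x, K) \<in> jacobian_graph F"
      using graph_sequential_limit yJ(2) by metis
    have "\<forall>\<^sub>F n in sequentially. dist ((J \<circ> r) n) K < e" by (rule tendstoD[OF rK(1) e])
    then show False using yJ(3)[OF rK(2)] by (auto simp: dist_norm)
  qed
  then obtain n :: nat where n: "\<And>y J. norm (y - x) < inverse (Suc n) \<Longrightarrow> (y, J) \<in> jacobian_graph F \<Longrightarrow>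
      \<exists>K. (x, K) \<in> jacobian_graph F \<and> norm (J - K) < e" by blast
  show ?thesis
  proof (rule that[of "inverse (Suc n)"])
    fix y J assume y: "norm (y - x) < inverse (Suc n)" and J: "J \<in> clarke_jacobian F y"
    \<comment> \<open>The open \<open>e\<close>-neighbourhood of the Clarke Jacobian at
      \<open>x\<close> is a sum of two convex sets, hence convex; so it contains the hull as soon as
      it contains the limiting Jacobians at \<open>y\<close>.\<close>
    define N where "N = (\<Union>a\<in>clarke_jacobian F x. \<Union>b\<in>ball 0 e. {a + b})"
    have cN: "convex N" unfolding N_def clarke_jacobian_eq using convex_sums[OF convex_convex_hull convex_ball] .
    have "J' \<in> N" if J': "(y, J') \<in> jacobian_graph F" for J'
    proof -
      obtain K where "(x, K) \<in> jacobian_graph F" "norm (J' - K) < e" using n[OF y J'] by blast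
      then have "K \<in> clarke_jacobian F x" "J' - K \<in> ball 0 e" "J' = K + (J' - K)"
        using graph_subset_clarke by auto
      then show ?thesis unfolding N_def by blast
    qed
    then have "clarke_jacobian F y \<subseteq> N"
      unfolding clarke_jacobian_eq[of F y] by (intro hull_minimal cN) auto
    with J obtain K b where "K \<in> clarke_jacobian F x" "b \<in> ball 0 e" "J = K + b"
      unfolding N_def by blast
    then show "\<exists>K\<in>clarke_jacobian F x. norm (J - K) < e" by (intro bexI[of _ K]) auto
  qed simp
qed

text \<open>The hull could be the hull of the empty set. Differentiability points tending to
  \<open>x\<close> exclude this, since their Jacobians are bounded and have a convergent
  subsequence.\<close>

lemma clarke_nonempty:
  assumes dense: "\<And>U. open U \<Longrightarrow> U \<noteq> {} \<Longrightarrow> \<exists>y\<in>U. F differentiable (at y)"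
  shows "clarke_jacobian F x \<noteq> {}"
proof -
  have "\<exists>y\<in>ball x (inverse (Suc n)). F differentiable (at y)" for n by (rule dense) auto
  then obtain y where y: "\<And>n. dist x (y n) < inverse (Suc n)" "\<And>n. F differentiable (at (y n))"
    by (metis mem_ball)
  have "y \<longlonglongrightarrow> x" using y(1) by (intro LIMSEQ_if_dist_less_inverse) (simp add: dist_commute)
  moreover have "(y n, jacobian F (at (y n))) \<in> jacobian_graph F" for n
    unfolding jacobian_graph_def by (rule subsetD[OF closure_subset]) (use y(2) in blast)
  ultimately show ?thesis using graph_sequential_limit[of y x "\<lambda>n. jacobian F (at (y n))"] graph_subset_clarke
    by blast
qed

end

text \<open>The closed sets \<open>E N\<close>, on which all members from index \<open>N\<close> on
  agree up to \<open>e / 4\<close>, cover a ball; by Baire one of them has interior points, and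
  there the limit is uniformly close to the continuous function \<open>f N\<close>.\<close>

lemma baire_one_small_oscillation:
  fixes f :: "nat \<Rightarrow> 'a::euclidean_space \<Rightarrow> 'b::metric_space"
  assumes cont: "\<And>n. continuous_on UNIV (f n)" and lim: "\<And>x. (\<lambda>n. f n x) \<longlonglongrightarrow> g x"
    and e: "e > 0" and U: "open U" "U \<noteq> {}"
  obtains V where "open V" "V \<noteq> {}" "V \<subseteq> U" "\<And>y z. y \<in> V \<Longrightarrow> z \<in> V \<Longrightarrow> dist (g y) (g z) \<le> e"
proof -
  obtain x r where xr: "r > 0" "cball x r \<subseteq> U" using U open_contains_cball by blast
  define E where "E N = {y. dist x y \<le> r \<and> (\<forall>p q. N \<le> p \<longrightarrow> N \<le> q \<longrightarrow> dist (f p y) (f q y) \<le> e / 4)}" for N :: nat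
  have clE: "closed (E N)" for N unfolding E_def
    by (intro closed_Collect_conj closed_Collect_all closed_Collect_imp open_Collect_const
        closed_Collect_le continuous_intros cont)
  have cover: "\<exists>N. y \<in> E N" if "dist x y \<le> r" for y
  proof -
    have "Cauchy (\<lambda>n. f n y)" using lim LIMSEQ_imp_Cauchy by blast
    then obtain N where "\<And>m n. m \<ge> N \<Longrightarrow> n \<ge> N \<Longrightarrow> dist (f m y) (f n y) < e / 4"
      using e metric_CauchyD[of "\<lambda>n. f n y" "e / 4"] by auto
    then show ?thesis using that by (auto simp: E_def intro!: exI[of _ N] less_imp_le)
  qed
  have "\<exists>N. interior (E N) \<noteq> {}"
  proof (rule ccontr)
    assume none: "\<not> ?thesis"
    have "(UNIV :: 'a set) \<subseteq> closure (\<Inter>(range (\<lambda>N. - E N)))"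
      by (rule Baire) (use none clE in \<open>auto simp: closure_complement\<close>)
    moreover have "\<Inter>(range (\<lambda>N. - E N)) \<subseteq> - ball x r" using cover by (fastforce dest: less_imp_le)
    moreover have "closed (- ball x r)" by (rule closed_Compl[OF open_ball])
    ultimately have "UNIV \<subseteq> - ball x r" using closure_minimal by (metis subset_trans)
    then show False using xr(1) by (metis ComplD UNIV_I centre_in_ball subsetD)
  qed
  then obtain N v where v: "v \<in> interior (E N)" by blast
  have close: "dist (f N y) (g y) \<le> e / 4" if "y \<in> interior (E N)" for y
  proof (rule tendsto_upperbound)
    show "(\<lambda>q. dist (f N y) (f q y)) \<longlonglongrightarrow> dist (f N y) (g y)" by (intro tendsto_dist tendsto_const lim)
    have "y \<in> E N" using that interior_subset by blast
    then show "\<forall>\<^sub>F q in sequentially. dist (f N y) (f q y) \<le> e / 4"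
      by (intro eventually_mono[OF eventually_ge_at_top[of N]]) (simp add: E_def)
  qed simp
  \<comment> \<open>Shrinking to where \<open>f N\<close> varies by less than \<open>e / 4\<close>
    from its value at \<open>v\<close> makes the chain \<open>g y\<close>, \<open>f N y\<close>,
    \<open>f N v\<close>, \<open>f N z\<close>, \<open>g z\<close> consist of four steps of size at
    most \<open>e / 4\<close>.\<close>
  define V where "V = interior (E N) \<inter> {y. dist (f N y) (f N v) < e / 4}"
  show ?thesis
  proof (rule that)
    show "open V" unfolding V_def
      by (intro open_Int open_interior open_Collect_less continuous_intros cont)
    show "V \<noteq> {}" using v e by (auto simp: V_def)
    show "V \<subseteq> U" using xr(2) interior_subset by (fastforce simp: V_def E_def)
    fix y z assume "y \<in> V" "z \<in> V"
    then have "dist (f N y) (g y) \<le> e / 4" "dist (f N z) (g z) \<le> e / 4"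
      "dist (f N y) (f N v) < e / 4" "dist (f N z) (f N v) < e / 4"
      using close by (auto simp: V_def)
    then show "dist (g y) (g z) \<le> e"
      using dist_triangle[of "g y" "g z" "f N y"] dist_triangle[of "f N y" "g z" "f N v"]
        dist_triangle[of "f N v" "g z" "f N z"] by (simp add: dist_commute)
  qed
qed

text \<open>Small oscillation on some open subset of every open set makes each \<open>W k\<close>
  dense; a point common to all of them is a point of zero oscillation.\<close>

lemma baire_one_continuity_point:
  fixes f :: "nat \<Rightarrow> 'a::euclidean_space \<Rightarrow> 'b::metric_space"
  assumes cont: "\<And>n. continuous_on UNIV (f n)" and lim: "\<And>x. (\<lambda>n. f n x) \<longlonglongrightarrow> g x"
    and U: "open U" "U \<noteq> {}"
  obtains x where "x \<in> U" "\<And>e. e > 0 \<Longrightarrow> \<exists>\<delta>>0. \<forall>y. dist y x < \<delta> \<longrightarrow> dist (g y) (g x) \<le> e"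
proof -
  define W where "W k = \<Union>{V. open V \<and> (\<forall>y\<in>V. \<forall>z\<in>V. dist (g y) (g z) \<le> inverse (Suc k))}" for k :: nat
  have oW: "open (W k)" for k unfolding W_def by (rule open_Union) blast
  have dW: "closure (W k) = UNIV" for k
  proof (rule ccontr)
    assume "closure (W k) \<noteq> UNIV"
    then have "open (- closure (W k))" "- closure (W k) \<noteq> {}" by auto
    then obtain V where V: "open V" "V \<noteq> {}" "V \<subseteq> - closure (W k)"
      "\<And>y z. y \<in> V \<Longrightarrow> z \<in> V \<Longrightarrow> dist (g y) (g z) \<le> inverse (Suc k)"
      using baire_one_small_oscillation[OF cont lim, of "inverse (Suc k)" "- closure (W k)"] by auto
    then have "V \<subseteq> W k" unfolding W_def by blast
    then show False using V(2,3) closure_subset by blast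
  qed
  have "(UNIV :: 'a set) \<subseteq> closure (\<Inter>(range W))"
    by (rule Baire) (use oW dW in auto)
  then have "U \<inter> \<Inter>(range W) \<noteq> {}" using U open_Int_closure_eq_empty by fastforce
  then obtain x where x: "x \<in> U" "\<And>k. x \<in> W k" by blast
  show ?thesis
  proof (rule that[OF x(1)])
    fix e :: real assume e: "e > 0"
    then obtain k where k: "inverse (real (Suc k)) < e" using reals_Archimedean by blast
    obtain V where V: "x \<in> V" "open V" "\<And>y z. y \<in> V \<Longrightarrow> z \<in> V \<Longrightarrow> dist (g y) (g z) \<le> inverse (Suc k)"
      using x(2)[of k] unfolding W_def by blast
    obtain \<delta> where \<delta>: "\<delta> > 0" "\<And>y. dist y x < \<delta> \<Longrightarrow> y \<in> V" using V(1,2) open_dist by blast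
    then have "dist (g y) (g x) \<le> e" if "dist y x < \<delta>" for y
      using V(3)[OF \<delta>(2)[OF that] V(1)] k by linarith
    then show "\<exists>\<delta>>0. \<forall>y. dist y x < \<delta> \<longrightarrow> dist (g y) (g x) \<le> e" using \<delta>(1) by blast
  qed
qed

text \<open>A mean value inequality from right-hand information, which is all that directional
  derivatives provide.\<close>

lemma right_lipschitz_bound:
  fixes \<phi> :: "real \<Rightarrow> 'a::real_normed_vector"
  assumes ab: "a \<le> b" and cont: "continuous_on {a..b} \<phi>"
    and loc: "\<And>s. a \<le> s \<Longrightarrow> s < b \<Longrightarrow> \<forall>\<^sub>F r in at_right s. norm (\<phi> r - \<phi> s) \<le> k * (r - s)"
  shows "norm (\<phi> b - \<phi> a) \<le> k * (b - a)"
proof -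
  \<comment> \<open>The largest parameter satisfying the bound must be \<open>b\<close>: at a
    smaller one the right-hand estimate would produce a larger member.\<close>
  define S where "S = {t \<in> {a..b}. norm (\<phi> t - \<phi> a) \<le> k * (t - a)}"
  have "closed S" unfolding S_def
    by (intro continuous_on_closed_Collect_le continuous_intros cont)
  moreover have "S \<subseteq> {a..b}" by (auto simp: S_def)
  ultimately have "compact S" by (metis compact_Icc compact_Int_closed inf.absorb_iff2)
  moreover have "a \<in> S" using ab by (simp add: S_def)
  ultimately obtain s where s: "s \<in> S" "\<And>t. t \<in> S \<Longrightarrow> t \<le> s" using compact_attains_sup[of S] by blast
  have "s = b"
  proof (rule ccontr)
    assume "s \<noteq> b"
    then have sb: "a \<le> s" "s < b" using s(1) by (auto simp: S_def)
    obtain b' where b': "b' > s" "\<And>r. s < r \<Longrightarrow> r < b' \<Longrightarrow> norm (\<phi> r - \<phi> s) \<le> k * (r - s)"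
      using loc[OF sb] unfolding eventually_at_right_field by blast
    obtain r where r: "s < r" "r < min b b'" using dense[of s "min b b'"] b'(1) sb by auto
    have "norm (\<phi> r - \<phi> a) \<le> norm (\<phi> r - \<phi> s) + norm (\<phi> s - \<phi> a)"
      by (metis diff_add_cancel add_diff_eq norm_triangle_ineq)
    also have "\<dots> \<le> k * (r - s) + k * (s - a)" using b'(2)[of r] r s(1) by (auto simp: S_def)
    finally have "r \<in> S" using r sb by (auto simp: S_def algebra_simps)
    then show False using s(2) r(1) by fastforce
  qed
  then show ?thesis using s(1) by (simp add: S_def)
qed

text \<open>The directional derivatives are pointwise limits of continuous difference quotients, hence
  continuous at the points of a residual set; there the map is differentiable.  This replaces
  Rademacher's theorem.\<close>

lemma directionally_differentiable_dense:
  fixes F :: "real^'n \<Rightarrow> real^'m"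
  assumes cont: "continuous_on UNIV F" and dd: "\<And>x. directionally_differentiable_at F x"
    and U: "open U" "U \<noteq> {}"
  shows "\<exists>x\<in>U. F differentiable (at x)"
proof -
  \<comment> \<open>Coordinate directions suffice: continuity of these finitely many derivatives at
    a single point yields full differentiability at that point.\<close>
  define D where "D x i = (SOME D. ((\<lambda>t. (F (x + t *\<^sub>R axis i 1) - F x) /\<^sub>R t) \<longlongrightarrow> D) (at_right 0))" for x i
  have D: "((\<lambda>t. (F (x + t *\<^sub>R axis i 1) - F x) /\<^sub>R t) \<longlongrightarrow> D x i) (at_right 0)" for x i
  proof -
    have "\<exists>D. ((\<lambda>t. (F (x + t *\<^sub>R axis i 1) - F x) /\<^sub>R t) \<longlongrightarrow> D) (at_right 0)"
      using dd[of x] unfolding directionally_differentiable_at_def by blast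
    then show ?thesis unfolding D_def by (rule someI_ex)
  qed
  define g where "g x = (\<chi> i. D x i)" for x
  define f where "f n x = (\<chi> i. (F (x + inverse (Suc n) *\<^sub>R axis i 1) - F x) /\<^sub>R inverse (Suc n))" for n :: nat and x
  have fcont: "continuous_on UNIV (f n)" for n
    unfolding f_def by (intro continuous_on_vec_lambda continuous_intros continuous_on_compose2[OF cont]) auto
  have "filterlim (\<lambda>n. inverse (real (Suc n))) (at_right 0) sequentially"
    by (intro tendsto_imp_filterlim_at_right LIMSEQ_inverse_real_of_nat) simp
  then have flim: "(\<lambda>n. f n x) \<longlonglongrightarrow> g x" for x
    unfolding f_def g_def using filterlim_compose[OF D] by (intro tendsto_vec_lambda) blast
  obtain x where x: "x \<in> U" "\<And>e. e > 0 \<Longrightarrow> \<exists>\<delta>>0. \<forall>y. dist y x < \<delta> \<longrightarrow> dist (g y) (g x) \<le> e"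
    using baire_one_continuity_point[OF fcont flim U] by blast
  define A where "A h = (\<Sum>i\<in>UNIV. h $ i *\<^sub>R D x i)" for h :: "real^'n"
  have "(F has_derivative A) (at x)" unfolding has_derivative_at_alt
  proof (intro conjI allI impI)
    show "bounded_linear A" unfolding A_def
      by (intro bounded_linear_sum bounded_linear_scaleR_left[THEN bounded_linear_compose] bounded_linear_vec_nth)
    fix e :: real assume e: "e > 0"
    \<comment> \<open>A coordinate move costs \<open>2 * e'\<close> times its length, one
      \<open>e'\<close> for the directional limit and one for the variation of \<open>D\<close>;
      there are \<open>CARD('n)\<close> moves.\<close>
    define e' where "e' = e / (2 * real CARD('n))"
    have e': "e' > 0" using e by (simp add: e'_def)
    obtain \<delta> where \<delta>: "\<delta> > 0" "\<And>y. dist y x < \<delta> \<Longrightarrow> dist (g y) (g x) \<le> e'" using x(2)[OF e'] by blast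
    have Dc: "norm (D y i - D x i) \<le> e'" if "norm (y - x) < \<delta>" for y i
    proof -
      have "norm ((g y - g x) $ i) \<le> norm (g y - g x)" by (rule Finite_Cartesian_Product.norm_nth_le)
      also have "\<dots> \<le> e'" using \<delta>(2)[of y] that by (simp add: dist_norm)
      finally show ?thesis by (simp add: g_def)
    qed
    have fwd: "norm (F (y + t *\<^sub>R axis i 1) - F y - t *\<^sub>R D x i) \<le> 2 * e' * t"
      if t: "t \<ge> 0" and seg: "\<And>s. 0 \<le> s \<Longrightarrow> s \<le> t \<Longrightarrow> norm (y + s *\<^sub>R axis i 1 - x) < \<delta>" for y t i
    proof -
      define \<phi> where "\<phi> s = F (y + s *\<^sub>R axis i 1) - s *\<^sub>R D x i" for s
      have "norm (\<phi> t - \<phi> 0) \<le> 2 * e' * (t - 0)"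
      proof (rule right_lipschitz_bound[OF t])
        show "continuous_on {0..t} \<phi>" unfolding \<phi>_def
          by (intro continuous_intros continuous_on_compose2[OF cont]) auto
        fix s assume s: "0 \<le> s" "s < t"
        define z where "z = y + s *\<^sub>R axis i 1"
        have "\<forall>\<^sub>F h in at_right 0. dist ((F (z + h *\<^sub>R axis i 1) - F z) /\<^sub>R h) (D z i) < e'"
          using tendstoD[OF D e'] .
        moreover have "\<forall>\<^sub>F h in at_right (0::real). 0 < h" by (rule eventually_at_right_less)
        ultimately have "\<forall>\<^sub>F h in at_right 0. norm (\<phi> (h + s) - \<phi> s) \<le> 2 * e' * h"
        proof eventually_elim
          case (elim h)
          have "norm (D z i - D x i) \<le> e'" using seg[of s] s by (intro Dc) (simp add: z_def)
          then have "norm ((F (z + h *\<^sub>R axis i 1) - F z) /\<^sub>R h - D x i) \<le> 2 * e'"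
            using norm_triangle_ineq[of "(F (z + h *\<^sub>R axis i 1) - F z) /\<^sub>R h - D z i" "D z i - D x i"] elim(1)
            by (simp add: dist_norm)
          moreover have "\<phi> (h + s) - \<phi> s = h *\<^sub>R ((F (z + h *\<^sub>R axis i 1) - F z) /\<^sub>R h - D x i)"
            using elim(2) by (simp add: \<phi>_def z_def scaleR_diff_right scaleR_add_left algebra_simps)
          ultimately show ?case using elim(2) by (simp add: mult.commute)
        qed
        then show "\<forall>\<^sub>F r in at_right s. norm (\<phi> r - \<phi> s) \<le> 2 * e' * (r - s)"
          unfolding eventually_at_right_to_0[of _ s] by simp
      qed
      then show ?thesis by (simp add: \<phi>_def algebra_simps)
    qed
    have step: "norm (F (y + t *\<^sub>R axis i 1) - F y - t *\<^sub>R D x i) \<le> 2 * e' * \<bar>t\<bar>"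
      if seg: "\<And>s. \<bar>s\<bar> \<le> \<bar>t\<bar> \<Longrightarrow> s * t \<ge> 0 \<Longrightarrow> norm (y + s *\<^sub>R axis i 1 - x) < \<delta>" for y t i
    proof (cases "t \<ge> 0")
      case True
      then show ?thesis using fwd[OF True, of y i] seg by simp
    next
      case False
      \<comment> \<open>A backward move is a forward move over the same segment, started at its
        other end point.\<close>
      define y' where "y' = y + t *\<^sub>R axis i 1"
      have "norm (F (y' + (-t) *\<^sub>R axis i 1) - F y' - (-t) *\<^sub>R D x i) \<le> 2 * e' * (-t)"
      proof (rule fwd)
        fix s assume s: "0 \<le> s" "s \<le> - t"
        have "norm (y + (s + t) *\<^sub>R axis i 1 - x) < \<delta>"
          using s False by (intro seg) (auto intro: mult_nonpos_nonpos)
        then show "norm (y' + s *\<^sub>R axis i 1 - x) < \<delta>" by (simp add: y'_def scaleR_add_left add_ac)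
      qed (use False in simp)
      moreover have "F (y' + (-t) *\<^sub>R axis i 1) - F y' - (-t) *\<^sub>R D x i
          = - (F (y + t *\<^sub>R axis i 1) - F y - t *\<^sub>R D x i)"
        by (simp add: y'_def)
      ultimately show ?thesis using False by (metis abs_of_neg not_le norm_minus_cancel)
    qed
    show "\<exists>d>0. \<forall>y. norm (y - x) < d \<longrightarrow> norm (F y - F x - A (y - x)) \<le> e * norm (y - x)"
    proof (intro exI[of _ \<delta>] conjI allI impI)
      fix y assume "norm (y - x) < \<delta>"
      define h where "h = y - x"
      have h: "norm h < \<delta>" using \<open>norm (y - x) < \<delta>\<close> by (simp add: h_def)
      \<comment> \<open>Truncating \<open>h\<close> to the coordinates in \<open>I\<close> does not
        increase its norm, so the path that adds one coordinate at a time stays inside the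
        \<delta>-ball.\<close>
      define hr where "hr I = (\<chi> j. if j \<in> I then h $ j else 0)" for I
      have part: "norm (F (x + hr I) - F x - (\<Sum>i\<in>I. h $ i *\<^sub>R D x i)) \<le> (\<Sum>i\<in>I. 2 * e' * \<bar>h $ i\<bar>)"
        if "finite I" for I using that
      proof (induction I rule: finite_induct)
        case empty
        have "hr {} = 0" by (simp add: hr_def vec_eq_iff)
        then show ?case by simp
      next
        case (insert i I)
        have hi: "hr (insert i I) = hr I + h $ i *\<^sub>R axis i 1"
          using insert(2) by (auto simp: hr_def vec_eq_iff axis_def)
        have "norm (F (x + hr I + h $ i *\<^sub>R axis i 1) - F (x + hr I) - h $ i *\<^sub>R D x i) \<le> 2 * e' * \<bar>h $ i\<bar>"
        proof (rule step)
          fix s assume s: "\<bar>s\<bar> \<le> \<bar>h $ i\<bar>"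
          have "norm (hr I + s *\<^sub>R axis i 1) \<le> norm h"
            using s insert(2) by (intro norm_le_componentwise_cart) (auto simp: hr_def axis_def)
          then show "norm (x + hr I + s *\<^sub>R axis i 1 - x) < \<delta>" using h by (simp add: add.assoc)
        qed
        moreover have "F (x + hr (insert i I)) - F x - (\<Sum>i\<in>insert i I. h $ i *\<^sub>R D x i)
          = (F (x + hr I + h $ i *\<^sub>R axis i 1) - F (x + hr I) - h $ i *\<^sub>R D x i)
            + (F (x + hr I) - F x - (\<Sum>i\<in>I. h $ i *\<^sub>R D x i))"
          using insert(1,2) by (simp add: hi add.assoc)
        ultimately show ?case using insert
          by (metis (no_types, lifting) add_mono norm_triangle_le sum.insert)
      qed
      have "hr UNIV = h" by (simp add: hr_def vec_eq_iff)
      then have "norm (F (x + h) - F x - A h) \<le> (\<Sum>i\<in>UNIV. 2 * e' * \<bar>h $ i\<bar>)"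
        using part[of UNIV] by (simp add: A_def)
      also have "\<dots> \<le> (\<Sum>i\<in>(UNIV::'n set). 2 * e' * norm h)"
        using e' by (intro sum_mono mult_left_mono component_le_norm_cart) auto
      also have "\<dots> = e * norm h" by (simp add: e'_def)
      finally show "norm (F y - F x - A (y - x)) \<le> e * norm (y - x)" by (simp add: h_def)
    qed (rule \<delta>(1))
  qed
  then show ?thesis using x(1) by (auto simp: differentiable_def)
qed

text \<open>The substitution is invertible, so differentiability of the composite gives back
  differentiability of \<open>S\<close> at the image point, and the limiting sequences correspond to
  each other up to the factor \<gamma>.\<close>

lemma clarke_jacobian_affine:
  fixes S :: "real^'n \<Rightarrow> real^'m"
  assumes \<gamma>: "\<gamma> \<noteq> 0" and J: "J \<in> clarke_jacobian (\<lambda>x. S (\<gamma> *\<^sub>R x + c)) x"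
  obtains K where "K \<in> clarke_jacobian S (\<gamma> *\<^sub>R x + c)" "J = \<gamma> *\<^sub>R K"
proof -
  define F where "F = (\<lambda>x. S (\<gamma> *\<^sub>R x + c))"
  have jac: "S differentiable (at (\<gamma> *\<^sub>R y + c))"
      "jacobian S (at (\<gamma> *\<^sub>R y + c)) = inverse \<gamma> *\<^sub>R jacobian F (at y)" if "F differentiable (at y)" for y
  proof -
    have S: "S = (\<lambda>z. F (inverse \<gamma> *\<^sub>R (z - c)))" using \<gamma> by (simp add: F_def)
    have 1: "((\<lambda>z. inverse \<gamma> *\<^sub>R (z - c)) has_derivative (\<lambda>h. inverse \<gamma> *\<^sub>R h)) (at (\<gamma> *\<^sub>R y + c))"
      by (auto intro!: derivative_eq_intros)
    have "(F has_derivative (\<lambda>h. jacobian F (at y) *v h)) (at y)" using that by (simp add: jacobian_works)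
    then have 2: "(F has_derivative (\<lambda>h. jacobian F (at y) *v h)) (at (inverse \<gamma> *\<^sub>R ((\<gamma> *\<^sub>R y + c) - c)))"
      using \<gamma> by simp
    have "(S has_derivative (\<lambda>h. jacobian F (at y) *v (inverse \<gamma> *\<^sub>R h))) (at (\<gamma> *\<^sub>R y + c))"
      using has_derivative_compose[OF 1 2] S by simp
    then have "(S has_derivative (\<lambda>h. (inverse \<gamma> *\<^sub>R jacobian F (at y)) *v h)) (at (\<gamma> *\<^sub>R y + c))"
      by (simp add: matrix_vector_mult_scaleR scaleR_matrix_vector_assoc)
    then show "S differentiable (at (\<gamma> *\<^sub>R y + c))"
      "jacobian S (at (\<gamma> *\<^sub>R y + c)) = inverse \<gamma> *\<^sub>R jacobian F (at y)"
      by (rule has_derivative_matrix_imp_jacobian)+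
  qed
  define B where "B G y = {J. \<exists>s. (\<forall>i::nat. G differentiable (at (s i))) \<and> s \<longlonglongrightarrow> y \<and>
      (\<lambda>i. jacobian G (at (s i))) \<longlonglongrightarrow> J}" for G :: "real^'n \<Rightarrow> real^'m" and y
  have "B F x \<subseteq> (*\<^sub>R) \<gamma> ` B S (\<gamma> *\<^sub>R x + c)"
  proof
    fix J assume "J \<in> B F x"
    then obtain s where s: "\<And>i::nat. F differentiable (at (s i))" "s \<longlonglongrightarrow> x"
      "(\<lambda>i. jacobian F (at (s i))) \<longlonglongrightarrow> J" by (auto simp: B_def)
    have "inverse \<gamma> *\<^sub>R J \<in> B S (\<gamma> *\<^sub>R x + c)" unfolding B_def mem_Collect_eq
    proof (intro exI[of _ "\<lambda>i. \<gamma> *\<^sub>R s i + c"] conjI allI)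
      show "(\<lambda>i. \<gamma> *\<^sub>R s i + c) \<longlonglongrightarrow> \<gamma> *\<^sub>R x + c" by (intro tendsto_intros s)
      show "(\<lambda>i. jacobian S (at (\<gamma> *\<^sub>R s i + c))) \<longlonglongrightarrow> inverse \<gamma> *\<^sub>R J"
        unfolding jac(2)[OF s(1)] by (intro tendsto_intros s)
    qed (rule jac(1)[OF s(1)])
    moreover have "J = \<gamma> *\<^sub>R (inverse \<gamma> *\<^sub>R J)" using \<gamma> by simp
    ultimately show "J \<in> (*\<^sub>R) \<gamma> ` B S (\<gamma> *\<^sub>R x + c)" by blast
  qed
  then have "convex hull (B F x) \<subseteq> (*\<^sub>R) \<gamma> ` (convex hull (B S (\<gamma> *\<^sub>R x + c)))"
    using hull_mono convex_hull_scaling by metis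
  moreover have "clarke_jacobian F x = convex hull (B F x)"
    "clarke_jacobian S (\<gamma> *\<^sub>R x + c) = convex hull (B S (\<gamma> *\<^sub>R x + c))"
    by (simp_all add: clarke_jacobian_def B_def)
  ultimately show ?thesis using J that unfolding F_def by blast
qed

lemma directionally_differentiable_affine:
  assumes "directionally_differentiable_at S (\<gamma> *\<^sub>R x + c)" and \<gamma>: "\<gamma> > 0"
  shows "directionally_differentiable_at (\<lambda>x. S (\<gamma> *\<^sub>R x + c)) x"
  unfolding directionally_differentiable_at_def
proof
  fix d
  obtain D where D: "((\<lambda>t. (S (\<gamma> *\<^sub>R x + c + t *\<^sub>R (\<gamma> *\<^sub>R d)) - S (\<gamma> *\<^sub>R x + c)) /\<^sub>R t) \<longlongrightarrow> D) (at_right 0)"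
    using assms(1) unfolding directionally_differentiable_at_def by blast
  moreover have "\<gamma> *\<^sub>R x + c + t *\<^sub>R (\<gamma> *\<^sub>R d) = \<gamma> *\<^sub>R (x + t *\<^sub>R d) + c" for t
    by (simp add: algebra_simps)
  ultimately have "((\<lambda>t. (S (\<gamma> *\<^sub>R (x + t *\<^sub>R d) + c) - S (\<gamma> *\<^sub>R x + c)) /\<^sub>R t) \<longlongrightarrow> D) (at_right 0)"
    by (simp only:)
  then show "\<exists>D. ((\<lambda>t. (S (\<gamma> *\<^sub>R (x + t *\<^sub>R d) + c) - S (\<gamma> *\<^sub>R x + c)) /\<^sub>R t) \<longlongrightarrow> D) (at_right 0)" ..
qed

lemma semismooth_affine_estimate:
  fixes S :: "real^'n \<Rightarrow> real^'m"
  assumes ss: "semismooth S" and \<gamma>: "\<gamma> > 0" and e: "e > 0"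
  obtains \<delta> where "\<delta> > 0" "\<And>d H. norm d < \<delta> \<Longrightarrow> H \<in> clarke_jacobian (\<lambda>x. S (\<gamma> *\<^sub>R x + c)) (x + d) \<Longrightarrow>
    norm (S (\<gamma> *\<^sub>R (x + d) + c) - S (\<gamma> *\<^sub>R x + c) - H *v d) \<le> e * norm d"
proof -
  obtain \<delta> where \<delta>: "\<delta> > 0" "\<And>d H. norm d < \<delta> \<Longrightarrow> H \<in> clarke_jacobian S (\<gamma> *\<^sub>R x + c + d) \<Longrightarrow>
     norm (S (\<gamma> *\<^sub>R x + c + d) - S (\<gamma> *\<^sub>R x + c) - H *v d) \<le> e / \<gamma> * norm d"
  proof -
    \<comment> \<open>The argument of \<open>S\<close> moves by \<open>\<gamma> *\<^sub>R d\<close>,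
      so the tolerance is divided by \<gamma>.\<close>
    have "e / \<gamma> > 0" using e \<gamma> by simp
    with ss have "\<exists>\<delta>>0. \<forall>d. norm d < \<delta> \<longrightarrow> (\<forall>H\<in>clarke_jacobian S (\<gamma> *\<^sub>R x + c + d).
       norm (S (\<gamma> *\<^sub>R x + c + d) - S (\<gamma> *\<^sub>R x + c) - H *v d) \<le> e / \<gamma> * norm d)"
      unfolding semismooth_def by blast
    then show thesis using that by blast
  qed
  show ?thesis
  proof (rule that[of "\<delta> / \<gamma>"])
    show "\<delta> / \<gamma> > 0" using \<delta>(1) \<gamma> by simp
    fix d H assume d: "norm d < \<delta> / \<gamma>" and H: "H \<in> clarke_jacobian (\<lambda>x. S (\<gamma> *\<^sub>R x + c)) (x + d)"
    obtain K where K: "K \<in> clarke_jacobian S (\<gamma> *\<^sub>R (x + d) + c)" "H = \<gamma> *\<^sub>R K"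
      using clarke_jacobian_affine[OF _ H] \<gamma> by auto
    have eq: "\<gamma> *\<^sub>R (x + d) + c = \<gamma> *\<^sub>R x + c + \<gamma> *\<^sub>R d" by (simp add: scaleR_add_right)
    have "norm (\<gamma> *\<^sub>R d) < \<delta>" using d \<gamma> by (simp add: field_simps)
    from \<delta>(2)[OF this K(1)[unfolded eq]]
    show "norm (S (\<gamma> *\<^sub>R (x + d) + c) - S (\<gamma> *\<^sub>R x + c) - H *v d) \<le> e * norm d"
      using \<gamma> unfolding eq K(2) by (simp add: matrix_vector_mult_scaleR scaleR_matrix_vector_assoc)
  qed
qed

section \<open>Inexact Newton method with line search\<close>

lemma symmetric_matrix_inner:
  fixes K :: "real^'n^'n"
  assumes "transpose K = K"
  shows "(K *v x) \<bullet> y = x \<bullet> (K *v y)"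
  using inner_transpose[of K x y] assms by simp

text \<open>For the descent property only the local relations \<open>r = b - K d\<close> and \<open>r \<bullet> s = r \<bullet> r\<close> matter:
  every step is an exact line search, so the quadratic model decreases at least as much as in
  the first step.\<close>

lemma cg_state_invariant:
  fixes K :: "real^'n^'n"
  assumes pd: "\<And>x. x \<noteq> 0 \<Longrightarrow> 0 < (K *v x) \<bullet> x"
    and st: "cg_state K b i = (d, r, s)"
  shows "r = b - K *v d \<and> r \<bullet> s = r \<bullet> r"
  using st
proof (induction i arbitrary: d r s)
  case (Suc i)
  obtain d0 r0 s0 where st0: "cg_state K b i = (d0, r0, s0)" by (cases "cg_state K b i") auto
  have IH: "r0 = b - K *v d0" "r0 \<bullet> s0 = r0 \<bullet> r0" using Suc.IH[OF st0] by auto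
  define a where "a = (r0 \<bullet> r0) / (s0 \<bullet> (K *v s0))"
  define c where "c = (r \<bullet> r) / (r0 \<bullet> r0)"
  have new: "d = d0 + a *\<^sub>R s0" "r = r0 - a *\<^sub>R (K *v s0)" "s = r + c *\<^sub>R s0"
    using Suc.prems st0 by (auto simp: Let_def a_def c_def)
  have "r = b - K *v d"
    by (simp add: new IH matrix_vector_right_distrib matrix_vector_mult_scaleR)
  moreover have "r \<bullet> s0 = 0"
  proof (cases "s0 = 0")
    case False
    then have "s0 \<bullet> (K *v s0) > 0" using pd[OF False] by (simp add: inner_commute)
    then have "a * ((K *v s0) \<bullet> s0) = r0 \<bullet> r0" by (simp add: a_def inner_commute)
    then show ?thesis by (simp add: new inner_diff_left IH(2))
  qed simp
  ultimately show ?case by (simp add: new(3) inner_add_right)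
qed simp

lemma cg_iterate_quadratic_le:
  fixes K :: "real^'n^'n" and b :: "real^'n"
  assumes sym: "transpose K = K" and pd: "\<And>x. x \<noteq> 0 \<Longrightarrow> 0 < (K *v x) \<bullet> x" and i: "i \<ge> 1"
  defines "d \<equiv> cg_iterate K b i"
  shows "(K *v d) \<bullet> d / 2 - b \<bullet> d \<le> - ((b \<bullet> b)\<^sup>2 / (2 * (b \<bullet> (K *v b))))"
proof -
  define q where "q d = (K *v d) \<bullet> d / 2 - b \<bullet> d" for d
  \<comment> \<open>Exact minimization along \<open>s\<close> subtracts
    \<open>(r \<bullet> s)\<^sup>2 / (2 * (s \<bullet> (K *v s)))\<close>, and the invariant
    replaces \<open>r \<bullet> s\<close> by \<open>r \<bullet> r\<close>.\<close>
  have step: "q (cg_iterate K b (Suc i)) = q d - (r \<bullet> r)\<^sup>2 / (2 * (s \<bullet> (K *v s)))"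
    if st: "cg_state K b i = (d, r, s)" for i d r s
  proof -
    have inv: "r = b - K *v d" "r \<bullet> s = r \<bullet> r" using cg_state_invariant[OF pd st] by auto
    define a where "a = (r \<bullet> r) / (s \<bullet> (K *v s))"
    have it: "cg_iterate K b (Suc i) = d + a *\<^sub>R s" using st by (simp add: cg_iterate_def Let_def a_def)
    have rs: "b \<bullet> s - (K *v d) \<bullet> s = r \<bullet> r" using inv by (simp add: inner_diff_left)
    have Ks: "(K *v s) \<bullet> d = (K *v d) \<bullet> s" using symmetric_matrix_inner[OF sym] by (simp add: inner_commute)
    have "q (d + a *\<^sub>R s) = q d - a * (b \<bullet> s - (K *v d) \<bullet> s) + a\<^sup>2 * (s \<bullet> (K *v s)) / 2"
      by (simp add: q_def matrix_vector_right_distrib matrix_vector_mult_scaleR inner_add_left inner_add_right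
          Ks inner_commute[of s] power2_eq_square algebra_simps)
    also have "\<dots> = q d - (r \<bullet> r)\<^sup>2 / (2 * (s \<bullet> (K *v s)))"
      unfolding rs by (simp add: a_def power2_eq_square)
    finally show ?thesis by (simp add: it)
  qed
  have dec: "q (cg_iterate K b (Suc i)) \<le> q (cg_iterate K b i)" for i
  proof -
    obtain d r s where st: "cg_state K b i = (d, r, s)" by (cases "cg_state K b i") auto
    have "s \<bullet> (K *v s) \<ge> 0" using pd[of s] by (cases "s = 0") (auto simp: inner_commute)
    then have "(r \<bullet> r)\<^sup>2 / (2 * (s \<bullet> (K *v s))) \<ge> 0" by simp
    moreover have "d = cg_iterate K b i" by (simp add: cg_iterate_def st)
    ultimately show ?thesis using step[OF st] by simp
  qed
  have "q d \<le> q (cg_iterate K b 1)"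
    using i unfolding d_def
  proof (induction i rule: dec_induct)
    case (step n)
    then show ?case using dec[of n] by simp
  qed simp
  also have "q (cg_iterate K b 1) = - ((b \<bullet> b)\<^sup>2 / (2 * (b \<bullet> (K *v b))))"
    using step[of 0 0 b b] by (simp add: q_def)
  finally show ?thesis by (simp add: q_def)
qed

text \<open>The infinite sequence may hit a stationary point; there 0 / 0 = 0 keeps the whole state
  at zero, so the direction vanishes too.\<close>

lemma cg_iterate_zero: "cg_iterate K 0 i = 0"
proof -
  have "cg_state K 0 i = (0, 0, 0)" by (induction i) (auto simp: Let_def)
  then show ?thesis by (simp add: cg_iterate_def)
qed

text \<open>The Hessian is an arbitrary set-valued map, so no relation to a Clarke Jacobian of
  \<open>G\<close> is presupposed. Uniform positivity and semismoothness are local at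
  \<open>xhat\<close>, whose stationarity is not assumed but concluded from the iterates.\<close>

locale newton_problem =
  fixes \<Psi> :: "real^'n \<Rightarrow> real" and G :: "real^'n \<Rightarrow> real^'n" and hess :: "real^'n \<Rightarrow> (real^'n^'n) set"
    and L c \<delta>0 :: real and xhat :: "real^'n" and \<tau> \<tau>1 \<tau>2 \<beta> \<zeta> :: real
  assumes sc: "smooth_convex L \<Psi> G"
    and hess_sym: "H \<in> hess x \<Longrightarrow> transpose H = H"
    and hess_nonneg: "H \<in> hess x \<Longrightarrow> 0 \<le> (H *v d) \<bullet> d"
    and hess_le: "H \<in> hess x \<Longrightarrow> norm (H *v d) \<le> L * norm d"
    and c: "c > 0" and \<delta>0: "\<delta>0 > 0"
    and hess_ge: "norm (x - xhat) < \<delta>0 \<Longrightarrow> H \<in> hess x \<Longrightarrow> c * (norm d)\<^sup>2 \<le> (H *v d) \<bullet> d"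
    and hess_semismooth: "e > 0 \<Longrightarrow> \<exists>\<delta>>0. \<forall>x H. norm (x - xhat) < \<delta> \<longrightarrow> H \<in> hess x \<longrightarrow>
      norm (G x - G xhat - H *v (x - xhat)) \<le> e * norm (x - xhat)"
    and G_directional: "directionally_differentiable_at G xhat"
    and \<tau>: "\<tau> > 0" and \<tau>1: "\<tau>1 \<in> {0<..<1}" and \<tau>2: "\<tau>2 \<in> {0<..<1}" and \<beta>: "\<beta> \<in> {0<..<1}"
    and \<zeta>: "\<zeta> \<in> {0<..<1/2}"
begin

lemma L_nonneg: "L \<ge> 0" by (rule smooth_convexD(1)[OF sc])

lemma G_lipschitz: "norm (G y - G x) \<le> L * norm (y - x)" by (rule smooth_convexD(4)[OF sc])

lemma armijo_iff: "armijo \<Psi> \<beta> \<zeta> x d q \<longleftrightarrow> \<Psi> (x + \<beta> ^ q *\<^sub>R d) \<le> \<Psi> x + \<zeta> * \<beta> ^ q * (G x \<bullet> d)"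
  by (simp add: armijo_def smooth_convex_grad[OF sc])

lemma shift_mult: "(H + \<theta> *\<^sub>R mat 1) *v d = H *v d + \<theta> *\<^sub>R (d :: real^'n)"
  by (simp add: matrix_vector_mult_add_rdistrib scaleR_matrix_vector_assoc[symmetric])

text \<open>This rearranges the decrease of the regularized quadratic model, using \<open>b
  \<bullet> (K *v b) \<le> (L + \<theta> + 1) * (b \<bullet> b)\<close>. The curvature term controls
  \<open>norm d\<close> and hence the step length; the gradient term guarantees descent
  independently of \<open>d\<close>.\<close>

lemma newton_direction_descent:
  assumes H: "H \<in> hess x" and d: "newton_direction \<tau> \<tau>1 \<tau>2 H (G x) d"
  shows "(H *v d) \<bullet> d / 2 + (norm (G x))\<^sup>2 / (2 * (L + \<tau>1 * norm (G x) + 1)) \<le> - (G x \<bullet> d)"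
proof (cases "G x = 0")
  case True
  then have "d = 0" using d by (auto simp: newton_direction_def Let_def cg_iterate_zero)
  then show ?thesis by (simp add: True)
next
  case False
  define b where "b = - G x"
  define \<theta> where "\<theta> = \<tau>1 * norm (G x)"
  define K where "K = H + \<theta> *\<^sub>R mat 1"
  have \<theta>: "\<theta> > 0" using False \<tau>1 by (simp add: \<theta>_def)
  have K: "K *v v = H *v v + \<theta> *\<^sub>R v" for v by (simp add: K_def shift_mult)
  have sym: "transpose K = K" using hess_sym[OF H]
    by (simp add: K_def transpose_def vec_eq_iff mat_def)
  have pd: "0 < (K *v v) \<bullet> v" if "v \<noteq> 0" for v
    using hess_nonneg[OF H, of v] \<theta> that by (simp add: K inner_add_left add_nonneg_pos)
  obtain i where i: "i \<ge> 1" "d = cg_iterate K b i"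
    using d by (auto simp: newton_direction_def Let_def K_def \<theta>_def b_def)
  have q: "(K *v d) \<bullet> d / 2 - b \<bullet> d \<le> - ((b \<bullet> b)\<^sup>2 / (2 * (b \<bullet> (K *v b))))"
    unfolding i(2) by (rule cg_iterate_quadratic_le[OF sym pd i(1)])
  have bb: "b \<bullet> b > 0" using False by (simp add: b_def)
  have bKb: "0 < b \<bullet> (K *v b)" using pd[of b] False by (simp add: b_def inner_commute)
  have "b \<bullet> (H *v b) \<le> norm b * (L * norm b)"
    by (rule order_trans[OF norm_cauchy_schwarz mult_left_mono[OF hess_le[OF H]]]) simp
  then have "b \<bullet> (K *v b) \<le> (L + \<theta> + 1) * (b \<bullet> b)"
    using bb by (simp add: K inner_add_right algebra_simps power2_norm_eq_inner[symmetric] power2_eq_square)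
  then have "(b \<bullet> b)\<^sup>2 / (2 * ((L + \<theta> + 1) * (b \<bullet> b))) \<le> (b \<bullet> b)\<^sup>2 / (2 * (b \<bullet> (K *v b)))"
    using bKb bb L_nonneg \<theta> by (intro divide_left_mono mult_left_mono mult_pos_pos) auto
  also have "\<dots> \<le> b \<bullet> d - (K *v d) \<bullet> d / 2" using q by simp
  also have "\<dots> \<le> b \<bullet> d - (H *v d) \<bullet> d / 2" using \<theta> by (simp add: K inner_add_left)
  finally have "(b \<bullet> b)\<^sup>2 / (2 * ((L + \<theta> + 1) * (b \<bullet> b))) \<le> b \<bullet> d - (H *v d) \<bullet> d / 2" .
  moreover have "(b \<bullet> b)\<^sup>2 / (2 * ((L + \<theta> + 1) * (b \<bullet> b))) = (norm (G x))\<^sup>2 / (2 * (L + \<theta> + 1))"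
    using bb by (simp add: power2_eq_square b_def power2_norm_eq_inner dot_square_norm)
  ultimately show ?thesis by (simp add: \<theta>_def b_def)
qed

text \<open>By the descent lemma and
  \<open>c / 2 * (norm d)\<^sup>2 \<le> - (G x \<bullet> d)\<close>, every power with
  \<open>L * \<beta> ^ p \<le> (1 - \<zeta>) * c\<close> passes the test. The last rejected exponent
  is \<open>q - 1\<close>, which accounts for the additional factor \<beta>.\<close>

lemma armijo_step_ge:
  assumes H: "H \<in> hess x" and d: "newton_direction \<tau> \<tau>1 \<tau>2 H (G x) d"
    and x: "norm (x - xhat) < \<delta>0" and q: "\<And>p. p < q \<Longrightarrow> \<not> armijo \<Psi> \<beta> \<zeta> x d p"
  shows "min 1 (\<beta> * (1 - \<zeta>) * c / (L + 1)) \<le> \<beta> ^ q"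
proof (cases q)
  case (Suc p)
  have "c * (norm d)\<^sup>2 \<le> (H *v d) \<bullet> d" by (rule hess_ge[OF x H])
  moreover have "0 \<le> (norm (G x))\<^sup>2 / (2 * (L + \<tau>1 * norm (G x) + 1))" using L_nonneg \<tau>1 by simp
  ultimately have desc: "c / 2 * (norm d)\<^sup>2 \<le> - (G x \<bullet> d)"
    using newton_direction_descent[OF H d] by simp
  have bp: "\<beta> ^ p > 0" using \<beta> by simp
  have "\<not> L * \<beta> ^ p \<le> (1 - \<zeta>) * c"
  proof
    assume *: "L * \<beta> ^ p \<le> (1 - \<zeta>) * c"
    have "\<Psi> (x + \<beta> ^ p *\<^sub>R d) \<le> \<Psi> x + G x \<bullet> (\<beta> ^ p *\<^sub>R d) + L / 2 * (norm (\<beta> ^ p *\<^sub>R d))\<^sup>2"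
      using smooth_convexD(3)[OF sc, of "x + \<beta> ^ p *\<^sub>R d" x] by simp
    also have "\<dots> = \<Psi> x + \<beta> ^ p * (G x \<bullet> d) + \<beta> ^ p * (L * \<beta> ^ p * ((norm d)\<^sup>2 / 2))"
      using bp by (simp add: power_mult_distrib power2_eq_square)
    also have "\<dots> \<le> \<Psi> x + \<beta> ^ p * (G x \<bullet> d) + \<beta> ^ p * ((1 - \<zeta>) * c * ((norm d)\<^sup>2 / 2))"
      using * bp by (intro add_left_mono mult_left_mono mult_right_mono) auto
    also have "\<dots> \<le> \<Psi> x + \<beta> ^ p * (G x \<bullet> d) + \<beta> ^ p * ((1 - \<zeta>) * (- (G x \<bullet> d)))"
      unfolding mult.assoc using desc \<zeta> bp by (intro add_left_mono mult_left_mono) auto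
    also have "\<dots> = \<Psi> x + \<zeta> * \<beta> ^ p * (G x \<bullet> d)" by (simp add: algebra_simps)
    finally have "armijo \<Psi> \<beta> \<zeta> x d p" by (simp add: armijo_iff)
    then show False using q[of p] Suc by simp
  qed
  then have "(1 - \<zeta>) * c \<le> (L + 1) * \<beta> ^ p" using bp by (simp add: distrib_right)
  then have "(1 - \<zeta>) * c / (L + 1) \<le> \<beta> ^ p" using L_nonneg by (simp add: pos_divide_le_eq mult.commute)
  then have "\<beta> * ((1 - \<zeta>) * c / (L + 1)) \<le> \<beta> * \<beta> ^ p" using \<beta> by (intro mult_left_mono) auto
  then show ?thesis using Suc by (simp add: mult.assoc)
qed simp

lemma newton_step_contraction:
  assumes \<eta>: "\<eta> > 0" and G0: "G xhat = 0"
  obtains \<delta> where "\<delta> > 0" "\<And>x H d. norm (x - xhat) < \<delta> \<Longrightarrow> H \<in> hess x \<Longrightarrow>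
    newton_direction \<tau> \<tau>1 \<tau>2 H (G x) d \<Longrightarrow> norm (x + d - xhat) \<le> \<eta> * norm (x - xhat)"
proof -
  \<comment> \<open>Three errors of size \<open>\<epsilon> * norm e\<close> arise: the solver
    residual, the semismooth remainder and the regularization. The lower bound \<open>c\<close> on
    the Hessian converts their sum into \<eta>.\<close>
  define \<epsilon> where "\<epsilon> = \<eta> * c / 3"
  have \<epsilon>: "\<epsilon> > 0" using \<eta> c by (simp add: \<epsilon>_def)
  obtain \<delta>1 where \<delta>1: "\<delta>1 > 0" "\<And>x H. norm (x - xhat) < \<delta>1 \<Longrightarrow> H \<in> hess x \<Longrightarrow>
      norm (G x - H *v (x - xhat)) \<le> \<epsilon> * norm (x - xhat)"
    using hess_semismooth[OF \<epsilon>] by (auto simp: G0)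
  \<comment> \<open>Below this gradient norm, \<open>norm (G x) powr \<tau>\<close> is at most
    \<open>\<epsilon> / (L + 1)\<close>; this makes the superlinear residual bound linear in
    \<open>norm e\<close> with factor \<epsilon>.\<close>
  define k where "k = (\<epsilon> / (L + 1)) powr (1 / \<tau>)"
  have k: "k > 0" using \<epsilon> L_nonneg by (simp add: k_def)
  define \<delta> where "\<delta> = Min {\<delta>0, \<delta>1, \<epsilon> / (L + 1), k / (L + 1)}"
  show ?thesis
  proof (rule that[of \<delta>])
    show "\<delta> > 0" using \<delta>0 \<delta>1 \<epsilon> k L_nonneg by (simp add: \<delta>_def)
    fix x H d assume x: "norm (x - xhat) < \<delta>" and H: "H \<in> hess x"
      and nd: "newton_direction \<tau> \<tau>1 \<tau>2 H (G x) d"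
    define e where "e = x - xhat"
    define u where "u = x + d - xhat"
    define \<theta> where "\<theta> = \<tau>1 * norm (G x)"
    have \<theta>: "\<theta> \<ge> 0" using \<tau>1 by (simp add: \<theta>_def)
    have ex: "norm e < \<delta>0" "norm e < \<delta>1" "norm e < \<epsilon> / (L + 1)" "norm e < k / (L + 1)"
      using x by (auto simp: \<delta>_def e_def)
    have Le3: "L * norm e \<le> \<epsilon>"
      using ex(3) L_nonneg by (simp add: pos_less_divide_eq distrib_left) (smt (verit, best) mult.commute norm_ge_zero)
    have Lek: "L * norm e \<le> k"
      using ex(4) L_nonneg by (simp add: pos_less_divide_eq distrib_left) (smt (verit, best) mult.commute norm_ge_zero)
    have Gx: "norm (G x) \<le> L * norm e" using G_lipschitz[of x xhat] by (simp add: G0 e_def)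
    have "norm (G x) powr \<tau> \<le> k powr \<tau>" using Gx Lek \<tau> by (intro powr_mono2) auto
    also have "k powr \<tau> = \<epsilon> / (L + 1)" using \<tau> \<epsilon> L_nonneg by (simp add: k_def powr_powr)
    finally have "norm (G x) * norm (G x) powr \<tau> \<le> (L * norm e) * (\<epsilon> / (L + 1))"
      using Gx L_nonneg by (intro mult_mono) auto
    also have "\<dots> = (L / (L + 1)) * (\<epsilon> * norm e)" by simp
    also have "\<dots> \<le> 1 * (\<epsilon> * norm e)" using L_nonneg \<epsilon> by (intro mult_right_mono) auto
    finally have "norm (G x) powr (1 + \<tau>) \<le> \<epsilon> * norm e" by (simp add: powr_add)
    then have "\<tau>2 * norm (G x) powr (1 + \<tau>) \<le> 1 * (\<epsilon> * norm e)"
      using \<tau>2 by (intro mult_mono) auto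
    then have r1: "norm (H *v d + \<theta> *\<^sub>R d + G x) \<le> \<epsilon> * norm e"
      using nd by (simp add: newton_direction_def Let_def shift_mult \<theta>_def)
    have r2: "norm (G x - H *v e) \<le> \<epsilon> * norm e" using \<delta>1(2) ex(2) H by (simp add: e_def)
    have "\<theta> \<le> \<epsilon>" unfolding \<theta>_def using \<tau>1 Gx Le3
      by (smt (verit) greaterThanLessThan_iff mult_left_le_one_le norm_ge_zero)
    then have r3: "norm (\<theta> *\<^sub>R e) \<le> \<epsilon> * norm e" using \<theta> by (simp add: mult_right_mono)
    have "u = e + d" by (simp add: u_def e_def)
    \<comment> \<open>The error \<open>u\<close> after the full step solves the regularized system
      with a right-hand side made only of the three small terms.\<close>
    then have "H *v u + \<theta> *\<^sub>R u = (H *v d + \<theta> *\<^sub>R d + G x) - (G x - H *v e) + \<theta> *\<^sub>R e"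
      by (simp add: matrix_vector_right_distrib scaleR_add_right)
    then have "norm (H *v u + \<theta> *\<^sub>R u) = norm ((H *v d + \<theta> *\<^sub>R d + G x) - (G x - H *v e) + \<theta> *\<^sub>R e)"
      by (rule arg_cong)
    then have "norm (H *v u + \<theta> *\<^sub>R u) \<le> \<epsilon> * norm e + \<epsilon> * norm e + \<epsilon> * norm e"
      using r1 r2 r3 norm_triangle_ineq4[of "H *v d + \<theta> *\<^sub>R d + G x" "G x - H *v e"]
        norm_triangle_ineq[of "(H *v d + \<theta> *\<^sub>R d + G x) - (G x - H *v e)" "\<theta> *\<^sub>R e"] by linarith
    also have "\<dots> = c * (\<eta> * norm e)" by (simp add: \<epsilon>_def)
    finally have Ku: "norm (H *v u + \<theta> *\<^sub>R u) \<le> c * (\<eta> * norm e)" .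
    have "c * norm u * norm u \<le> (H *v u) \<bullet> u"
      using hess_ge[of x H u] ex(1) H by (simp add: e_def power2_eq_square)
    also have "\<dots> \<le> (H *v u + \<theta> *\<^sub>R u) \<bullet> u" using \<theta> by (simp add: inner_add_left)
    also have "\<dots> \<le> norm (H *v u + \<theta> *\<^sub>R u) * norm u" by (rule norm_cauchy_schwarz)
    also have "\<dots> \<le> c * (\<eta> * norm e) * norm u" using Ku by (rule mult_right_mono) simp
    finally have "norm u \<le> \<eta> * norm e" using c \<eta>
      by (cases "norm u = 0") (auto simp: mult_le_cancel_right)
    then show "norm (x + d - xhat) \<le> \<eta> * norm (x - xhat)" by (simp add: u_def e_def)
  qed
qed

text \<open>A directional derivative is positively homogeneous, so \<open>G\<close> is nearly linear
  on each ray. Uniformity over rays comes by contradiction: the unit directions accumulate at some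
  \<open>v\<close>, and the Lipschitz bound transfers the estimate along \<open>v\<close> to nearby
  directions.\<close>

lemma G_radial_estimate:
  assumes e: "e > 0" and G0: "G xhat = 0"
  obtains \<delta> where "\<delta> > 0" "\<And>d t. norm d < \<delta> \<Longrightarrow> 0 \<le> t \<Longrightarrow> t \<le> 1 \<Longrightarrow>
    norm (G (xhat + t *\<^sub>R d) - t *\<^sub>R G (xhat + d)) \<le> e * norm d"
proof -
  have "\<exists>n::nat. \<forall>d t. norm d < inverse (Suc n) \<longrightarrow> 0 \<le> t \<longrightarrow> t \<le> 1 \<longrightarrow>
    norm (G (xhat + t *\<^sub>R d) - t *\<^sub>R G (xhat + d)) \<le> e * norm d"
  proof (rule ccontr)
    assume "\<not> ?thesis"
    then have "\<forall>n::nat. \<exists>d t. norm d < inverse (Suc n) \<and> 0 \<le> t \<and> t \<le> 1 \<and>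
      e * norm d < norm (G (xhat + t *\<^sub>R d) - t *\<^sub>R G (xhat + d))" by (auto simp: not_le)
    then obtain d t where dt: "\<And>n::nat. norm (d n) < inverse (Suc n)" "\<And>n. 0 \<le> t n" "\<And>n. t n \<le> (1::real)"
      "\<And>n. e * norm (d n) < norm (G (xhat + t n *\<^sub>R d n) - t n *\<^sub>R G (xhat + d n))" by metis
    have d0: "d n \<noteq> 0" for n using dt(4)[of n] G0 by auto
    define u where "u n = d n /\<^sub>R norm (d n)" for n
    have du: "d n = norm (d n) *\<^sub>R u n" for n using d0 by (simp add: u_def)
    have "\<And>n. u n \<in> sphere 0 1" using d0 by (simp add: u_def)
    then obtain v r where r: "strict_mono r" "(u \<circ> r) \<longlonglongrightarrow> v"
      using compact_sphere[of "0::real^'n" 1] unfolding compact_def by metis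
    have "d \<longlonglongrightarrow> 0" using dt(1) by (intro LIMSEQ_if_dist_less_inverse) simp
    then have "(\<lambda>n. norm ((d \<circ> r) n)) \<longlonglongrightarrow> 0"
      using LIMSEQ_subseq_LIMSEQ r(1) tendsto_norm_zero by blast
    obtain D where D: "((\<lambda>s. (G (xhat + s *\<^sub>R v) - G xhat) /\<^sub>R s) \<longlongrightarrow> D) (at_right 0)"
      using G_directional unfolding directionally_differentiable_at_def by blast
    have "\<forall>\<^sub>F s in at_right 0. dist ((G (xhat + s *\<^sub>R v) - G xhat) /\<^sub>R s) D < e / 4"
      using tendstoD[OF D, of "e / 4"] e by simp
    then obtain \<delta> where \<delta>: "\<delta> > 0"
      "\<And>s. 0 < s \<Longrightarrow> s < \<delta> \<Longrightarrow> dist ((G (xhat + s *\<^sub>R v) - G xhat) /\<^sub>R s) D < e / 4"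
      unfolding eventually_at_right_field by auto
    have near: "norm (G (xhat + s *\<^sub>R v) - s *\<^sub>R D) \<le> e / 4 * s" if "0 \<le> s" "s < \<delta>" for s
    proof (cases "s = 0")
      case False
      have "G (xhat + s *\<^sub>R v) - s *\<^sub>R D = s *\<^sub>R ((G (xhat + s *\<^sub>R v) - G xhat) /\<^sub>R s - D)"
        using False by (simp add: G0 scaleR_diff_right)
      then have "norm (G (xhat + s *\<^sub>R v) - s *\<^sub>R D) = s * norm ((G (xhat + s *\<^sub>R v) - G xhat) /\<^sub>R s - D)"
        using that(1) by simp
      also have "\<dots> \<le> s * (e / 4)"
        using \<delta>(2)[of s] that False by (intro mult_left_mono) (auto simp: dist_norm)
      finally show ?thesis by (simp add: mult.commute)
    qed (simp add: G0)
    have "\<forall>\<^sub>F n in sequentially. norm ((d \<circ> r) n) < \<delta>"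
      using \<open>(\<lambda>n. norm ((d \<circ> r) n)) \<longlonglongrightarrow> 0\<close> \<delta>(1) by (rule order_tendstoD)
    moreover have "\<forall>\<^sub>F n in sequentially. dist ((u \<circ> r) n) v < e / (4 * (L + 1))"
      using tendstoD[OF r(2)] e L_nonneg by simp
    ultimately have "\<forall>\<^sub>F n in sequentially. False"
    proof eventually_elim
      case (elim n)
      define m where "m = r n"
      have m: "norm (d m) < \<delta>" "norm (u m - v) < e / (4 * (L + 1))"
        using elim by (auto simp: m_def dist_norm)
      have "norm (u m - v) * (4 * (L + 1)) < e" using m(2) L_nonneg by (simp add: pos_less_divide_eq)
      moreover have "norm (u m - v) * (4 * (L + 1)) = 4 * norm (u m - v) + 4 * (L * norm (u m - v))"
        by (simp add: algebra_simps)
      ultimately have uv: "L * norm (u m - v) \<le> e / 4"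
        using norm_ge_zero[of "u m - v"] by linarith
      \<comment> \<open>Replacing \<open>v\<close> by \<open>u m\<close> costs at most another
        \<open>e / 4\<close>. The estimate is then used at the two lengths \<open>t m * s\<close>
        and \<open>s\<close>, and the two errors add up to the bound \<open>e * s\<close> that was
        supposed to fail.\<close>
      have est: "norm (G (xhat + s *\<^sub>R u m) - s *\<^sub>R D) \<le> e / 2 * s" if s: "0 \<le> s" "s < \<delta>" for s
      proof -
        have "norm (G (xhat + s *\<^sub>R u m) - G (xhat + s *\<^sub>R v)) \<le> L * norm (s *\<^sub>R (u m - v))"
          using G_lipschitz[of "xhat + s *\<^sub>R u m" "xhat + s *\<^sub>R v"] by (simp add: scaleR_diff_right)
        also have "\<dots> = s * (L * norm (u m - v))" using s by simp
        also have "\<dots> \<le> s * (e / 4)" using uv s by (intro mult_left_mono) auto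
        finally show ?thesis using near[OF s]
          norm_triangle_ineq[of "G (xhat + s *\<^sub>R u m) - G (xhat + s *\<^sub>R v)" "G (xhat + s *\<^sub>R v) - s *\<^sub>R D"]
          by (simp add: mult.commute)
      qed
      define s where "s = norm (d m)"
      have s: "s > 0" "s < \<delta>" using d0 m(1) by (auto simp: s_def)
      have dm: "d m = s *\<^sub>R u m" using du[of m] by (simp add: s_def)
      have ts: "0 \<le> t m * s" "t m * s \<le> s" using dt(2,3)[of m] s(1) by (auto simp: mult_left_le_one_le)
      have "norm (G (xhat + (t m * s) *\<^sub>R u m) - (t m * s) *\<^sub>R D) \<le> e / 2 * (t m * s)"
        by (rule est[OF ts(1) order.strict_trans1[OF ts(2) s(2)]])
      also have "\<dots> \<le> e / 2 * s" using ts e by (intro mult_left_mono) auto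
      finally have 1: "norm (G (xhat + (t m * s) *\<^sub>R u m) - (t m * s) *\<^sub>R D) \<le> e / 2 * s" .
      have "norm (t m *\<^sub>R (G (xhat + s *\<^sub>R u m) - s *\<^sub>R D)) = t m * norm (G (xhat + s *\<^sub>R u m) - s *\<^sub>R D)"
        using dt(2)[of m] by simp
      also have "\<dots> \<le> 1 * (e / 2 * s)" using dt(2,3)[of m] s est[of s] e by (intro mult_mono) auto
      finally have 2: "norm (t m *\<^sub>R (G (xhat + s *\<^sub>R u m) - s *\<^sub>R D)) \<le> e / 2 * s" by simp
      have "G (xhat + t m *\<^sub>R d m) - t m *\<^sub>R G (xhat + d m)
        = (G (xhat + (t m * s) *\<^sub>R u m) - (t m * s) *\<^sub>R D) - t m *\<^sub>R (G (xhat + s *\<^sub>R u m) - s *\<^sub>R D)"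
        by (simp add: dm scaleR_diff_right)
      then have "norm (G (xhat + t m *\<^sub>R d m) - t m *\<^sub>R G (xhat + d m)) \<le> e / 2 * s + e / 2 * s"
        using 1 2 norm_triangle_ineq4[of "G (xhat + (t m * s) *\<^sub>R u m) - (t m * s) *\<^sub>R D"
            "t m *\<^sub>R (G (xhat + s *\<^sub>R u m) - s *\<^sub>R D)"] by simp
      then show False using dt(4)[of m] by (simp add: s_def)
    qed
    then show False by simp
  qed
  then obtain n :: nat where "\<And>d t. norm d < inverse (Suc n) \<Longrightarrow> 0 \<le> t \<Longrightarrow> t \<le> 1 \<Longrightarrow>
    norm (G (xhat + t *\<^sub>R d) - t *\<^sub>R G (xhat + d)) \<le> e * norm d" by blast
  then show ?thesis using that[of "inverse (Suc n)"] by simp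
qed

lemma quadratic_growth_expansion:
  assumes e: "e > 0" and G0: "G xhat = 0"
  obtains \<delta> where "\<delta> > 0" "\<And>x. norm (x - xhat) < \<delta> \<Longrightarrow>
    G x \<bullet> (x - xhat) / 2 - e * (norm (x - xhat))\<^sup>2 \<le> \<Psi> x - \<Psi> xhat"
proof -
  obtain \<delta> where \<delta>: "\<delta> > 0" "\<And>d t. norm d < \<delta> \<Longrightarrow> 0 \<le> t \<Longrightarrow> t \<le> 1 \<Longrightarrow>
    norm (G (xhat + t *\<^sub>R d) - t *\<^sub>R G (xhat + d)) \<le> e * norm d"
    using G_radial_estimate[OF e G0] by blast
  show ?thesis
  proof (rule that[OF \<delta>(1)])
    fix x assume x: "norm (x - xhat) < \<delta>"
    define d where "d = x - xhat"
    \<comment> \<open>Monotonicity of \<open>p\<close> stands for integrating the radial estimate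
      over \<open>t\<close>; the value of \<open>t\<^sup>2 / 2\<close> at 1 is the factor 1/2, and
      the last term makes the derivative nonnegative.\<close>
    define p where "p t = \<Psi> (xhat + t *\<^sub>R d) - t\<^sup>2 / 2 * (G x \<bullet> d) + t * (e * (norm d)\<^sup>2)" for t
    have "p 0 \<le> p 1"
    proof (rule DERIV_nonneg_imp_nondecreasing[of 0 1 p])
      fix t :: real assume t: "0 \<le> t" "t \<le> 1"
      have "(p has_real_derivative (G (xhat + t *\<^sub>R d) \<bullet> d - t * (G x \<bullet> d) + e * (norm d)\<^sup>2)) (at t)"
        unfolding p_def by (auto intro!: derivative_eq_intros smooth_convex_DERIV_line[OF sc])
      moreover have "0 \<le> G (xhat + t *\<^sub>R d) \<bullet> d - t * (G x \<bullet> d) + e * (norm d)\<^sup>2"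
      proof -
        have "norm (G (xhat + t *\<^sub>R d) - t *\<^sub>R G (xhat + d)) \<le> e * norm d"
          using x t by (intro \<delta>(2)) (auto simp: d_def)
        then have "norm (G (xhat + t *\<^sub>R d) - t *\<^sub>R G x) * norm d \<le> e * norm d * norm d"
          by (intro mult_right_mono) (auto simp: d_def)
        moreover have "\<bar>(G (xhat + t *\<^sub>R d) - t *\<^sub>R G x) \<bullet> d\<bar> \<le> norm (G (xhat + t *\<^sub>R d) - t *\<^sub>R G x) * norm d"
          by (rule Cauchy_Schwarz_ineq2)
        ultimately show ?thesis by (simp add: inner_diff_left power2_eq_square)
      qed
      ultimately show "\<exists>y. (p has_real_derivative y) (at t) \<and> 0 \<le> y" by blast
    qed simp
    then show "G x \<bullet> (x - xhat) / 2 - e * (norm (x - xhat))\<^sup>2 \<le> \<Psi> x - \<Psi> xhat"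
      by (simp add: p_def d_def)
  qed
qed

lemma G_inner_ge:
  assumes e: "e > 0" and G0: "G xhat = 0"
  obtains \<delta> where "\<delta> > 0" "\<And>x H. norm (x - xhat) < \<delta> \<Longrightarrow> H \<in> hess x \<Longrightarrow>
    (c - e) * (norm (x - xhat))\<^sup>2 \<le> G x \<bullet> (x - xhat)"
proof -
  obtain \<delta>1 where \<delta>1: "\<delta>1 > 0" "\<And>x H. norm (x - xhat) < \<delta>1 \<Longrightarrow> H \<in> hess x \<Longrightarrow>
      norm (G x - H *v (x - xhat)) \<le> e * norm (x - xhat)"
    using hess_semismooth[OF e] by (auto simp: G0)
  show ?thesis
  proof (rule that[of "min \<delta>0 \<delta>1"])
    show "min \<delta>0 \<delta>1 > 0" using \<delta>0 \<delta>1(1) by simp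
    fix x H assume x: "norm (x - xhat) < min \<delta>0 \<delta>1" and H: "H \<in> hess x"
    have "\<bar>(G x - H *v (x - xhat)) \<bullet> (x - xhat)\<bar> \<le> norm (G x - H *v (x - xhat)) * norm (x - xhat)"
      by (rule Cauchy_Schwarz_ineq2)
    also have "\<dots> \<le> e * norm (x - xhat) * norm (x - xhat)" using \<delta>1(2) x H by (intro mult_right_mono) auto
    finally have "\<bar>(G x - H *v (x - xhat)) \<bullet> (x - xhat)\<bar> \<le> e * norm (x - xhat) * norm (x - xhat)" .
    moreover have "c * (norm (x - xhat))\<^sup>2 \<le> (H *v (x - xhat)) \<bullet> (x - xhat)"
      using x H by (intro hess_ge) auto
    ultimately show "(c - e) * (norm (x - xhat))\<^sup>2 \<le> G x \<bullet> (x - xhat)"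
      by (simp add: inner_diff_left[of "G x"] power2_eq_square left_diff_distrib)
  qed
qed

text \<open>Let \<open>g = G x \<bullet> (x - xhat)\<close>. The full step lands so close to
  \<open>xhat\<close> that \<Psi> drops by about \<open>g / 2\<close>, while
  \<open>G x \<bullet> d\<close> is about \<open>- g\<close>, so the test asks only for about
  \<open>\<zeta> * g\<close>.\<close>

lemma unit_step_accepted:
  assumes G0: "G xhat = 0"
  obtains \<delta> where "\<delta> > 0" "\<And>x H d. norm (x - xhat) < \<delta> \<Longrightarrow> H \<in> hess x \<Longrightarrow>
    newton_direction \<tau> \<tau>1 \<tau>2 H (G x) d \<Longrightarrow> armijo \<Psi> \<beta> \<zeta> x d 0"
proof -
  define k where "k = 1 / 2 - \<zeta>"
  have k: "k > 0" "k < 1 / 2" using \<zeta> by (auto simp: k_def)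
  \<comment> \<open>In units of \<open>\<epsilon> * n\<close> the errors are 1/2 for the new value,
    1 for the expansion and 1/2 for the slope, together 2. The margin \<open>k * g\<close> is at
    least \<open>k * (c - \<epsilon>) * n\<close>, that is \<open>4 - k\<close> such units.\<close>
  define \<epsilon> where "\<epsilon> = k * c / 4"
  have \<epsilon>: "\<epsilon> > 0" using k c by (simp add: \<epsilon>_def)
  define \<eta> where "\<eta> = min 1 (\<epsilon> / (L + 1))"
  have \<eta>: "\<eta> > 0" "\<eta> \<le> 1" using \<epsilon> L_nonneg by (auto simp: \<eta>_def)
  have "(L + 1) * \<eta> \<le> \<epsilon>" unfolding \<eta>_def
    using L_nonneg by (metis min.cobounded2 mult.commute pos_le_divide_eq add_nonneg_pos zero_less_one)
  then have L\<eta>: "L * \<eta> \<le> \<epsilon>" using \<eta> by (simp add: distrib_right)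
  obtain \<delta>1 where \<delta>1: "\<delta>1 > 0" "\<And>x H d. norm (x - xhat) < \<delta>1 \<Longrightarrow> H \<in> hess x \<Longrightarrow>
    newton_direction \<tau> \<tau>1 \<tau>2 H (G x) d \<Longrightarrow> norm (x + d - xhat) \<le> \<eta> * norm (x - xhat)"
    using newton_step_contraction[OF \<eta>(1) G0] by blast
  obtain \<delta>2 where \<delta>2: "\<delta>2 > 0" "\<And>x. norm (x - xhat) < \<delta>2 \<Longrightarrow>
    G x \<bullet> (x - xhat) / 2 - \<epsilon> * (norm (x - xhat))\<^sup>2 \<le> \<Psi> x - \<Psi> xhat"
    using quadratic_growth_expansion[OF \<epsilon> G0] by blast
  obtain \<delta>3 where \<delta>3: "\<delta>3 > 0" "\<And>x H. norm (x - xhat) < \<delta>3 \<Longrightarrow> H \<in> hess x \<Longrightarrow>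
    (c - \<epsilon>) * (norm (x - xhat))\<^sup>2 \<le> G x \<bullet> (x - xhat)"
    using G_inner_ge[OF \<epsilon> G0] by blast
  show ?thesis
  proof (rule that[of "Min {\<delta>1, \<delta>2, \<delta>3}"])
    show "Min {\<delta>1, \<delta>2, \<delta>3} > 0" using \<delta>1 \<delta>2 \<delta>3 by simp
    fix x H d assume x: "norm (x - xhat) < Min {\<delta>1, \<delta>2, \<delta>3}" and H: "H \<in> hess x"
      and nd: "newton_direction \<tau> \<tau>1 \<tau>2 H (G x) d"
    define n where "n = (norm (x - xhat))\<^sup>2"
    define u where "u = x + d - xhat"
    define g where "g = G x \<bullet> (x - xhat)"
    have n: "n \<ge> 0" by (simp add: n_def)
    have un: "norm u \<le> \<eta> * norm (x - xhat)" unfolding u_def using x by (intro \<delta>1(2)[OF _ H nd]) simp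
    have "(norm u)\<^sup>2 \<le> (\<eta> * norm (x - xhat))\<^sup>2" using un by (rule power_mono) simp
    also have "\<dots> = \<eta> * \<eta> * n" by (simp add: n_def power2_eq_square)
    also have "\<dots> \<le> 1 * \<eta> * n" using \<eta> n by (intro mult_right_mono) auto
    finally have "L / 2 * (norm u)\<^sup>2 \<le> L / 2 * (\<eta> * n)" using L_nonneg by (intro mult_left_mono) auto
    moreover have "\<Psi> (x + d) \<le> \<Psi> xhat + L / 2 * (norm u)\<^sup>2"
      using smooth_convexD(3)[OF sc, of "x + d" xhat] by (simp add: G0 u_def)
    moreover have "L * \<eta> * n \<le> \<epsilon> * n" using L\<eta> n by (rule mult_right_mono)
    ultimately have a: "\<Psi> (x + d) \<le> \<Psi> xhat + \<epsilon> * n / 2" by simp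
    have b: "g / 2 - \<epsilon> * n \<le> \<Psi> x - \<Psi> xhat" unfolding g_def n_def using x by (intro \<delta>2(2)) simp
    have g: "(c - \<epsilon>) * n \<le> g" unfolding g_def n_def using x H by (intro \<delta>3(2)) auto
    have "\<bar>G x \<bullet> u\<bar> \<le> norm (G x) * norm u" by (rule Cauchy_Schwarz_ineq2)
    also have "\<dots> \<le> (L * norm (x - xhat)) * (\<eta> * norm (x - xhat))"
      using G_lipschitz[of x xhat] un L_nonneg by (intro mult_mono) (auto simp: G0)
    also have "\<dots> = L * \<eta> * n" by (simp add: n_def power2_eq_square)
    finally have "\<bar>G x \<bullet> u\<bar> \<le> \<epsilon> * n" using \<open>L * \<eta> * n \<le> \<epsilon> * n\<close> by simp
    moreover have "G x \<bullet> d = G x \<bullet> u - g" by (simp add: u_def g_def inner_diff_right inner_add_right)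
    ultimately have "- g - \<epsilon> * n \<le> G x \<bullet> d" by simp
    then have "\<zeta> * (- g - \<epsilon> * n) \<le> \<zeta> * (G x \<bullet> d)" using \<zeta> by (intro mult_left_mono) auto
    moreover have "\<zeta> * (\<epsilon> * n) \<le> 1 / 2 * (\<epsilon> * n)" using \<zeta> \<epsilon> n by (intro mult_right_mono) auto
    ultimately have d: "- (\<zeta> * g) - \<epsilon> * n / 2 \<le> \<zeta> * (G x \<bullet> d)" by (simp add: right_diff_distrib)
    have "k * g = g / 2 - \<zeta> * g" by (simp add: k_def left_diff_distrib)
    moreover have "k * ((c - \<epsilon>) * n) \<le> k * g" using g k by (intro mult_left_mono) auto
    moreover have "k * ((c - \<epsilon>) * n) = 4 * (\<epsilon> * n) - k * (\<epsilon> * n)" by (simp add: \<epsilon>_def algebra_simps)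
    moreover have "k * (\<epsilon> * n) \<le> 1 / 2 * (\<epsilon> * n)" using k \<epsilon> n by (intro mult_right_mono) auto
    moreover have "0 \<le> \<epsilon> * n" using \<epsilon> n by simp
    ultimately have "2 * (\<epsilon> * n) \<le> g / 2 - \<zeta> * g" by linarith
    then show "armijo \<Psi> \<beta> \<zeta> x d 0" using a b d \<open>0 \<le> \<epsilon> * n\<close> by (simp add: armijo_iff)
  qed
qed

lemma minimum_if_stationary: "G xhat = 0 \<Longrightarrow> \<Psi> xhat \<le> \<Psi> x"
  using smooth_convexD(2)[OF sc, of xhat x] by simp

text \<open>Strong monotonicity is known only near \<open>xhat\<close>. On the segment to another
  minimizer \<open>y\<close>, a point \<open>z\<close> close to \<open>xhat\<close> has a gradient
  with positive component towards \<open>y\<close>, and convexity makes \<Psi> strictly larger at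
  \<open>y\<close> than at \<open>z\<close>. A Hessian has to exist at \<open>z\<close> for the
  local bound to apply.\<close>

lemma unique_minimizer_if_stationary:
  assumes G0: "G xhat = 0" and ne: "\<And>x. hess x \<noteq> {}"
  shows "unique_minimizer \<Psi> (\<lambda>_. True) xhat"
  unfolding unique_minimizer_def
proof (intro conjI allI impI)
  show "is_arg_min \<Psi> (\<lambda>_. True) xhat"
    using minimum_if_stationary[OF G0] by (auto simp: is_arg_min_def not_less)
  fix y assume "is_arg_min \<Psi> (\<lambda>_. True) y"
  then have y: "\<Psi> y \<le> \<Psi> xhat" by (auto simp: is_arg_min_def not_less)
  obtain \<delta> where \<delta>: "\<delta> > 0" "\<And>x H. norm (x - xhat) < \<delta> \<Longrightarrow> H \<in> hess x \<Longrightarrow>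
    (c - c / 2) * (norm (x - xhat))\<^sup>2 \<le> G x \<bullet> (x - xhat)"
    using G_inner_ge[of "c / 2"] c G0 by auto
  show "y = xhat"
  proof (rule ccontr)
    assume ne_y: "y \<noteq> xhat"
    define t where "t = min (1 / 2) (\<delta> / (2 * norm (y - xhat)))"
    define z where "z = xhat + t *\<^sub>R (y - xhat)"
    have ny: "norm (y - xhat) > 0" using ne_y by simp
    have t: "0 < t" "t < 1" using \<delta>(1) ny by (auto simp: t_def)
    have "t \<le> \<delta> / (2 * norm (y - xhat))" by (simp add: t_def)
    then have "t * norm (y - xhat) \<le> \<delta> / 2" using ny by (simp add: field_simps)
    then have "norm (z - xhat) < \<delta>" using t \<delta>(1) by (simp add: z_def)
    then have "(c - c / 2) * (norm (z - xhat))\<^sup>2 \<le> G z \<bullet> (z - xhat)" using \<delta>(2) ne by blast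
    moreover have zx: "z - xhat = t *\<^sub>R (y - xhat)" by (simp add: z_def)
    moreover have "0 < (c - c / 2) * (norm (z - xhat))\<^sup>2" using c t ne_y by (simp add: zx)
    ultimately have "0 < t * (G z \<bullet> (y - xhat))" by simp
    then have "0 < (1 - t) * (G z \<bullet> (y - xhat))" using t by (simp add: zero_less_mult_iff)
    moreover have "y - z = (1 - t) *\<^sub>R (y - xhat)" by (simp add: z_def algebra_simps)
    ultimately have "\<Psi> z < \<Psi> y" using smooth_convexD(2)[OF sc, of z y] by simp
    then show False using y minimum_if_stationary[OF G0, of z] by simp
  qed
qed

section \<open>Convergence of the generated iterates\<close>

context
  fixes x d :: "nat \<Rightarrow> real^'n" and H :: "nat \<Rightarrow> real^'n^'n" and q r :: "nat \<Rightarrow> nat"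
  assumes H: "\<And>j. H j \<in> hess (x j)"
    and nd: "\<And>j. newton_direction \<tau> \<tau>1 \<tau>2 (H j) (G (x j)) (d j)"
    and ar: "\<And>j. armijo \<Psi> \<beta> \<zeta> (x j) (d j) (q j)"
    and q: "\<And>j p. p < q j \<Longrightarrow> \<not> armijo \<Psi> \<beta> \<zeta> (x j) (d j) p"
    and x_Suc: "\<And>j. x (Suc j) = x j + \<beta> ^ q j *\<^sub>R d j"
    and r: "strict_mono r" and x_r: "(x \<circ> r) \<longlonglongrightarrow> xhat"
begin

lemma iterates_decrease:
  "\<Psi> (x (Suc j)) \<le> \<Psi> (x j) - \<zeta> * \<beta> ^ q j * ((norm (G (x j)))\<^sup>2 / (2 * (L + \<tau>1 * norm (G (x j)) + 1)))"
proof -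
  have "(norm (G (x j)))\<^sup>2 / (2 * (L + \<tau>1 * norm (G (x j)) + 1)) \<le> - (G (x j) \<bullet> d j)"
    using newton_direction_descent[OF H nd, of j] hess_nonneg[OF H, of j "d j"] by simp
  then have "\<zeta> * \<beta> ^ q j * ((norm (G (x j)))\<^sup>2 / (2 * (L + \<tau>1 * norm (G (x j)) + 1)))
      \<le> \<zeta> * \<beta> ^ q j * (- (G (x j) \<bullet> d j))"
    using \<zeta> \<beta> by (intro mult_left_mono) auto
  then show ?thesis using ar[of j] by (simp add: armijo_iff x_Suc)
qed

lemma limit_stationary: "G xhat = 0"
proof (rule ccontr)
  assume nz: "G xhat \<noteq> 0"
  define m where "m = norm (G xhat)"
  have m: "m > 0" using nz by (simp add: m_def)
  define s where "s = min 1 (\<beta> * (1 - \<zeta>) * c / (L + 1))"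
  have s: "s > 0" using \<beta> \<zeta> c L_nonneg by (auto simp: s_def)
  \<comment> \<open>This is the worst case of the decrease in \<open>iterates_decrease\<close> when
    the gradient norm lies between \<open>m / 2\<close> and \<open>2 * m\<close> and the step length
    is at least \<open>s\<close>.\<close>
  define \<kappa> where "\<kappa> = \<zeta> * s * ((m / 2)\<^sup>2 / (2 * (L + \<tau>1 * (2 * m) + 1)))"
  have \<kappa>: "\<kappa> > 0" unfolding \<kappa>_def using \<zeta> s m L_nonneg \<tau>1
    by (intro mult_pos_pos divide_pos_pos) (auto intro: add_nonneg_pos)
  have mono: "\<Psi> (x (Suc j)) \<le> \<Psi> (x j)" for j
  proof -
    have "0 \<le> \<zeta> * \<beta> ^ q j * ((norm (G (x j)))\<^sup>2 / (2 * (L + \<tau>1 * norm (G (x j)) + 1)))"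
      using \<zeta> \<beta> \<tau>1 L_nonneg by (intro mult_nonneg_nonneg divide_nonneg_nonneg) auto
    then show ?thesis using iterates_decrease[of j] by linarith
  qed
  then have antimono: "\<Psi> (x j) \<le> \<Psi> (x i)" if "i \<le> j" for i j
    using decseq_SucI[of "\<lambda>j. \<Psi> (x j)"] that by (auto simp: decseq_def)
  have "isCont \<Psi> xhat" using smooth_convex_gderiv[OF sc] unfolding gderiv_def by (rule has_derivative_continuous)
  then have lim: "(\<lambda>n. \<Psi> (x (r n))) \<longlonglongrightarrow> \<Psi> xhat" using isCont_tendsto_compose x_r by (force simp: o_def)
  have dl: "(\<lambda>n. norm (x (r n) - xhat)) \<longlonglongrightarrow> 0"
    using x_r by (auto simp: o_def intro: tendsto_norm_zero LIM_zero)
  have "(\<lambda>n. L * norm (x (r n) - xhat)) \<longlonglongrightarrow> 0"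
    using tendsto_mult[OF tendsto_const dl, of L] by simp
  then have "(\<lambda>n. G (x (r n)) - G xhat) \<longlonglongrightarrow> 0"
    by (rule Lim_null_comparison[rotated]) (simp add: G_lipschitz)
  then have "(\<lambda>n. G (x (r n))) \<longlonglongrightarrow> G xhat" by (rule LIM_zero_cancel)
  then have gl: "(\<lambda>n. norm (G (x (r n)))) \<longlonglongrightarrow> m" unfolding m_def by (rule tendsto_norm)
  have "\<forall>\<^sub>F n in sequentially. norm (x (r n) - xhat) < \<delta>0" using dl \<delta>0 by (rule order_tendstoD)
  moreover have "\<forall>\<^sub>F n in sequentially. m / 2 < norm (G (x (r n)))"
    using gl by (rule order_tendstoD) (use m in simp)
  moreover have "\<forall>\<^sub>F n in sequentially. norm (G (x (r n))) < 2 * m"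
    using gl by (rule order_tendstoD) (use m in simp)
  ultimately have "\<forall>\<^sub>F n in sequentially. \<Psi> (x (r (Suc n))) \<le> \<Psi> (x (r n)) - \<kappa>"
  proof eventually_elim
    case (elim n)
    have "s \<le> \<beta> ^ q (r n)" unfolding s_def by (rule armijo_step_ge[OF H nd elim(1)]) (rule q)
    moreover have "(m / 2)\<^sup>2 / (2 * (L + \<tau>1 * (2 * m) + 1))
       \<le> (norm (G (x (r n))))\<^sup>2 / (2 * (L + \<tau>1 * norm (G (x (r n))) + 1))"
      using elim m L_nonneg \<tau>1
      by (intro frac_le power_mono mult_left_mono add_mono) (auto intro: add_nonneg_pos)
    ultimately have "\<kappa> \<le> \<zeta> * \<beta> ^ q (r n) * ((norm (G (x (r n))))\<^sup>2 / (2 * (L + \<tau>1 * norm (G (x (r n))) + 1)))"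
      unfolding \<kappa>_def using \<zeta> s \<beta> L_nonneg \<tau>1 m
      by (intro mult_mono) auto
    then have "\<Psi> (x (Suc (r n))) \<le> \<Psi> (x (r n)) - \<kappa>" using iterates_decrease[of "r n"] by linarith
    \<comment> \<open>The iterates between two members of the subsequence cannot increase \<Psi>, so
      the drop by \<kappa> survives until the next member.\<close>
    moreover have "Suc (r n) \<le> r (Suc n)" using r by (simp add: Suc_leI strict_mono_less)
    ultimately show ?case using antimono by (meson order_trans)
  qed
  moreover have "(\<lambda>n. \<Psi> (x (r (Suc n)))) \<longlonglongrightarrow> \<Psi> xhat" using LIMSEQ_Suc[OF lim] .
  moreover have "(\<lambda>n. \<Psi> (x (r n)) - \<kappa>) \<longlonglongrightarrow> \<Psi> xhat - \<kappa>" by (intro tendsto_intros lim)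
  ultimately have "\<Psi> xhat \<le> \<Psi> xhat - \<kappa>" by (intro tendsto_le[OF sequentially_bot])
  then show False using \<kappa> by simp
qed

lemma contraction_near_limit:
  assumes \<eta>: "\<eta> > 0"
  obtains \<delta> where "\<delta> > 0" "\<And>j. norm (x j - xhat) < \<delta> \<Longrightarrow> norm (x (Suc j) - xhat) \<le> \<eta> * norm (x j - xhat)"
proof -
  obtain \<delta>1 where \<delta>1: "\<delta>1 > 0" "\<And>x H d. norm (x - xhat) < \<delta>1 \<Longrightarrow> H \<in> hess x \<Longrightarrow>
    newton_direction \<tau> \<tau>1 \<tau>2 H (G x) d \<Longrightarrow> norm (x + d - xhat) \<le> \<eta> * norm (x - xhat)"
    using newton_step_contraction[OF \<eta> limit_stationary] by blast
  obtain \<delta>2 where \<delta>2: "\<delta>2 > 0" "\<And>x H d. norm (x - xhat) < \<delta>2 \<Longrightarrow> H \<in> hess x \<Longrightarrow>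
    newton_direction \<tau> \<tau>1 \<tau>2 H (G x) d \<Longrightarrow> armijo \<Psi> \<beta> \<zeta> x d 0"
    using unit_step_accepted[OF limit_stationary] by blast
  show ?thesis
  proof (rule that[of "min \<delta>1 \<delta>2"])
    fix j assume j: "norm (x j - xhat) < min \<delta>1 \<delta>2"
    have "armijo \<Psi> \<beta> \<zeta> (x j) (d j) 0" using j by (intro \<delta>2(2)[OF _ H nd]) simp
    then have "q j = 0" using q[of 0 j] by (cases "q j") auto
    then show "norm (x (Suc j) - xhat) \<le> \<eta> * norm (x j - xhat)"
      using \<delta>1(2)[OF _ H nd, of j] j by (simp add: x_Suc)
  qed (use \<delta>1 \<delta>2 in simp)
qed

text \<open>One member of the subsequence inside the contraction ball traps all later iterates,
  since halving the distance keeps them in the ball; accumulation thereby becomes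
  convergence.\<close>

lemma iterates_tendsto: "x \<longlonglongrightarrow> xhat"
proof -
  obtain \<delta> where \<delta>: "\<delta> > 0" "\<And>j. norm (x j - xhat) < \<delta> \<Longrightarrow> norm (x (Suc j) - xhat) \<le> 1 / 2 * norm (x j - xhat)"
    using contraction_near_limit[of "1 / 2"] by auto
  obtain n where n: "norm (x (r n) - xhat) < \<delta>"
    using tendstoD[OF x_r \<delta>(1)] unfolding eventually_sequentially by (auto simp: dist_norm)
  have bound: "norm (x (j + r n) - xhat) \<le> (1 / 2) ^ j * norm (x (r n) - xhat)" for j
  proof (induction j)
    case (Suc j)
    have "(1 / 2) ^ j * norm (x (r n) - xhat) \<le> 1 * norm (x (r n) - xhat)"
      by (intro mult_right_mono power_le_one) auto
    then have "norm (x (j + r n) - xhat) < \<delta>" using Suc n by linarith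
    from \<delta>(2)[OF this] Suc show ?case by simp
  qed simp
  have "(\<lambda>j. (1 / 2) ^ j * norm (x (r n) - xhat)) \<longlonglongrightarrow> 0"
    by (intro tendsto_mult_left_zero LIMSEQ_power_zero) simp
  then have "(\<lambda>j. x (j + r n) - xhat) \<longlonglongrightarrow> 0"
    by (rule Lim_null_comparison[rotated]) (intro always_eventually allI bound)
  then have "(\<lambda>j. x (j + r n)) \<longlonglongrightarrow> xhat" by (rule LIM_zero_cancel)
  then show ?thesis by (rule LIMSEQ_offset)
qed

lemma iterates_superlinear: "(\<lambda>j. norm (x (Suc j) - xhat)) \<in> o(\<lambda>j. norm (x j - xhat))"
proof (rule landau_o.smallI)
  fix \<eta> :: real assume "\<eta> > 0"
  then obtain \<delta> where \<delta>: "\<delta> > 0" "\<And>j. norm (x j - xhat) < \<delta> \<Longrightarrow> norm (x (Suc j) - xhat) \<le> \<eta> * norm (x j - xhat)"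
    using contraction_near_limit by blast
  show "\<forall>\<^sub>F j in sequentially. norm (norm (x (Suc j) - xhat)) \<le> \<eta> * norm (norm (x j - xhat))"
    using tendstoD[OF iterates_tendsto \<delta>(1)] by eventually_elim (simp add: \<delta>(2) dist_norm)
qed

end

end

section \<open>The subproblem and its dual\<close>

text \<open>Each property describes a closed convex set of matrices, so it is inherited from points
  of differentiability; symmetry is phrased through bilinear forms to fit this pattern.\<close>

lemma smooth_convex_clarke_jacobian:
  assumes sc: "smooth_convex L \<phi> G" and J: "J \<in> clarke_jacobian G x"
  shows "transpose J = J" "0 \<le> (J *v d) \<bullet> d" "norm (J *v d) \<le> L * norm d"
proof -
  note bl = bounded_linear_matrix_vector_mult_left
  interpret lipschitz_map G L by unfold_locales (rule smooth_convexD(4)[OF sc])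
  have "clarke_jacobian G x \<subseteq> {J. \<forall>a b. (J *v a) \<bullet> b = (J *v b) \<bullet> a}"
  proof (rule clarke_jacobian_subset)
    show "closed {J :: real^'a^'a. \<forall>a b. (J *v a) \<bullet> b = (J *v b) \<bullet> a}"
      by (intro closed_Collect_all closed_Collect_eq continuous_intros bounded_linear.continuous_on[OF bl])
    show "convex {J :: real^'a^'a. \<forall>a b. (J *v a) \<bullet> b = (J *v b) \<bullet> a}"
      by (rule convexI) (auto simp: matrix_vector_mult_add_rdistrib scaleR_matrix_vector_assoc[symmetric] inner_add_left)
    fix y assume "G differentiable (at y)"
    then show "jacobian G (at y) \<in> {J. \<forall>a b. (J *v a) \<bullet> b = (J *v b) \<bullet> a}"
      using symmetric_matrix_inner[OF smooth_convex_jacobian_symmetric[OF sc]] by (simp add: inner_commute)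
  qed
  with J have "(J *v a) \<bullet> b = (J *v b) \<bullet> a" for a b by blast
  then show "transpose J = J" by (rule transpose_eq_if_self_adjoint)
  have "clarke_jacobian G x \<subseteq> {J. \<forall>d. 0 \<le> (J *v d) \<bullet> d}"
  proof (rule clarke_jacobian_subset)
    show "closed {J :: real^'a^'a. \<forall>d. 0 \<le> (J *v d) \<bullet> d}"
      by (intro closed_Collect_all closed_Collect_le continuous_intros bounded_linear.continuous_on[OF bl])
    show "convex {J :: real^'a^'a. \<forall>d. 0 \<le> (J *v d) \<bullet> d}"
      by (rule convexI) (auto simp: matrix_vector_mult_add_rdistrib scaleR_matrix_vector_assoc[symmetric] inner_add_left)
    fix y assume "G differentiable (at y)"
    then show "jacobian G (at y) \<in> {J. \<forall>d. 0 \<le> (J *v d) \<bullet> d}"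
      using jacobian_monotone[OF smooth_convex_monotone[OF sc]] by blast
  qed
  with J show "0 \<le> (J *v d) \<bullet> d" by blast
  show "norm (J *v d) \<le> L * norm d" by (rule clarke_norm_mult_le[OF J])
qed

text \<open>A semidefinite form vanishing at \<open>d\<close> is minimal there, so its gradient,
  twice \<open>H *v d\<close>, must vanish. The proof tests this by moving from \<open>d\<close> in
  direction \<open>- (H *v d)\<close>.\<close>

lemma positive_definite_if_invertible:
  fixes H :: "real^'n^'n"
  assumes sym: "transpose H = H" and psd: "\<And>d. 0 \<le> (H *v d) \<bullet> d" and inv: "invertible H" and d: "d \<noteq> 0"
  shows "0 < (H *v d) \<bullet> d"
proof (rule ccontr)
  assume "\<not> 0 < (H *v d) \<bullet> d"
  with psd[of d] have 0: "(H *v d) \<bullet> d = 0" by simp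
  define w where "w = H *v d"
  have "2 * (w \<bullet> w) \<le> 0"
  proof (rule nonpos_if_le_small_multiples[of _ "(H *v w) \<bullet> w"])
    fix s :: real assume s: "0 < s" "s \<le> 1"
    have Hw: "(H *v w) \<bullet> d = w \<bullet> w" using symmetric_matrix_inner[OF sym, of w d] by (simp add: w_def)
    have "0 \<le> (H *v (d - s *\<^sub>R w)) \<bullet> (d - s *\<^sub>R w)" by (rule psd)
    also have "\<dots> = s * (s * ((H *v w) \<bullet> w) - 2 * (w \<bullet> w))"
      using 0 by (simp add: matrix_vector_mult_diff_distrib matrix_vector_mult_scaleR inner_diff_left
          inner_diff_right Hw w_def[symmetric] algebra_simps)
    finally show "2 * (w \<bullet> w) \<le> s * ((H *v w) \<bullet> w)" using s by (simp add: zero_le_mult_iff)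
  qed
  then have "w \<bullet> w = 0" using inner_ge_zero[of w] by linarith
  then have "H *v d = 0" by (simp add: w_def)
  moreover obtain B where "B ** H = mat 1" using inv by (auto simp: invertible_def)
  ultimately have "d = 0" by (metis matrix_vector_mul_assoc matrix_vector_mul_lid matrix_vector_mult_0_right)
  with d show False by simp
qed

lemma directionally_differentiable_add:
  assumes "directionally_differentiable_at F x" "directionally_differentiable_at G x"
  shows "directionally_differentiable_at (\<lambda>x. F x + G x) x"
  unfolding directionally_differentiable_at_def
proof
  fix d
  obtain D E where D: "((\<lambda>t. (F (x + t *\<^sub>R d) - F x) /\<^sub>R t) \<longlongrightarrow> D) (at_right 0)"
    and E: "((\<lambda>t. (G (x + t *\<^sub>R d) - G x) /\<^sub>R t) \<longlongrightarrow> E) (at_right 0)"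
    using assms unfolding directionally_differentiable_at_def by blast
  have "(\<lambda>t. (F (x + t *\<^sub>R d) + G (x + t *\<^sub>R d) - (F x + G x)) /\<^sub>R t)
     = (\<lambda>t. (F (x + t *\<^sub>R d) - F x) /\<^sub>R t + (G (x + t *\<^sub>R d) - G x) /\<^sub>R t)"
    by (rule ext) (simp add: scaleR_add_right scaleR_diff_right)
  with tendsto_add[OF D E]
  show "\<exists>D. ((\<lambda>t. (F (x + t *\<^sub>R d) + G (x + t *\<^sub>R d) - (F x + G x)) /\<^sub>R t) \<longlongrightarrow> D) (at_right 0)"
    by auto
qed

lemma directionally_differentiable_compose_matrix:
  fixes F :: "real^'m \<Rightarrow> real^'m" and A :: "real^'n^'m"
  assumes "directionally_differentiable_at F (A *v x)"
  shows "directionally_differentiable_at (\<lambda>x. transpose A *v F (A *v x)) x"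
  unfolding directionally_differentiable_at_def
proof
  fix d
  obtain D where D: "((\<lambda>t. (F (A *v x + t *\<^sub>R (A *v d)) - F (A *v x)) /\<^sub>R t) \<longlongrightarrow> D) (at_right 0)"
    using assms unfolding directionally_differentiable_at_def by blast
  have "(\<lambda>t. (transpose A *v F (A *v (x + t *\<^sub>R d)) - transpose A *v F (A *v x)) /\<^sub>R t)
     = (\<lambda>t. transpose A *v ((F (A *v x + t *\<^sub>R (A *v d)) - F (A *v x)) /\<^sub>R t))"
    by (rule ext) (simp only: matrix_vector_right_distrib matrix_vector_mult_scaleR matrix_vector_mult_diff_distrib)
  moreover have "((\<lambda>t. transpose A *v ((F (A *v x + t *\<^sub>R (A *v d)) - F (A *v x)) /\<^sub>R t)) \<longlongrightarrow> transpose A *v D) (at_right 0)"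
    by (rule bounded_linear.tendsto[OF matrix_vector_mul_bounded_linear D])
  ultimately show "\<exists>D. ((\<lambda>t. (transpose A *v F (A *v (x + t *\<^sub>R d)) - transpose A *v F (A *v x)) /\<^sub>R t) \<longlongrightarrow> D) (at_right 0)"
    by auto
qed

lemma bounded_bilinear_matrix_vector_mult: "bounded_bilinear (\<lambda>(J :: real^'n^'m) d. J *v d)"
proof
  show "\<exists>K. \<forall>(a :: real^'n^'m) b. norm (a *v b) \<le> norm a * norm b * K"
    by (rule exI[of _ 1]) (simp add: norm_matrix_vector_mult_le)
qed (simp_all add: matrix_vector_mult_add_rdistrib matrix_vector_right_distrib matrix_vector_mult_scaleR
    scaleR_matrix_vector_assoc[symmetric])

lemma prox_conj_optimal:
  fixes \<psi> :: "'a::euclidean_space \<Rightarrow> ereal"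
  assumes "proper_closed_convex \<psi>" "\<gamma> > 0"
  obtains c where "prox_objective \<gamma> (fenchel_conj \<psi>) v (prox \<gamma> (fenchel_conj \<psi>) v) = ereal c"
    "\<And>q. ereal (c + 1 / (2 * \<gamma>) * (norm (q - prox \<gamma> (fenchel_conj \<psi>) v))\<^sup>2) \<le> prox_objective \<gamma> (fenchel_conj \<psi>) v q"
proof -
  have v: "\<gamma> *\<^sub>R (v /\<^sub>R \<gamma>) = v" using assms(2) by simp
  obtain P c where *: "prox \<gamma> (fenchel_conj \<psi>) v = \<gamma> *\<^sub>R (v /\<^sub>R \<gamma> - P)"
    "fenchel_conj \<psi> (\<gamma> *\<^sub>R (v /\<^sub>R \<gamma> - P)) = ereal c"
    "\<And>q. prox_objective \<gamma> (fenchel_conj \<psi>) v (\<gamma> *\<^sub>R (v /\<^sub>R \<gamma> - P))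
       + ereal (1 / (2 * \<gamma>) * (norm (q - \<gamma> *\<^sub>R (v /\<^sub>R \<gamma> - P)))\<^sup>2) \<le> prox_objective \<gamma> (fenchel_conj \<psi>) v q"
    by (rule moreau_decomposition[OF assms, of "v /\<^sub>R \<gamma>", unfolded v]) (rule that; assumption)
  define p where "p = prox \<gamma> (fenchel_conj \<psi>) v"
  have eq: "prox_objective \<gamma> (fenchel_conj \<psi>) v p = ereal (1 / (2 * \<gamma>) * (norm (p - v))\<^sup>2 + c)"
    using *(2) by (simp add: prox_objective_def p_def *(1))
  show ?thesis
    using that[of "1 / (2 * \<gamma>) * (norm (p - v))\<^sup>2 + c"] *(3)[folded *(1), folded p_def] eq
    unfolding p_def[symmetric] by simp
qed

section \<open>Coordinate restriction and the three terms of the primal objective\<close>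

lemma restrict_idx_nth: "restrict_idx T v $ i = (if i \<in> T then v $ i else 0)"
  by (simp add: restrict_idx_def)

lemma restrict_idx_linear:
  fixes u v :: "real^'p"
  shows "restrict_idx T (u + v) = restrict_idx T u + restrict_idx T v"
    "restrict_idx T (u - v) = restrict_idx T u - restrict_idx T v"
    "restrict_idx T (c *\<^sub>R u) = c *\<^sub>R restrict_idx T u"
  by (simp_all add: vec_eq_iff restrict_idx_nth)

lemma inner_restrict_idx:
  fixes u v :: "real^'p"
  shows "restrict_idx T u \<bullet> restrict_idx T v = restrict_idx T u \<bullet> v"
  by (auto simp: inner_vec_def restrict_idx_nth intro: sum.cong)

lemma norm_restrict_idx_le: "norm (restrict_idx T v) \<le> norm (v :: real^'p)"
  by (rule norm_le_componentwise_cart) (simp add: restrict_idx_nth)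

lemma restrict_idx_matrix_vector_mult: "restrict_idx T B *v x = restrict_idx T ((B :: real^'n^'p) *v x)"
  by (simp add: vec_eq_iff restrict_idx_nth matrix_vector_mul_component)

lemma transpose_restrict_idx_mult:
  "transpose (restrict_idx T B) *v v = transpose B *v restrict_idx T (v :: real^'p)"
  for B :: "real^'n^'p"
  by (auto simp: vec_eq_iff transpose_def matrix_vector_mult_def restrict_idx_nth intro: sum.cong)

lemma smooth_convex_f_k:
  assumes "proper_closed_convex f" "\<gamma> > 0"
  shows "smooth_convex \<gamma> (f_k f A B \<gamma> wk) (\<lambda>x. prox \<gamma> (fenchel_conj f) (\<gamma> *\<^sub>R x + (- QT_op A B wk)))"
proof -
  have "smooth_convex \<gamma>
     (\<lambda>x. real_of_ereal (moreau_env (1 / \<gamma>) f (x + - (QT_op A B wk /\<^sub>R \<gamma>))) + - (1 / (2 * \<gamma>) * (norm (QT_op A B wk))\<^sup>2))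
     (\<lambda>x. prox \<gamma> (fenchel_conj f) (\<gamma> *\<^sub>R (x + - (QT_op A B wk /\<^sub>R \<gamma>))))"
    by (rule smooth_convex_translate[OF smooth_convex_moreau_env[OF assms]])
  moreover have "\<gamma> *\<^sub>R (x + - (QT_op A B wk /\<^sub>R \<gamma>)) = \<gamma> *\<^sub>R x + (- QT_op A B wk)" for x
    using assms(2) by (simp add: scaleR_diff_right)
  ultimately show ?thesis by (simp add: f_k_def[abs_def])
qed

lemma smooth_convex_g_k:
  assumes "proper_closed_convex g" "\<gamma> > 0"
  shows "smooth_convex \<gamma> (g_k g \<gamma> wk) (\<lambda>u. prox \<gamma> (fenchel_conj g) (\<gamma> *\<^sub>R u + fst wk))"
proof -
  have "smooth_convex \<gamma>
     (\<lambda>u. real_of_ereal (moreau_env (1 / \<gamma>) g (u + fst wk /\<^sub>R \<gamma>)) + - (1 / (2 * \<gamma>) * (norm (fst wk))\<^sup>2))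
     (\<lambda>u. prox \<gamma> (fenchel_conj g) (\<gamma> *\<^sub>R (u + fst wk /\<^sub>R \<gamma>)))"
    by (rule smooth_convex_translate[OF smooth_convex_moreau_env[OF assms]])
  then show ?thesis using assms(2) by (simp add: g_k_def[abs_def] scaleR_add_right)
qed

lemma smooth_convex_h_k:
  assumes "\<gamma> > 0"
  shows "smooth_convex \<gamma> (h_k \<gamma> wk T) (\<lambda>v. restrict_idx T (\<gamma> *\<^sub>R v + snd wk))"
proof -
  define R where "R = restrict_idx T (snd wk /\<^sub>R \<gamma>)"
  have grad: "restrict_idx T (\<gamma> *\<^sub>R x + snd wk) = \<gamma> *\<^sub>R restrict_idx T (x + snd wk /\<^sub>R \<gamma>)" for x
    using assms by (simp add: restrict_idx_linear scaleR_add_right)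
  have sq: "h_k \<gamma> wk T y = h_k \<gamma> wk T x + restrict_idx T (\<gamma> *\<^sub>R x + snd wk) \<bullet> (y - x)
      + \<gamma> / 2 * (norm (restrict_idx T (y - x)))\<^sup>2" for x y
  proof -
    have "restrict_idx T (y + snd wk /\<^sub>R \<gamma>) = restrict_idx T (x + snd wk /\<^sub>R \<gamma>) + restrict_idx T (y - x)"
      by (simp add: restrict_idx_linear)
    moreover have "restrict_idx T (\<gamma> *\<^sub>R x + snd wk) \<bullet> (y - x)
        = \<gamma> * (restrict_idx T (x + snd wk /\<^sub>R \<gamma>) \<bullet> restrict_idx T (y - x))"
      by (simp add: grad inner_restrict_idx)
    moreover have "\<gamma> / 2 * (k + 2 * l + m) = \<gamma> / 2 * k + \<gamma> * l + \<gamma> / 2 * m" for k l m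
      by (simp add: field_simps)
    ultimately show ?thesis by (simp only: h_k_def norm_add_sq)
  qed
  show ?thesis unfolding smooth_convex_def
  proof (intro conjI allI)
    show "\<gamma> \<ge> 0" using assms by simp
    fix x y
    show "h_k \<gamma> wk T x + restrict_idx T (\<gamma> *\<^sub>R x + snd wk) \<bullet> (y - x) \<le> h_k \<gamma> wk T y"
      using assms by (simp add: sq[of y x])
    have "\<gamma> / 2 * (norm (restrict_idx T (y - x)))\<^sup>2 \<le> \<gamma> / 2 * (norm (y - x))\<^sup>2"
      using assms by (intro mult_left_mono power_mono norm_restrict_idx_le) auto
    then show "h_k \<gamma> wk T y \<le> h_k \<gamma> wk T x + restrict_idx T (\<gamma> *\<^sub>R x + snd wk) \<bullet> (y - x) + \<gamma> / 2 * (norm (y - x))\<^sup>2"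
      by (simp add: sq[of y x])
    have "restrict_idx T (\<gamma> *\<^sub>R y + snd wk) - restrict_idx T (\<gamma> *\<^sub>R x + snd wk) = restrict_idx T (\<gamma> *\<^sub>R (y - x))"
      by (simp add: restrict_idx_linear scaleR_diff_right)
    then show "norm (restrict_idx T (\<gamma> *\<^sub>R y + snd wk) - restrict_idx T (\<gamma> *\<^sub>R x + snd wk)) \<le> \<gamma> * norm (y - x)"
      using norm_restrict_idx_le[of T "\<gamma> *\<^sub>R (y - x)"] assms by simp
  qed
qed

lemma semismooth_imp_continuous: "semismooth F \<Longrightarrow> continuous_on UNIV F"
  unfolding continuous_on_eq_continuous_at[OF open_UNIV]
proof (intro ballI)
  fix x assume "semismooth F"
  then obtain e L where "e > 0" "L-lipschitz_on (ball x e) F"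
    unfolding semismooth_def locally_lipschitz_def by blast
  then show "isCont F x"
    using lipschitz_on_continuous_on continuous_on_eq_continuous_at[OF open_ball] by (metis centre_in_ball)
qed

locale subproblem =
  fixes f :: "real^'n \<Rightarrow> ereal" and g :: "real^'m \<Rightarrow> ereal"
    and A :: "real^'n^'m" and B :: "real^'n^'p" and \<gamma> :: real and wk :: "(real^'m) \<times> (real^'p)" and T :: "'p set"
  assumes f: "proper_closed_convex f" and g: "proper_closed_convex g" and \<gamma>: "\<gamma> > 0"
    and ssf: "semismooth (prox \<gamma> (fenchel_conj f))" and ssg: "semismooth (prox \<gamma> (fenchel_conj g))"
begin

text \<open>These are the gradients of the three summands. On the dual side,
  \<open>F2 (A *v x)\<close> and \<open>F3 (B *v x)\<close> are also the blocks of the recovered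
  point, and \<open>F1 x\<close> is the value that \<open>- QT_op A B w\<close> should take
  there.\<close>

definition F1 where "F1 x = prox \<gamma> (fenchel_conj f) (\<gamma> *\<^sub>R x + (- QT_op A B wk))"
definition F2 where "F2 u = prox \<gamma> (fenchel_conj g) (\<gamma> *\<^sub>R u + fst wk)"
definition F3 where "F3 v = restrict_idx T (\<gamma> *\<^sub>R v + snd wk)"
definition grad_Psi where "grad_Psi x = F1 x + transpose A *v F2 (A *v x) + transpose B *v F3 (B *v x)"
definition lip where "lip = \<gamma> + \<gamma> * (norm A)\<^sup>2 + \<gamma> * (norm B)\<^sup>2"

lemma smooth_F1: "smooth_convex \<gamma> (f_k f A B \<gamma> wk) F1"
  unfolding F1_def[abs_def] by (rule smooth_convex_f_k[OF f \<gamma>])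

lemma smooth_F2: "smooth_convex \<gamma> (g_k g \<gamma> wk) F2"
  unfolding F2_def[abs_def] by (rule smooth_convex_g_k[OF g \<gamma>])

lemma smooth_F3: "smooth_convex \<gamma> (h_k \<gamma> wk T) F3"
  unfolding F3_def[abs_def] by (rule smooth_convex_h_k[OF \<gamma>])

lemma smooth_Psi: "smooth_convex lip (Psi_k f g A B \<gamma> wk T) grad_Psi"
  unfolding Psi_k_def[abs_def] grad_Psi_def[abs_def] lip_def
  by (intro smooth_convex_add smooth_convex_compose_matrix smooth_F1 smooth_F2 smooth_F3)

sublocale F1: lipschitz_map F1 \<gamma> by unfold_locales (rule smooth_convexD(4)[OF smooth_F1])
sublocale F2: lipschitz_map F2 \<gamma> by unfold_locales (rule smooth_convexD(4)[OF smooth_F2])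

text \<open>The quadratic form of a generalized Hessian as a continuous function of its Clarke
  components and the direction, so that it can be minimized over a compact product.\<close>

definition hess_form where
  "hess_form V W d = (V *v d) \<bullet> d + (W *v (A *v d)) \<bullet> (A *v d) + \<gamma> * (norm (restrict_idx T (B *v d)))\<^sup>2"

lemma hess_matrix_mult:
  "(V + transpose A ** W ** A + \<gamma> *\<^sub>R (transpose (restrict_idx T B) ** restrict_idx T B)) *v d
    = V *v d + transpose A *v (W *v (A *v d)) + \<gamma> *\<^sub>R (transpose B *v restrict_idx T (B *v d))"
proof -
  have "restrict_idx T (restrict_idx T v) = restrict_idx T v" for v :: "real^'p"
    by (simp add: vec_eq_iff restrict_idx_nth)
  then show ?thesis
    by (simp only: matrix_vector_mult_add_rdistrib scaleR_matrix_vector_assoc[symmetric]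
        matrix_vector_mul_assoc[symmetric] transpose_restrict_idx_mult restrict_idx_matrix_vector_mult)
qed

lemma gen_hessianE:
  assumes "H \<in> gen_hessian f g A B \<gamma> wk T x"
  obtains V W where "V \<in> clarke_jacobian F1 x" "W \<in> clarke_jacobian F2 (A *v x)"
    "H = V + transpose A ** W ** A + \<gamma> *\<^sub>R (transpose (restrict_idx T B) ** restrict_idx T B)"
    "\<And>d. H *v d = V *v d + transpose A *v (W *v (A *v d)) + \<gamma> *\<^sub>R (transpose B *v restrict_idx T (B *v d))"
proof -
  obtain V W where VW: "V \<in> clarke_jacobian F1 x" "W \<in> clarke_jacobian F2 (A *v x)"
    and H: "H = V + transpose A ** W ** A + \<gamma> *\<^sub>R (transpose (restrict_idx T B) ** restrict_idx T B)"
    using assms unfolding gen_hessian_def smooth_convex_grad[OF smooth_F1] smooth_convex_grad[OF smooth_F2] by blast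
  show ?thesis using that[OF VW H] hess_matrix_mult[of V W] unfolding H by blast
qed

lemma inner_gen_hessian:
  assumes "H *v d = V *v d + transpose A *v (W *v (A *v d)) + \<gamma> *\<^sub>R (transpose B *v restrict_idx T (B *v d))"
  shows "(H *v d) \<bullet> e = (V *v d) \<bullet> e + (W *v (A *v d)) \<bullet> (A *v e) + \<gamma> * (restrict_idx T (B *v d) \<bullet> restrict_idx T (B *v e))"
  by (simp only: assms inner_add_left inner_scaleR_left inner_transpose inner_restrict_idx)

lemma gen_hessianI:
  "V \<in> clarke_jacobian F1 x \<Longrightarrow> W \<in> clarke_jacobian F2 (A *v x) \<Longrightarrow>
   V + transpose A ** W ** A + \<gamma> *\<^sub>R (transpose (restrict_idx T B) ** restrict_idx T B) \<in> gen_hessian f g A B \<gamma> wk T x"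
  unfolding gen_hessian_def smooth_convex_grad[OF smooth_F1] smooth_convex_grad[OF smooth_F2] by blast

lemma gen_hessian_symmetric:
  assumes "H \<in> gen_hessian f g A B \<gamma> wk T x"
  shows "transpose H = H"
  using assms
proof (rule gen_hessianE)
  fix V W assume V: "V \<in> clarke_jacobian F1 x" and W: "W \<in> clarke_jacobian F2 (A *v x)"
    and H: "\<And>d. H *v d = V *v d + transpose A *v (W *v (A *v d)) + \<gamma> *\<^sub>R (transpose B *v restrict_idx T (B *v d))"
  have sV: "(V *v a) \<bullet> b = (V *v b) \<bullet> a" for a b
    using symmetric_matrix_inner[OF smooth_convex_clarke_jacobian(1)[OF smooth_F1 V]] by (simp add: inner_commute)
  have sW: "(W *v a) \<bullet> b = (W *v b) \<bullet> a" for a b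
    using symmetric_matrix_inner[OF smooth_convex_clarke_jacobian(1)[OF smooth_F2 W]] by (simp add: inner_commute)
  show ?thesis
  proof (rule transpose_eq_if_self_adjoint)
    fix a b
    show "(H *v a) \<bullet> b = (H *v b) \<bullet> a"
      unfolding inner_gen_hessian[OF H] sV[of a b] sW[of "A *v a" "A *v b"]
        inner_commute[of "restrict_idx T (B *v a)" "restrict_idx T (B *v b)"] by (rule refl)
  qed
qed

lemma gen_hessian_nonneg:
  assumes "H \<in> gen_hessian f g A B \<gamma> wk T x"
  shows "0 \<le> (H *v d) \<bullet> d"
  using assms
proof (rule gen_hessianE)
  fix V W assume V: "V \<in> clarke_jacobian F1 x" and W: "W \<in> clarke_jacobian F2 (A *v x)"
    and H: "\<And>d. H *v d = V *v d + transpose A *v (W *v (A *v d)) + \<gamma> *\<^sub>R (transpose B *v restrict_idx T (B *v d))"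
  show ?thesis unfolding inner_gen_hessian[OF H]
    using smooth_convex_clarke_jacobian(2)[OF smooth_F1 V] smooth_convex_clarke_jacobian(2)[OF smooth_F2 W] \<gamma>
    by (intro add_nonneg_nonneg mult_nonneg_nonneg) auto
qed

lemma gen_hessian_norm_le:
  assumes "H \<in> gen_hessian f g A B \<gamma> wk T x"
  shows "norm (H *v d) \<le> lip * norm d"
  using assms
proof (rule gen_hessianE)
  fix V W assume V: "V \<in> clarke_jacobian F1 x" and W: "W \<in> clarke_jacobian F2 (A *v x)"
    and H: "\<And>d. H *v d = V *v d + transpose A *v (W *v (A *v d)) + \<gamma> *\<^sub>R (transpose B *v restrict_idx T (B *v d))"
  have 1: "norm (V *v d) \<le> \<gamma> * norm d" by (rule smooth_convex_clarke_jacobian(3)[OF smooth_F1 V])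
  have "norm (transpose A *v (W *v (A *v d))) \<le> norm A * norm (W *v (A *v d))"
    by (metis norm_matrix_vector_mult_le norm_transpose)
  also have "\<dots> \<le> norm A * (\<gamma> * norm (A *v d))"
    by (intro mult_left_mono smooth_convex_clarke_jacobian(3)[OF smooth_F2 W]) simp
  also have "\<dots> \<le> norm A * (\<gamma> * (norm A * norm d))"
    using \<gamma> by (intro mult_left_mono norm_matrix_vector_mult_le) auto
  finally have 2: "norm (transpose A *v (W *v (A *v d))) \<le> \<gamma> * (norm A)\<^sup>2 * norm d"
    by (simp add: power2_eq_square ac_simps)
  have "norm (transpose B *v restrict_idx T (B *v d)) \<le> norm B * norm (restrict_idx T (B *v d))"
    by (metis norm_matrix_vector_mult_le norm_transpose)
  also have "\<dots> \<le> norm B * (norm B * norm d)"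
    by (intro mult_left_mono order_trans[OF norm_restrict_idx_le norm_matrix_vector_mult_le]) simp
  finally have "\<gamma> * norm (transpose B *v restrict_idx T (B *v d)) \<le> \<gamma> * (norm B * (norm B * norm d))"
    using \<gamma> by (intro mult_left_mono) auto
  then have 3: "norm (\<gamma> *\<^sub>R (transpose B *v restrict_idx T (B *v d))) \<le> \<gamma> * (norm B)\<^sup>2 * norm d"
    using \<gamma> by (simp add: power2_eq_square ac_simps)
  have "norm (H *v d) \<le> \<gamma> * norm d + \<gamma> * (norm A)\<^sup>2 * norm d + \<gamma> * (norm B)\<^sup>2 * norm d"
    unfolding H by (rule norm_triangle_le[OF add_mono[OF norm_triangle_le[OF add_mono[OF 1 2]] 3]])
  then show ?thesis by (simp add: lip_def distrib_right)
qed

lemma clarke_F1_nonempty: "clarke_jacobian F1 x \<noteq> {}"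
proof (rule F1.clarke_nonempty)
  fix U :: "(real^'n) set" assume "open U" "U \<noteq> {}"
  moreover have "continuous_on UNIV F1" unfolding F1_def[abs_def]
    by (intro continuous_on_compose2[OF semismooth_imp_continuous[OF ssf]] continuous_intros) auto
  moreover have "directionally_differentiable_at F1 x" for x
    unfolding F1_def[abs_def] using ssf \<gamma> by (intro directionally_differentiable_affine) (auto simp: semismooth_def)
  ultimately show "\<exists>y\<in>U. F1 differentiable (at y)" by (intro directionally_differentiable_dense)
qed

lemma clarke_F2_nonempty: "clarke_jacobian F2 u \<noteq> {}"
proof (rule F2.clarke_nonempty)
  fix U :: "(real^'m) set" assume "open U" "U \<noteq> {}"
  moreover have "continuous_on UNIV F2" unfolding F2_def[abs_def]
    by (intro continuous_on_compose2[OF semismooth_imp_continuous[OF ssg]] continuous_intros) auto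
  moreover have "directionally_differentiable_at F2 x" for x
    unfolding F2_def[abs_def] using ssg \<gamma> by (intro directionally_differentiable_affine) (auto simp: semismooth_def)
  ultimately show "\<exists>y\<in>U. F2 differentiable (at y)" by (intro directionally_differentiable_dense)
qed

lemma gen_hessian_nonempty: "gen_hessian f g A B \<gamma> wk T x \<noteq> {}"
  using clarke_F1_nonempty clarke_F2_nonempty gen_hessianI by blast

lemma grad_Psi_directional: "directionally_differentiable_at grad_Psi x"
proof -
  have "directionally_differentiable_at F3 v" for v unfolding directionally_differentiable_at_def
  proof
    fix d
    have "\<forall>\<^sub>F t in at_right 0. (F3 (v + t *\<^sub>R d) - F3 v) /\<^sub>R t = restrict_idx T (\<gamma> *\<^sub>R d)"
      using eventually_at_right_less[of "0::real"]
      by eventually_elim (simp add: F3_def restrict_idx_linear scaleR_add_right)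
    then have "((\<lambda>t. (F3 (v + t *\<^sub>R d) - F3 v) /\<^sub>R t) \<longlongrightarrow> restrict_idx T (\<gamma> *\<^sub>R d)) (at_right 0)"
      by (rule tendsto_eventually)
    then show "\<exists>D. ((\<lambda>t. (F3 (v + t *\<^sub>R d) - F3 v) /\<^sub>R t) \<longlongrightarrow> D) (at_right 0)" ..
  qed
  moreover have "directionally_differentiable_at F1 x"
    unfolding F1_def[abs_def] using ssf \<gamma> by (intro directionally_differentiable_affine) (auto simp: semismooth_def)
  moreover have "directionally_differentiable_at F2 u" for u
    unfolding F2_def[abs_def] using ssg \<gamma> by (intro directionally_differentiable_affine) (auto simp: semismooth_def)
  ultimately show ?thesis unfolding grad_Psi_def[abs_def]
    by (intro directionally_differentiable_add directionally_differentiable_compose_matrix)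
qed

lemma gen_hessian_semismooth:
  assumes e: "e > 0"
  shows "\<exists>\<delta>>0. \<forall>x H. norm (x - xh) < \<delta> \<longrightarrow> H \<in> gen_hessian f g A B \<gamma> wk T x \<longrightarrow>
    norm (grad_Psi x - grad_Psi xh - H *v (x - xh)) \<le> e * norm (x - xh)"
proof -
  \<comment> \<open>The \<open>f\<close> part contributes \<open>e' * norm d\<close>, the
    \<open>g\<close> part picks up \<open>norm A\<close> once on each side, and the affine map
    \<open>F3\<close> has no remainder.\<close>
  define e' where "e' = e / (1 + (norm A)\<^sup>2)"
  have pos: "1 + (norm A)\<^sup>2 > 0" by (simp add: add_pos_nonneg)
  have e': "e' > 0" using e pos by (simp add: e'_def)
  obtain \<delta>1 where \<delta>1: "\<delta>1 > 0" "\<And>d H. norm d < \<delta>1 \<Longrightarrow> H \<in> clarke_jacobian F1 (xh + d) \<Longrightarrow>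
      norm (F1 (xh + d) - F1 xh - H *v d) \<le> e' * norm d"
    using semismooth_affine_estimate[OF ssf \<gamma> e', of "- QT_op A B wk" xh] unfolding F1_def[abs_def] by blast
  obtain \<delta>2 where \<delta>2: "\<delta>2 > 0" "\<And>d H. norm d < \<delta>2 \<Longrightarrow> H \<in> clarke_jacobian F2 (A *v xh + d) \<Longrightarrow>
      norm (F2 (A *v xh + d) - F2 (A *v xh) - H *v d) \<le> e' * norm d"
    using semismooth_affine_estimate[OF ssg \<gamma> e', of "fst wk" "A *v xh"] unfolding F2_def[abs_def] by blast
  have nA: "norm A + 1 > 0" by (simp add: add_nonneg_pos)
  show ?thesis
  proof (intro exI[of _ "min \<delta>1 (\<delta>2 / (norm A + 1))"] conjI allI impI)
    show "min \<delta>1 (\<delta>2 / (norm A + 1)) > 0" using \<delta>1 \<delta>2 nA by simp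
    fix x H assume x: "norm (x - xh) < min \<delta>1 (\<delta>2 / (norm A + 1))" and H: "H \<in> gen_hessian f g A B \<gamma> wk T x"
    define d where "d = x - xh"
    have xd: "x = xh + d" by (simp add: d_def)
    have Axd: "A *v x = A *v xh + A *v d" by (simp add: xd matrix_vector_right_distrib)
    obtain V W where V: "V \<in> clarke_jacobian F1 x" and W: "W \<in> clarke_jacobian F2 (A *v x)"
      and Hd: "\<And>d. H *v d = V *v d + transpose A *v (W *v (A *v d)) + \<gamma> *\<^sub>R (transpose B *v restrict_idx T (B *v d))"
      using H by (rule gen_hessianE) blast
    have 1: "norm (F1 x - F1 xh - V *v d) \<le> e' * norm d"
      using x V unfolding xd by (intro \<delta>1(2)) auto
    have nAd: "norm (A *v d) \<le> norm A * norm d" by (rule norm_matrix_vector_mult_le)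
    have "norm d * (norm A + 1) < \<delta>2" using x nA by (simp add: d_def pos_less_divide_eq)
    moreover have "norm d * (norm A + 1) = norm A * norm d + norm d" by (simp add: algebra_simps)
    ultimately have "norm (A *v d) < \<delta>2" using nAd norm_ge_zero[of d] by linarith
    then have "norm (F2 (A *v x) - F2 (A *v xh) - W *v (A *v d)) \<le> e' * norm (A *v d)"
      using W unfolding Axd by (intro \<delta>2(2)) auto
    also have "\<dots> \<le> e' * (norm A * norm d)" using nAd e' by (intro mult_left_mono) auto
    finally have "norm A * norm (F2 (A *v x) - F2 (A *v xh) - W *v (A *v d)) \<le> norm A * (e' * (norm A * norm d))"
      by (intro mult_left_mono) auto
    then have 2: "norm (transpose A *v (F2 (A *v x) - F2 (A *v xh) - W *v (A *v d))) \<le> e' * (norm A)\<^sup>2 * norm d"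
      using norm_matrix_vector_mult_le[of "transpose A" "F2 (A *v x) - F2 (A *v xh) - W *v (A *v d)"]
      by (simp add: norm_transpose power2_eq_square ac_simps del: transpose_matrix_vector)
    have "F3 (B *v x) - F3 (B *v xh) = \<gamma> *\<^sub>R restrict_idx T (B *v d)"
      by (simp add: F3_def xd matrix_vector_right_distrib restrict_idx_linear scaleR_add_right)
    then have "transpose B *v F3 (B *v x) - transpose B *v F3 (B *v xh) = \<gamma> *\<^sub>R (transpose B *v restrict_idx T (B *v d))"
      by (metis matrix_vector_mult_diff_distrib matrix_vector_mult_scaleR)
    then have "grad_Psi x - grad_Psi xh - H *v d
       = (F1 x - F1 xh - V *v d) + transpose A *v (F2 (A *v x) - F2 (A *v xh) - W *v (A *v d))"
      by (simp add: grad_Psi_def Hd matrix_vector_mult_diff_distrib algebra_simps del: transpose_matrix_vector)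
    then have "norm (grad_Psi x - grad_Psi xh - H *v d) \<le> e' * norm d + e' * (norm A)\<^sup>2 * norm d"
      using norm_triangle_le[OF add_mono[OF 1 2]] by simp
    also have "\<dots> = e' * (1 + (norm A)\<^sup>2) * norm d" by (simp add: algebra_simps)
    also have "\<dots> = e * norm d" using pos by (simp add: e'_def)
    finally show "norm (grad_Psi x - grad_Psi xh - H *v (x - xh)) \<le> e * norm (x - xh)" by (simp add: d_def)
  qed
qed

text \<open>Invertibility makes the minimum of the form over unit vectors and Clarke components at
  \<open>xh\<close> positive; upper semicontinuity then compares the components at nearby points
  with those at \<open>xh\<close>.\<close>

lemma gen_hessian_uniformly_positive:
  assumes inv: "\<forall>H\<in>gen_hessian f g A B \<gamma> wk T xh. invertible H"
  obtains c \<delta> where "c > 0" "\<delta> > 0" "\<And>x H d. norm (x - xh) < \<delta> \<Longrightarrow> H \<in> gen_hessian f g A B \<gamma> wk T x \<Longrightarrow>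
    c * (norm d)\<^sup>2 \<le> (H *v d) \<bullet> d"
proof -
  note bb = bounded_bilinear.continuous_on[OF bounded_bilinear_matrix_vector_mult]
  note ml = bounded_linear.continuous_on[OF matrix_vector_mul_bounded_linear]
  have hf: "(H *v d) \<bullet> d = hess_form V W d"
    if "\<And>d. H *v d = V *v d + transpose A *v (W *v (A *v d)) + \<gamma> *\<^sub>R (transpose B *v restrict_idx T (B *v d))" for H V W d
    by (simp add: inner_gen_hessian[OF that] hess_form_def power2_norm_eq_inner)
  define S where "S = clarke_jacobian F1 xh \<times> clarke_jacobian F2 (A *v xh) \<times> sphere (0 :: real^'n) 1"
  have "compact S" unfolding S_def by (intro compact_Times F1.compact_clarke F2.compact_clarke compact_sphere)
  moreover have "S \<noteq> {}"
  proof -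
    have "axis undefined 1 \<in> sphere (0 :: real^'n) 1" by simp
    then show ?thesis unfolding S_def using clarke_F1_nonempty clarke_F2_nonempty by blast
  qed
  moreover have "continuous_on S (\<lambda>s. hess_form (fst s) (fst (snd s)) (snd (snd s)))"
  proof -
    have "(\<lambda>d. restrict_idx T (B *v d)) = (\<lambda>d. restrict_idx T B *v d)"
      by (simp add: restrict_idx_matrix_vector_mult)
    then show ?thesis unfolding hess_form_def restrict_idx_matrix_vector_mult[symmetric]
      by (intro continuous_intros bb ml)
  qed
  ultimately obtain s where s: "s \<in> S" "\<And>t. t \<in> S \<Longrightarrow>
      hess_form (fst s) (fst (snd s)) (snd (snd s)) \<le> hess_form (fst t) (fst (snd t)) (snd (snd t))"
    using continuous_attains_inf[of S "\<lambda>s. hess_form (fst s) (fst (snd s)) (snd (snd s))"] by blast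
  define m where "m = hess_form (fst s) (fst (snd s)) (snd (snd s))"
  have m: "m > 0"
  proof -
    obtain V W u where s3: "s = (V, W, u)" by (cases s)
    have V: "V \<in> clarke_jacobian F1 xh" and W: "W \<in> clarke_jacobian F2 (A *v xh)" and u: "u \<noteq> 0"
      using s(1) by (auto simp: S_def s3)
    define H where "H = V + transpose A ** W ** A + \<gamma> *\<^sub>R (transpose (restrict_idx T B) ** restrict_idx T B)"
    have H: "H \<in> gen_hessian f g A B \<gamma> wk T xh" unfolding H_def by (rule gen_hessianI[OF V W])
    note Hd = hess_matrix_mult[of V W, folded H_def]
    have "(H *v u) \<bullet> u = m" by (simp only: m_def s3 fst_conv snd_conv) (rule hf[OF Hd])
    then show ?thesis
      using positive_definite_if_invertible[OF gen_hessian_symmetric[OF H] gen_hessian_nonneg[OF H] _ u] inv H by auto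
  qed
  have form_ge: "m * (norm d)\<^sup>2 \<le> hess_form V W d"
    if V: "V \<in> clarke_jacobian F1 xh" and W: "W \<in> clarke_jacobian F2 (A *v xh)" for V W d
  proof (cases "d = 0")
    case False
    define u where "u = d /\<^sub>R norm d"
    have "(V, W, u) \<in> S" using V W False by (simp add: S_def u_def)
    then have "m \<le> hess_form V W u" using s(2) unfolding m_def by fastforce
    then have "(norm d)\<^sup>2 * m \<le> (norm d)\<^sup>2 * hess_form V W u" by (rule mult_left_mono) simp
    moreover have "hess_form V W (k *\<^sub>R u) = k\<^sup>2 * hess_form V W u" for k
      by (simp add: hess_form_def matrix_vector_mult_scaleR restrict_idx_linear power_mult_distrib power2_eq_square
          algebra_simps)
    moreover have "d = norm d *\<^sub>R u" using False by (simp add: u_def)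
    ultimately show ?thesis by (metis mult.commute)
  next
    case True
    have "restrict_idx T (0 :: real^'p) = 0" by (simp add: vec_eq_iff restrict_idx_nth)
    then show ?thesis by (simp add: True hess_form_def)
  qed
  \<comment> \<open>Perturbing \<open>V\<close> and \<open>W\<close> by \<epsilon> lowers the form
    by at most \<open>\<epsilon> * (1 + (norm A)\<^sup>2) * (norm d)\<^sup>2\<close>, so half of
    \<open>m\<close> remains.\<close>
  define \<epsilon> where "\<epsilon> = m / (2 * (1 + (norm A)\<^sup>2))"
  have pos: "1 + (norm A)\<^sup>2 > 0" by (simp add: add_pos_nonneg)
  have \<epsilon>: "\<epsilon> > 0" using m pos by (simp add: \<epsilon>_def)
  obtain \<delta>1 where \<delta>1: "\<delta>1 > 0"
    "\<And>y J. norm (y - xh) < \<delta>1 \<Longrightarrow> J \<in> clarke_jacobian F1 y \<Longrightarrow> \<exists>K\<in>clarke_jacobian F1 xh. norm (J - K) < \<epsilon>"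
    using F1.clarke_upper_semicontinuous[OF \<epsilon>] by blast
  obtain \<delta>2 where \<delta>2: "\<delta>2 > 0"
    "\<And>y J. norm (y - A *v xh) < \<delta>2 \<Longrightarrow> J \<in> clarke_jacobian F2 y \<Longrightarrow> \<exists>K\<in>clarke_jacobian F2 (A *v xh). norm (J - K) < \<epsilon>"
    using F2.clarke_upper_semicontinuous[OF \<epsilon>] by blast
  have nA: "norm A + 1 > 0" by (simp add: add_nonneg_pos)
  have pert: "- (\<epsilon> * (norm d)\<^sup>2) \<le> (J *v d) \<bullet> d - (K *v d) \<bullet> d"
    if "norm (J - K) < \<epsilon>" for J K :: "real^'k^'k" and d
  proof -
    have "\<bar>((J - K) *v d) \<bullet> d\<bar> \<le> norm ((J - K) *v d) * norm d" by (rule Cauchy_Schwarz_ineq2)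
    also have "\<dots> \<le> (norm (J - K) * norm d) * norm d" by (intro mult_right_mono norm_matrix_vector_mult_le) simp
    also have "\<dots> \<le> (\<epsilon> * norm d) * norm d" using that by (intro mult_right_mono) auto
    finally show ?thesis
      by (simp add: matrix_vector_mult_diff_rdistrib inner_diff_left power2_eq_square mult.assoc)
  qed
  show ?thesis
  proof (rule that[of "m / 2" "min \<delta>1 (\<delta>2 / (norm A + 1))"])
    show "m / 2 > 0" "min \<delta>1 (\<delta>2 / (norm A + 1)) > 0" using m \<delta>1 \<delta>2 nA by auto
    fix x H d assume x: "norm (x - xh) < min \<delta>1 (\<delta>2 / (norm A + 1))" and H: "H \<in> gen_hessian f g A B \<gamma> wk T x"
    obtain V W where V: "V \<in> clarke_jacobian F1 x" and W: "W \<in> clarke_jacobian F2 (A *v x)"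
      and Hd: "\<And>d. H *v d = V *v d + transpose A *v (W *v (A *v d)) + \<gamma> *\<^sub>R (transpose B *v restrict_idx T (B *v d))"
      using H by (rule gen_hessianE) blast
    obtain V' where V': "V' \<in> clarke_jacobian F1 xh" "norm (V - V') < \<epsilon>" using \<delta>1(2)[OF _ V] x by auto
    have "norm (x - xh) * (norm A + 1) < \<delta>2" using x nA by (simp add: pos_less_divide_eq)
    moreover have "norm (A *v x - A *v xh) \<le> norm A * norm (x - xh)"
      by (metis matrix_vector_mult_diff_distrib norm_matrix_vector_mult_le)
    moreover have "norm (x - xh) * (norm A + 1) = norm A * norm (x - xh) + norm (x - xh)"
      by (simp add: algebra_simps)
    ultimately have "norm (A *v x - A *v xh) < \<delta>2" using norm_ge_zero[of "x - xh"] by linarith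
    then obtain W' where W': "W' \<in> clarke_jacobian F2 (A *v xh)" "norm (W - W') < \<epsilon>" using \<delta>2(2)[OF _ W] by auto
    have "(norm (A *v d))\<^sup>2 \<le> (norm A * norm d)\<^sup>2" by (intro power_mono norm_matrix_vector_mult_le) simp
    then have "\<epsilon> * (norm (A *v d))\<^sup>2 \<le> \<epsilon> * ((norm A)\<^sup>2 * (norm d)\<^sup>2)"
      using \<epsilon> by (intro mult_left_mono) (auto simp: power_mult_distrib)
    then have "hess_form V W d \<ge> hess_form V' W' d - \<epsilon> * (norm d)\<^sup>2 - \<epsilon> * ((norm A)\<^sup>2 * (norm d)\<^sup>2)"
      using pert[OF V'(2), of d] pert[OF W'(2), of "A *v d"] by (simp add: hess_form_def)
    moreover have "\<epsilon> * (norm d)\<^sup>2 + \<epsilon> * ((norm A)\<^sup>2 * (norm d)\<^sup>2) = \<epsilon> * (1 + (norm A)\<^sup>2) * (norm d)\<^sup>2"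
      by (simp add: algebra_simps)
    moreover have "m / (2 * k) * k = m / 2" if "k > 0" for k using that by simp
    then have "\<epsilon> * (1 + (norm A)\<^sup>2) = m / 2" unfolding \<epsilon>_def using pos by blast
    ultimately have "m / 2 * (norm d)\<^sup>2 \<le> hess_form V W d" using form_ge[OF V'(1) W'(1), of d] by simp
    then show "m / 2 * (norm d)\<^sup>2 \<le> (H *v d) \<bullet> d" by (simp add: hf[OF Hd])
  qed
qed

section \<open>Dual recovery and the dual subproblem\<close>

lemma dual_recovery_eq: "dual_recovery g A B \<gamma> wk T x = (F2 (A *v x), F3 (B *v x))"
  by (simp add: dual_recovery_def F2_def F3_def add.commute)

text \<open>This bound turns the primal error into a majorant of the dual one, which is how a Q-rate
  becomes an R-rate.\<close>

lemma dual_recovery_lipschitz: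
  "norm (dual_recovery g A B \<gamma> wk T x - dual_recovery g A B \<gamma> wk T y) \<le> \<gamma> * (norm A + norm B) * norm (x - y)"
proof -
  have AB: "norm (A *v x - A *v y) \<le> norm A * norm (x - y)" "norm (B *v x - B *v y) \<le> norm B * norm (x - y)"
    by (metis matrix_vector_mult_diff_distrib norm_matrix_vector_mult_le)+
  have "norm (F2 (A *v x) - F2 (A *v y)) \<le> \<gamma> * (norm A * norm (x - y))"
    using smooth_convexD(4)[OF smooth_F2, of "A *v x" "A *v y"] AB(1) \<gamma> by (meson mult_left_mono less_imp_le order_trans)
  moreover have "norm (F3 (B *v x) - F3 (B *v y)) \<le> \<gamma> * (norm B * norm (x - y))"
    using smooth_convexD(4)[OF smooth_F3, of "B *v x" "B *v y"] AB(2) \<gamma> by (meson mult_left_mono less_imp_le order_trans)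
  ultimately show ?thesis unfolding dual_recovery_eq
    using norm_Pair_le[of "F2 (A *v x) - F2 (A *v y)" "F3 (B *v x) - F3 (B *v y)"] by (simp add: algebra_simps)
qed

text \<open>Adjointness of \<open>Q_op\<close> and \<open>QT_op\<close> splits the
  \<open>M\<close>-norm into three squares, one for each proximal objective.\<close>

lemma inner_M_op: "u \<bullet> M_op A B u = (norm (QT_op A B u))\<^sup>2 + (norm (fst u))\<^sup>2 + (norm (snd u))\<^sup>2"
proof -
  have "u \<bullet> Q_op A B r = QT_op A B u \<bullet> r" for r
    by (simp add: Q_op_def QT_op_def inner_prod_def inner_add_left inner_transpose del: transpose_matrix_vector)
  then show ?thesis
    by (simp add: M_op_def inner_add_right power2_norm_eq_inner) (simp add: inner_prod_def)
qed

text \<open>With \<open>q = - Q\<^sup>T w\<close> the terms linear in \<open>w\<close> that arise from completing the squares add up to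
  \<open>\<langle>q + Q\<^sup>T w, x\<rangle> = 0\<close>, for every \<open>x\<close>.\<close>

lemma Xi_k_eq_prox_objectives:
  fixes x :: "real^'n"
  obtains K where "\<And>w. Xi_k f g A B \<gamma> wk w =
     prox_objective \<gamma> (fenchel_conj f) (\<gamma> *\<^sub>R x + (- QT_op A B wk)) (- QT_op A B w)
     + prox_objective \<gamma> (fenchel_conj g) (\<gamma> *\<^sub>R (A *v x) + fst wk) (fst w)
     + ereal (1 / (2 * \<gamma>) * (norm (snd w - (\<gamma> *\<^sub>R (B *v x) + snd wk)))\<^sup>2 + K)"
proof -
  define v1 v2 v3 where "v1 = \<gamma> *\<^sub>R x + (- QT_op A B wk)" and "v2 = \<gamma> *\<^sub>R (A *v x) + fst wk"
    and "v3 = \<gamma> *\<^sub>R (B *v x) + snd wk"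
  \<comment> \<open>This collects what remains, independently of \<open>w\<close>, after the squares
    are recentred at \<open>v1\<close>, \<open>v2\<close> and \<open>v3\<close>.\<close>
  define K where "K = \<gamma> / 2 * ((norm x)\<^sup>2 + (norm (A *v x))\<^sup>2 + (norm (B *v x))\<^sup>2)
    - (v1 \<bullet> x + v2 \<bullet> (A *v x) + v3 \<bullet> (B *v x))"
  have sq: "1 / (2 * \<gamma>) * (norm (a + \<gamma> *\<^sub>R b))\<^sup>2 = 1 / (2 * \<gamma>) * (norm a)\<^sup>2 + a \<bullet> b + \<gamma> / 2 * (norm b)\<^sup>2"
    for a b :: "real^'k"
    unfolding norm_add_sq using \<gamma> by (simp add: power_mult_distrib field_simps power2_eq_square)
  show ?thesis
  proof (rule that[of K])
    fix w :: "(real^'m) \<times> (real^'p)"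
    define q where "q = - QT_op A B w"
    have QT: "QT_op A B (w - wk) = - ((q - v1) + \<gamma> *\<^sub>R x)"
      by (simp add: q_def v1_def QT_op_def matrix_vector_mult_diff_distrib del: transpose_matrix_vector)
    have y: "fst (w - wk) = (fst w - v2) + \<gamma> *\<^sub>R (A *v x)" by (simp add: v2_def)
    have z: "snd (w - wk) = (snd w - v3) + \<gamma> *\<^sub>R (B *v x)" by (simp add: v3_def)
    have lin: "q \<bullet> x + fst w \<bullet> (A *v x) + snd w \<bullet> (B *v x) = 0"
      by (simp add: q_def QT_op_def inner_add_left inner_diff_left inner_transpose inner_minus_left del: transpose_matrix_vector)
    have "1 / (2 * \<gamma>) * ((w - wk) \<bullet> M_op A B (w - wk))
        = 1 / (2 * \<gamma>) * (norm ((q - v1) + \<gamma> *\<^sub>R x))\<^sup>2 + 1 / (2 * \<gamma>) * (norm ((fst w - v2) + \<gamma> *\<^sub>R (A *v x)))\<^sup>2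
          + 1 / (2 * \<gamma>) * (norm ((snd w - v3) + \<gamma> *\<^sub>R (B *v x)))\<^sup>2"
      unfolding inner_M_op QT norm_minus_cancel y z by (simp only: distrib_left)
    also have "\<dots> = 1 / (2 * \<gamma>) * (norm (q - v1))\<^sup>2 + 1 / (2 * \<gamma>) * (norm (fst w - v2))\<^sup>2
        + 1 / (2 * \<gamma>) * (norm (snd w - v3))\<^sup>2 + K + (q \<bullet> x + fst w \<bullet> (A *v x) + snd w \<bullet> (B *v x))"
      unfolding sq K_def by (simp only: inner_diff_left distrib_left)
    finally have M: "1 / (2 * \<gamma>) * ((w - wk) \<bullet> M_op A B (w - wk)) =
      1 / (2 * \<gamma>) * (norm (q - v1))\<^sup>2 + 1 / (2 * \<gamma>) * (norm (fst w - v2))\<^sup>2 + (1 / (2 * \<gamma>) * (norm (snd w - v3))\<^sup>2 + K)"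
      using lin by simp
    show "Xi_k f g A B \<gamma> wk w =
     prox_objective \<gamma> (fenchel_conj f) (\<gamma> *\<^sub>R x + (- QT_op A B wk)) (- QT_op A B w)
     + prox_objective \<gamma> (fenchel_conj g) (\<gamma> *\<^sub>R (A *v x) + fst wk) (fst w)
     + ereal (1 / (2 * \<gamma>) * (norm (snd w - (\<gamma> *\<^sub>R (B *v x) + snd wk)))\<^sup>2 + K)"
      unfolding Xi_k_def Xi_def M v1_def[symmetric] v2_def[symmetric] v3_def[symmetric] q_def[symmetric]
        prox_objective_def
      by (simp only: plus_ereal.simps(1)[symmetric] add_ac)
  qed
qed

lemma dual_recovery_unique_minimizer:
  assumes G0: "grad_Psi x = 0"
  shows "unique_minimizer (Xi_k f g A B \<gamma> wk) (\<lambda>w. \<forall>i. i \<notin> T \<longrightarrow> snd w $ i = 0) (dual_recovery g A B \<gamma> wk T x)"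
proof -
  define y z p where "y = F2 (A *v x)" and "z = F3 (B *v x)" and "p = F1 x"
  define wh where "wh = (y, z)"
  have wh: "dual_recovery g A B \<gamma> wk T x = wh" by (simp add: dual_recovery_eq wh_def y_def z_def)
  \<comment> \<open>Stationarity is precisely the compatibility of the three minimizers: the first
    objective is evaluated at \<open>- QT_op A B wh\<close>, and this has to be its proximal
    point.\<close>
  have p: "- QT_op A B wh = p"
    using G0 by (simp add: grad_Psi_def QT_op_def wh_def y_def z_def p_def add_eq_0_iff2 add.assoc)
  obtain K where Xi: "\<And>w. Xi_k f g A B \<gamma> wk w =
     prox_objective \<gamma> (fenchel_conj f) (\<gamma> *\<^sub>R x + (- QT_op A B wk)) (- QT_op A B w)
     + prox_objective \<gamma> (fenchel_conj g) (\<gamma> *\<^sub>R (A *v x) + fst wk) (fst w)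
     + ereal (1 / (2 * \<gamma>) * (norm (snd w - (\<gamma> *\<^sub>R (B *v x) + snd wk)))\<^sup>2 + K)"
    using Xi_k_eq_prox_objectives by blast
  define v3 where "v3 = \<gamma> *\<^sub>R (B *v x) + snd wk"
  obtain a where a: "prox_objective \<gamma> (fenchel_conj f) (\<gamma> *\<^sub>R x + (- QT_op A B wk)) p = ereal a"
    "\<And>q. ereal (a + 1 / (2 * \<gamma>) * (norm (q - p))\<^sup>2) \<le> prox_objective \<gamma> (fenchel_conj f) (\<gamma> *\<^sub>R x + (- QT_op A B wk)) q"
    using prox_conj_optimal[OF f \<gamma>] unfolding p_def F1_def by metis
  obtain b where b: "prox_objective \<gamma> (fenchel_conj g) (\<gamma> *\<^sub>R (A *v x) + fst wk) y = ereal b"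
    "\<And>q. ereal (b + 1 / (2 * \<gamma>) * (norm (q - y))\<^sup>2) \<le> prox_objective \<gamma> (fenchel_conj g) (\<gamma> *\<^sub>R (A *v x) + fst wk) q"
    using prox_conj_optimal[OF g \<gamma>] unfolding y_def F2_def by metis
  define C where "C = a + b + (1 / (2 * \<gamma>) * (norm (z - v3))\<^sup>2 + K)"
  have val: "Xi_k f g A B \<gamma> wk wh = ereal C"
    by (simp only: Xi wh_def p[unfolded wh_def] a(1) fst_conv snd_conv b(1) C_def v3_def plus_ereal.simps)
  have strong: "ereal (C + 1 / (2 * \<gamma>) * ((norm (fst w - y))\<^sup>2 + (norm (snd w - z))\<^sup>2)) \<le> Xi_k f g A B \<gamma> wk w"
    if feas: "\<forall>i. i \<notin> T \<longrightarrow> snd w $ i = 0" for w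
  proof -
    \<comment> \<open>On \<open>T\<close> the point \<open>z\<close> agrees with \<open>v3\<close>,
      and off \<open>T\<close> both \<open>snd w\<close> and \<open>z\<close> vanish, so every
      summand is zero: \<open>z\<close> is the projection of \<open>v3\<close> onto the feasible
      subspace.\<close>
    have "(snd w - z) \<bullet> (z - v3) = 0"
      using feas by (auto simp: inner_vec_def z_def F3_def v3_def restrict_idx_nth intro!: sum.neutral)
    moreover have "snd w - v3 = (snd w - z) + (z - v3)" by simp
    ultimately have pyth: "(norm (snd w - v3))\<^sup>2 = (norm (snd w - z))\<^sup>2 + (norm (z - v3))\<^sup>2"
      by (simp only: norm_add_sq)
    \<comment> \<open>The first objective contributes only its minimal value; the quadratic gains in
      the \<open>y\<close> and \<open>z\<close> blocks already determine \<open>w\<close>.\<close>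
    have "ereal a \<le> prox_objective \<gamma> (fenchel_conj f) (\<gamma> *\<^sub>R x + (- QT_op A B wk)) (- QT_op A B w)"
      using \<gamma> by (intro order_trans[OF _ a(2)]) simp
    then have "ereal a + ereal (b + 1 / (2 * \<gamma>) * (norm (fst w - y))\<^sup>2)
        + ereal (1 / (2 * \<gamma>) * (norm (snd w - v3))\<^sup>2 + K) \<le> Xi_k f g A B \<gamma> wk w"
      unfolding Xi v3_def by (intro add_mono b(2) order_refl)
    then show ?thesis by (simp add: C_def pyth algebra_simps)
  qed
  have feas: "\<forall>i. i \<notin> T \<longrightarrow> snd wh $ i = 0" by (simp add: wh_def z_def F3_def restrict_idx_nth)
  show ?thesis unfolding unique_minimizer_def wh
  proof (intro conjI allI impI)
    have "ereal C \<le> Xi_k f g A B \<gamma> wk w" if "\<forall>i. i \<notin> T \<longrightarrow> snd w $ i = 0" for w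
      using \<gamma> by (intro order_trans[OF _ strong[OF that]]) simp
    then show "is_arg_min (Xi_k f g A B \<gamma> wk) (\<lambda>w. \<forall>i. i \<notin> T \<longrightarrow> snd w $ i = 0) wh"
      unfolding is_arg_min_def val using feas by (meson not_less)
    fix w assume w: "is_arg_min (Xi_k f g A B \<gamma> wk) (\<lambda>w. \<forall>i. i \<notin> T \<longrightarrow> snd w $ i = 0) w"
    then have "\<not> Xi_k f g A B \<gamma> wk wh < Xi_k f g A B \<gamma> wk w" using feas unfolding is_arg_min_def by blast
    then have "Xi_k f g A B \<gamma> wk w \<le> ereal C" by (simp add: val not_less)
    moreover have "\<forall>i. i \<notin> T \<longrightarrow> snd w $ i = 0" using w by (simp add: is_arg_min_def)
    ultimately have "ereal (C + 1 / (2 * \<gamma>) * ((norm (fst w - y))\<^sup>2 + (norm (snd w - z))\<^sup>2)) \<le> ereal C"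
      using strong order_trans by blast
    then have "(norm (fst w - y))\<^sup>2 + (norm (snd w - z))\<^sup>2 \<le> 0"
      using \<gamma> by (simp add: divide_le_0_iff)
    then show "w = wh" by (simp add: wh_def prod_eq_iff add_nonneg_eq_0_iff sum_power2_le_zero_iff)
  qed
qed

end

theorem theorem5:
  fixes f :: "real^'n \<Rightarrow> ereal" and g :: "real^'m \<Rightarrow> ereal"
    and A :: "real^'n^'m" and B :: "real^'n^('p::{finite,linorder})"
    and \<mu> :: "real^('p::{finite,linorder})" and \<gamma>k :: real
    and xk :: "real^'n" and yk :: "real^'m" and zk zt :: "real^('p::{finite,linorder})"
    and T :: "'p::{finite,linorder} set"
    and \<tau> \<tau>1 \<tau>2 \<beta> \<zeta> :: real
    and xbar :: "nat \<Rightarrow> real^'n" and wbar :: "nat \<Rightarrow> (real^'m) \<times> (real^('p::{finite,linorder}))"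
    and xhat :: "real^'n"
  assumes f: "proper_closed_convex f" and g: "proper_closed_convex g"
    and mu: "\<And>i. \<mu> $ i > 0" and gamma: "\<gamma>k > 0"
    and zt: "coordinate_cycle f g A B \<mu> \<gamma>k (yk, zk) zt"
    and T: "T = {i. zt $ i \<noteq> 0}"
    and params: "\<tau> \<in> {0<..1}" "\<tau>1 \<in> {0<..<1}" "\<tau>2 \<in> {0<..<1}" "\<beta> \<in> {0<..<1}"
      "\<zeta> \<in> {0<..<1/2}"
    and coercive: "coercive f"
    and SNA: "SNA_sequence f g A B \<gamma>k (yk, zk) T \<tau> \<tau>1 \<tau>2 \<beta> \<zeta> xk xbar wbar"
    and semismooth: "\<And>\<gamma>. \<gamma> > 0 \<Longrightarrow>
      semismooth (prox \<gamma> (fenchel_conj f)) \<and> semismooth (prox \<gamma> (fenchel_conj g))"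
    and accumulation: "\<exists>r. strict_mono r \<and> (xbar \<circ> r) \<longlonglongrightarrow> xhat"
    and nonsingular: "\<forall>H\<in>gen_hessian f g A B \<gamma>k (yk, zk) T xhat. invertible H"
  shows "unique_minimizer (Psi_k f g A B \<gamma>k (yk, zk) T) (\<lambda>_. True) xhat \<and>
    xbar \<longlonglongrightarrow> xhat \<and>
    (\<lambda>j. norm (xbar (Suc j) - xhat)) \<in> o(\<lambda>j. norm (xbar j - xhat)) \<and>
    (\<exists>what. unique_minimizer (Xi_k f g A B \<gamma>k (yk, zk)) (\<lambda>w. \<forall>i. i \<notin> T \<longrightarrow> snd w $ i = 0) what \<and>
      wbar \<longlonglongrightarrow> what \<and> R_superlinear wbar what)"
proof -
  interpret subproblem f g A B \<gamma>k "(yk, zk)" T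
    using f g gamma semismooth by unfold_locales auto
  let ?\<Psi> = "Psi_k f g A B \<gamma>k (yk, zk) T" and ?H = "gen_hessian f g A B \<gamma>k (yk, zk) T"
  let ?R = "dual_recovery g A B \<gamma>k (yk, zk) T"
  obtain c \<delta> where c: "c > 0" "\<delta> > 0"
    "\<And>x H d. norm (x - xhat) < \<delta> \<Longrightarrow> H \<in> ?H x \<Longrightarrow> c * (norm d)\<^sup>2 \<le> (H *v d) \<bullet> d"
    using gen_hessian_uniformly_positive[OF nonsingular] by blast
  interpret newton_problem ?\<Psi> grad_Psi ?H lip c \<delta> xhat \<tau> \<tau>1 \<tau>2 \<beta> \<zeta>
    by unfold_locales
      (use params smooth_Psi gen_hessian_symmetric gen_hessian_nonneg gen_hessian_norm_le c
        gen_hessian_semismooth grad_Psi_directional in \<open>(blast | simp)+\<close>)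
  \<comment> \<open>Bundling one iteration into a single predicate lets the three witnesses be
    chosen for all \<open>j\<close> at once.\<close>
  define step where "step j H d q \<longleftrightarrow> H \<in> ?H (xbar j) \<and>
     newton_direction \<tau> \<tau>1 \<tau>2 H (grad_Psi (xbar j)) d \<and>
     armijo ?\<Psi> \<beta> \<zeta> (xbar j) d q \<and> (\<forall>q'<q. \<not> armijo ?\<Psi> \<beta> \<zeta> (xbar j) d q') \<and>
     xbar (Suc j) = xbar j + \<beta> ^ q *\<^sub>R d \<and> wbar j = ?R (xbar j)" for j H d q
  have "\<forall>j. \<exists>H d q. step j H d q"
    using SNA unfolding SNA_sequence_def Let_def smooth_convex_grad[OF smooth_Psi] step_def by blast
  then obtain H d q where Hdq: "\<And>j. step j (H j) (d j) (q j)" by metis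
  obtain r where r: "strict_mono r" "(xbar \<circ> r) \<longlonglongrightarrow> xhat" using accumulation by blast
  have H: "H j \<in> ?H (xbar j)" and nd: "newton_direction \<tau> \<tau>1 \<tau>2 (H j) (grad_Psi (xbar j)) (d j)"
    and ar: "armijo ?\<Psi> \<beta> \<zeta> (xbar j) (d j) (q j)" and Suc: "xbar (Suc j) = xbar j + \<beta> ^ q j *\<^sub>R d j"
    and wbar: "wbar j = ?R (xbar j)" for j
    using Hdq[of j] by (auto simp: step_def)
  have q: "\<not> armijo ?\<Psi> \<beta> \<zeta> (xbar j) (d j) p" if "p < q j" for j p
    using Hdq[of j] that by (auto simp: step_def)
  note seq = H nd ar q Suc r
  have stationary: "grad_Psi xhat = 0" by (rule limit_stationary[OF seq])
  have lim: "xbar \<longlonglongrightarrow> xhat" by (rule iterates_tendsto[OF seq])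
  have superlinear: "(\<lambda>j. norm (xbar (Suc j) - xhat)) \<in> o(\<lambda>j. norm (xbar j - xhat))"
    by (rule iterates_superlinear[OF seq])
  define C where "C = \<gamma>k * (norm A + norm B)"
  have C: "C \<ge> 0" using gamma by (simp add: C_def)
  \<comment> \<open>The majorant inherits the primal superlinear rate by scaling; for
    \<open>C = 0\<close> it is the zero sequence and the little-o relation still holds.\<close>
  define e where "e j = C * norm (xbar j - xhat)" for j
  have we: "norm (wbar j - ?R xhat) \<le> e j" for j
    unfolding wbar e_def C_def by (rule dual_recovery_lipschitz)
  have e0: "e \<longlonglongrightarrow> 0" unfolding e_def
    by (intro tendsto_mult_right_zero tendsto_norm_zero LIM_zero lim)
  have "(\<lambda>j. e (Suc j)) \<in> o(e)"
  proof (rule landau_o.smallI)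
    fix k :: real assume "k > 0"
    with superlinear have "\<forall>\<^sub>F j in sequentially. norm (norm (xbar (Suc j) - xhat)) \<le> k * norm (norm (xbar j - xhat))"
      by (rule landau_o.smallD)
    then show "\<forall>\<^sub>F j in sequentially. norm (e (Suc j)) \<le> k * norm (e j)"
    proof eventually_elim
      case (elim j)
      then have "C * norm (xbar (Suc j) - xhat) \<le> C * (k * norm (xbar j - xhat))"
        using C by (intro mult_left_mono) auto
      then show ?case using C by (simp add: e_def abs_mult mult.left_commute)
    qed
  qed
  then have "R_superlinear wbar (?R xhat)"
    unfolding R_superlinear_def using we e0 C by (intro exI[of _ e]) (auto simp: e_def)
  moreover have "(\<lambda>j. wbar j - ?R xhat) \<longlonglongrightarrow> 0"
    by (rule Lim_null_comparison[OF always_eventually e0]) (use we in blast)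
  then have "wbar \<longlonglongrightarrow> ?R xhat" by (rule LIM_zero_cancel)
  ultimately show ?thesis
    using unique_minimizer_if_stationary[OF stationary gen_hessian_nonempty] lim superlinear
      dual_recovery_unique_minimizer[OF stationary] by blast
qed

end
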